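(* Let $t > \ell \ge 3$ be fixed integers. Then for all sufficiently large $n$, \[ \mathrm{ar}(n,H_{F}^{3}) = \begin{cases} t_{3}(n,\ell) + \ell+1, & \text{if } F \in \{K_{\ell}^{\alpha}[t],\ K_{\ell}^{\beta}[t]\},\\ t_{3}(n,\ell) + 2, & \text{if } F = K_{\ell}^{\gamma}[t].\end{cases} \]
   Context: A 3-graph is a collection of 3-subsets of a finite vertex set. $K_n^3$ is the complete 3-graph on $[n]$. Given $\chi\colon K_n^3\to\mathbb{N}$, a subgraph is rainbow if no two of its edges receive the same color. $\mathrm{ar}(n,F)$ is the minimum $m$ such that every surjective map $\chi\colon K_n^3\to[m]$ contains a rainbow copy of the 3-graph $F$. For a graph $F$, the expansion $H_F^3$ is the 3-graph obtained from $F$ by adding to each edge one new vertex, different edges receiving different new vertices. $K_\ell[t]$ is the $t$-blowup of $K_\ell$, i.e. the complete $\ell$-partite graph with all parts of size $t$. $K_\ell^\alpha[t]$ is obtained from $K_\ell[t]$ by adding a path with two edges inside one part; $K_\ell^\beta[t]$ by adding two disjoint edges inside one part; $K_\ell^\gamma[t]$ by adding two edges inside two different parts (one edge in each). For $n\ge r$, let $V_1\sqcup\cdots\sqcup V_\ell=[n]$ with $|V_\ell|+1\ge|V_1|\ge\cdots\ge|V_\ell|$; $T_r(n,\ell)$ is the $r$-graph of all $r$-subsets of $[n]$ containing at most one vertex from each $V_i$, and $t_r(n,\ell)$ is its number of edges. *)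

theory Defs
  imports Complex_Main "HOL-Library.Disjoint_Sets"
begin

text \<open>Graphs and hypergraphs are sets of edges; the vertex set of a (hyper)graph \<open>F\<close> is \<open>\<Union>F\<close>.
  All (hyper)graphs below that get embedded have no isolated vertices.\<close>

definition complete_hypergraph :: "nat \<Rightarrow> nat \<Rightarrow> nat set set" where
  "complete_hypergraph r n = {e. e \<subseteq> {1..n} \<and> card e = r}"

definition is_copy_of :: "'b set set \<Rightarrow> 'a set set \<Rightarrow> bool" where
  "is_copy_of H F \<longleftrightarrow> (\<exists>\<phi>. inj_on \<phi> (\<Union>F) \<and> H = (\<lambda>e. \<phi> ` e) ` F)"

definition rainbow :: "('a set \<Rightarrow> nat) \<Rightarrow> 'a set set \<Rightarrow> bool" where
  "rainbow \<chi> H \<longleftrightarrow> inj_on \<chi> H"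

text \<open>The bound \<open>m \<ge> 1\<close> is needed: for \<open>n \<ge> 3\<close> there is no map from the complete 3-graph
  to the empty set of colours, so \<open>m = 0\<close> would satisfy the condition vacuously.\<close>

definition anti_ramsey :: "nat \<Rightarrow> 'a set set \<Rightarrow> nat" where
  "anti_ramsey n F = (LEAST m. m \<ge> 1 \<and>
     (\<forall>\<chi> :: nat set \<Rightarrow> nat. \<chi> ` complete_hypergraph 3 n = {1..m} \<longrightarrow>
        (\<exists>H \<subseteq> complete_hypergraph 3 n. is_copy_of H F \<and> rainbow \<chi> H)))"

text \<open>The new vertex added to the edge \<open>e\<close> is \<open>Inr e\<close>.\<close>

definition expansion :: "'a set set \<Rightarrow> ('a + 'a set) set set" where
  "expansion F = (\<lambda>e. insert (Inr e) (Inl ` e)) ` F"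

text \<open>The vertex \<open>(i, a)\<close> is the \<open>a\<close>-th vertex of the \<open>i\<close>-th part.\<close>

definition blowup_K :: "nat \<Rightarrow> nat \<Rightarrow> (nat \<times> nat) set set" where
  "blowup_K l t = {{(i, a), (j, b)} | i a j b.
     i \<in> {1..l} \<and> j \<in> {1..l} \<and> i \<noteq> j \<and> a \<in> {1..t} \<and> b \<in> {1..t}}"

text \<open>By symmetry the added edges may be placed on fixed vertices. The added vertices lie in
  the blowup when \<open>t \<ge> 3\<close>, \<open>t \<ge> 4\<close>, and \<open>t, l \<ge> 2\<close>, respectively.\<close>

definition K_alpha :: "nat \<Rightarrow> nat \<Rightarrow> (nat \<times> nat) set set" where
  "K_alpha l t = blowup_K l t \<union> {{(1, 1), (1, 2)}, {(1, 2), (1, 3)}}"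

definition K_beta :: "nat \<Rightarrow> nat \<Rightarrow> (nat \<times> nat) set set" where
  "K_beta l t = blowup_K l t \<union> {{(1, 1), (1, 2)}, {(1, 3), (1, 4)}}"

definition K_gamma :: "nat \<Rightarrow> nat \<Rightarrow> (nat \<times> nat) set set" where
  "K_gamma l t = blowup_K l t \<union> {{(1, 1), (1, 2)}, {(2, 1), (2, 2)}}"

definition balanced_partition :: "nat \<Rightarrow> nat \<Rightarrow> (nat \<Rightarrow> nat set) \<Rightarrow> bool" where
  "balanced_partition n l V \<longleftrightarrow>
     disjoint_family_on V {1..l} \<and> (\<Union>i\<in>{1..l}. V i) = {1..n} \<and>
     (\<forall>i\<in>{1..l}. \<forall>j\<in>{1..l}. i \<le> j \<longrightarrow> card (V j) \<le> card (V i)) \<and>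
     card (V 1) \<le> card (V l) + 1"

definition turan_graph :: "nat \<Rightarrow> nat \<Rightarrow> nat \<Rightarrow> (nat \<Rightarrow> nat set) \<Rightarrow> nat set set" where
  "turan_graph r n l V =
     {e \<in> complete_hypergraph r n. \<forall>i\<in>{1..l}. card (e \<inter> V i) \<le> 1}"

text \<open>A balanced partition exists for \<open>l \<ge> 1\<close> (proved below) and its part sizes are determined
  by \<open>n\<close> and \<open>l\<close>, so the number of edges does not depend on the choice.\<close>

definition turan_number :: "nat \<Rightarrow> nat \<Rightarrow> nat \<Rightarrow> nat" where
  "turan_number r n l = card (turan_graph r n l (SOME V. balanced_partition n l V))"

lemma balanced_partition_exists:
  assumes "l \<ge> 1"
  shows "\<exists>V. balanced_partition n l V"
proof (induction n)
  case 0
  have "balanced_partition 0 l (\<lambda>_. {})"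
    by (simp add: balanced_partition_def disjoint_family_on_def)
  then show ?case by blast
next
  case (Suc n)
  then obtain V where V: "balanced_partition n l V" by blast
  have disj: "V i \<inter> V j = {}" if "i \<in> {1..l}" "j \<in> {1..l}" "i \<noteq> j" for i j
    using V that by (auto simp: balanced_partition_def disjoint_family_on_def)
  have un: "(\<Union>i\<in>{1..l}. V i) = {1..n}" using V by (simp add: balanced_partition_def)
  have mono: "card (V j) \<le> card (V i)" if "i \<in> {1..l}" "j \<in> {1..l}" "i \<le> j" for i j
    using V that by (simp add: balanced_partition_def)
  have bal: "card (V 1) \<le> card (V l) + 1" using V by (simp add: balanced_partition_def)
  have sub: "V i \<subseteq> {1..n}" if "i \<in> {1..l}" for i using un that by blast
  have fin: "finite (V i)" if "i \<in> {1..l}" for i using sub[OF that] finite_subset by blast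
  have new: "Suc n \<notin> V i" if "i \<in> {1..l}" for i using sub[OF that] by auto
  define k where "k = (LEAST k. k \<in> {1..l} \<and> card (V k) = card (V l))"
  have k: "k \<in> {1..l} \<and> card (V k) = card (V l)"
    unfolding k_def by (rule LeastI[of _ l]) (use assms in auto)
  have kl: "card (V i) \<noteq> card (V l)" if "i \<in> {1..l}" "i < k" for i
    using not_less_Least[of i "\<lambda>k. k \<in> {1..l} \<and> card (V k) = card (V l)"] that
    by (auto simp: k_def)
  have big: "card (V i) \<ge> card (V l) + 1" if "i \<in> {1..l}" "i < k" for i
    using kl[OF that] mono[of i l] that by auto
  define W where "W = V(k := insert (Suc n) (V k))"
  have cW: "card (W i) = (if i = k then card (V l) + 1 else card (V i))"
    if "i \<in> {1..l}" for i
    using that k fin new by (auto simp: W_def)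
  have "disjoint_family_on W {1..l}"
    using disj new k unfolding disjoint_family_on_def W_def by (auto; blast)
  moreover have "(\<Union>i\<in>{1..l}. W i) = {1..Suc n}"
  proof -
    have "(\<Union>i\<in>{1..l}. W i) = insert (Suc n) (\<Union>i\<in>{1..l}. V i)"
      using k by (auto simp: W_def split: if_splits)
    then show ?thesis unfolding un by auto
  qed
  moreover have "card (W j) \<le> card (W i)"
    if "i \<in> {1..l}" "j \<in> {1..l}" "i \<le> j" for i j
    using cW[OF that(1)] cW[OF that(2)] mono[OF that] mono[of k j] big[of i] k that
    by (auto split: if_splits)
  moreover have "card (W 1) \<le> card (W l) + 1"
    using cW[of 1] cW[of l] bal assms by (auto split: if_splits)
  ultimately have "balanced_partition (Suc n) l W"
    unfolding balanced_partition_def by blast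
  then show ?case by blast
qed

end

theory Submission
  imports Defs "HOL-Combinatorics.Multiset_Permutations" "HOL-Analysis.Convex"
begin

text \<open>
  Lower bound: give all transversal triples of a balanced partition distinct colours, and colour
  every other triple by the class that it meets twice (for \<open>K_gamma\<close>: by one common colour).
  A rainbow copy would colour the core of the expansion with at most one monochromatic edge per
  class. Since \<open>t > l\<close>, pigeonhole forces the classes to be the parts of the blowup, and then both
  extra edges are monochromatic.

  Upper bound: deleting vertices of small colour degree, we may assume that every vertex \<open>v\<close> sees
  at least as many private colours as in the extremal colouring. Call a pair adjacent if the
  triples through it carry many colours. All but \<open>O(n\<^sup>2)\<close> colours then lie on triangles of this
  graph, and adjacent pairs can be expanded greedily in a rainbow way. Hence the graph contains no
  \<open>l\<close>-partite blowup with one extra edge (the second extra edge may be expanded by any vertex), and by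
  Erdos' theorem on dense \<open>r\<close>-partite relations it has few \<open>(l+1)\<close>-cliques. The Moon-Moser
  inequalities, together with an average over all \<open>l\<close>-cliques \<open>x\<close> of the sets of vertices adjacent
  to all of \<open>x\<close> but one entry, give an almost complete \<open>l\<close>-partition. A vertex with many private
  colours must be adjacent to almost all of \<open>l - 1\<close> parts, so the partition extends to all
  vertices. Finally, two triples that each have two vertices in a common part get the same colour, as
  otherwise they could serve as the two expanded extra edges of a rainbow copy.
\<close>

section \<open>Complete multipartite structures in dense relations\<close>

text \<open>The value is exact, while stability describes the parts only up to a small error. What
  removes the error is the lower bound on private colours at every vertex; it is bought by passing
  to a subset \<open>S\<close>, which stays large because a colouring with one colour too many gains
  surplus with every deletion. Colours are counted directly and no representative triple per colour
  is chosen. A pair is rich if it carries more colours than a greedy expansion can block, that is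
  vertices plus twice the edges of the core graph. A poor pair thus accounts for boundedly many
  colours. An edge whose new vertex is fixed beforehand need not be rich: it blocks one vertex and
  one colour. With one extra edge treated so, the other cannot be a rich pair; with both treated so,
  the only obstruction to a rainbow copy is that their two colours agree. These two facts are all
  that is used of the absence of rainbow copies. Counting cliques takes the place of a removal lemma
  and keeps the constants explicit: \<open>q = 1 / (100 * l^3 * t)\<close> measures every defect of
  the partition.\<close>

lemma listset_Cons_subset:
  assumes "\<And>ys. ys \<in> listset As \<Longrightarrow> A \<subseteq> {x. x # ys \<in> R}"
  shows "listset (A # As) \<subseteq> R"
  using assms by (auto simp: set_Cons_def)

text \<open>Double counting in the manner of Kovari, Sos and Turan, by induction on the length: a
  positive fraction of the tails have linearly many heads, so some single \<open>t\<close>-set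
  \<open>T\<close> of heads serves a positive fraction of the tails, and the induction hypothesis
  applies to these with a smaller constant. The sets in \<open>As\<close> may overlap; for cliques
  disjointness will come from irreflexivity.\<close>

lemma blowup_in_dense_relation:
  fixes c :: real
  assumes "c > 0" "t \<ge> 1"
  shows "\<exists>n0. \<forall>S::'a set. \<forall>R. finite S \<longrightarrow> card S \<ge> n0 \<longrightarrow>
    R \<subseteq> {xs. set xs \<subseteq> S \<and> length xs = r} \<longrightarrow> real (card R) \<ge> c * real (card S) ^ r \<longrightarrow>
    (\<exists>As. length As = r \<and> (\<forall>A\<in>set As. A \<subseteq> S \<and> card A = t) \<and> listset As \<subseteq> R)"
  using assms(1)
proof (induction r arbitrary: c)
  case 0
  have "listset [] \<subseteq> R" if "R \<subseteq> {xs. set xs \<subseteq> (S::'a set) \<and> length xs = 0}" "real (card R) \<ge> c" for S R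
  proof -
    have "R \<noteq> {}" using that 0 by auto
    then show ?thesis using that(1) by auto
  qed
  then show ?case by (intro exI[of _ 0]) auto
next
  case (Suc r)
  \<comment> \<open>At least \<open>c/2 * n^r\<close> tails have at least \<open>d = c/2 * n\<close>
    heads, each then with \<open>d choose t \<ge> (d/t)^t\<close> sets of heads. Dividing by
    \<open>n^t\<close>, which bounds the number of \<open>t\<close>-sets, leaves
    \<open>c1 * n^r\<close>.\<close>
  define c1 where "c1 = c/2 * (c/(2*t))^t"
  have c1: "c1 > 0" using Suc.prems assms(2) by (simp add: c1_def)
  obtain n1 where n1: "\<forall>S::'a set. \<forall>R. finite S \<longrightarrow> card S \<ge> n1 \<longrightarrow>
    R \<subseteq> {xs. set xs \<subseteq> S \<and> length xs = r} \<longrightarrow> real (card R) \<ge> c1 * real (card S) ^ r \<longrightarrow>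
    (\<exists>As. length As = r \<and> (\<forall>A\<in>set As. A \<subseteq> S \<and> card A = t) \<and> listset As \<subseteq> R)"
    using Suc.IH[OF c1] by (elim exE)
  \<comment> \<open>The middle term gives \<open>c/2 * n \<ge> t\<close>, as the bound
    \<open>(d/t)^t\<close> for the binomial coefficient requires.\<close>
  define n0 where "n0 = n1 + nat \<lceil>2*t/c\<rceil> + 1"
  show ?case
  proof (intro exI[of _ n0] allI impI)
    fix S :: "'a set" and R
    assume fS: "finite S" and nS: "n0 \<le> card S"
      and RS: "R \<subseteq> {xs. set xs \<subseteq> S \<and> length xs = Suc r}"
      and cR: "c * real (card S) ^ Suc r \<le> real (card R)"
    define n where "n = card S"
    have npos: "n > 0" using nS by (auto simp: n_def n0_def)
    have nt: "c/2 * n \<ge> t"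
    proof -
      have "real n \<ge> 2*t/c" using nS by (simp add: n_def n0_def) linarith
      then show ?thesis using Suc.prems by (simp add: field_simps)
    qed
    define L where "L = {ys. set ys \<subseteq> S \<and> length ys = r}"
    have fL: "finite L" and cL: "card L = n ^ r"
      using finite_lists_length_eq[OF fS] card_lists_length_eq[OF fS] by (auto simp: L_def n_def)
    define D where "D ys = {x\<in>S. x # ys \<in> R}" for ys
    have fD: "finite (D ys)" and Dn: "card (D ys) \<le> n" for ys
      using fS by (auto simp: D_def n_def intro: card_mono)
    have fR: "finite R" using finite_subset[OF RS] finite_lists_length_eq[OF fS] by blast
    have "R = (\<lambda>(ys,x). x # ys) ` Sigma L D"
    proof (intro equalityI subsetI)
      fix xs assume "xs \<in> R"
      then obtain x ys where "xs = x # ys" "set xs \<subseteq> S" "length ys = r"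
        using RS by (cases xs) auto
      then show "xs \<in> (\<lambda>(ys,x). x # ys) ` Sigma L D"
        using \<open>xs \<in> R\<close> by (auto simp: L_def D_def image_iff)
    qed (auto simp: D_def)
    then have "card R = card (Sigma L D)"
      by (simp add: card_image inj_on_def split_beta)
    also have "\<dots> = (\<Sum>ys\<in>L. card (D ys))" using fL fD by simp
    finally have sumD: "real (card R) = (\<Sum>ys\<in>L. real (card (D ys)))" by simp
    \<comment> \<open>Tails with fewer than \<open>c/2 * n\<close> heads account for at most half of
      the guaranteed size of \<open>R\<close>.\<close>
    define P where "P = {ys\<in>L. real (card (D ys)) \<ge> c/2 * n}"
    have fP: "finite P" using fL by (simp add: P_def)
    have "(\<Sum>ys\<in>L. real (card (D ys))) \<le> (\<Sum>ys\<in>L. (if ys \<in> P then real n else 0) + c/2 * n)"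
    proof (intro sum_mono)
      fix ys assume "ys \<in> L"
      moreover have "real (card (D ys)) \<le> n" "0 \<le> c/2*n" using Dn[of ys] Suc.prems by auto
      ultimately show "real (card (D ys)) \<le> (if ys \<in> P then real n else 0) + c/2 * n"
        by (auto simp: P_def simp del: of_nat_le_iff)
    qed
    also have "\<dots> = real n * card P + n ^ r * (c/2 * n)"
      using fL by (simp add: sum.distrib cL sum.If_cases P_def Int_def)
    finally have "c * real n ^ Suc r \<le> real n * card P + n ^ r * (c/2 * n)"
      using cR sumD by (simp add: n_def)
    then have "n * (c/2 * n ^ r) \<le> n * card P" by (simp add: field_simps)
    then have cP: "c/2 * n ^ r \<le> card P" using npos by simp
    define TS where "TS = {T. T \<subseteq> S \<and> card T = t}"
    have fTS: "finite TS" using fS by (simp add: TS_def)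
    have cTS: "card TS = n choose t" using n_subsets[OF fS] by (simp add: TS_def n_def)
    have Dch: "card {T\<in>TS. T \<subseteq> D ys} \<ge> (c/2*n/t) ^ t" if "ys \<in> P" for ys
    proof -
      have "{T\<in>TS. T \<subseteq> D ys} = {T. T \<subseteq> D ys \<and> card T = t}" by (auto simp: TS_def D_def)
      then have "card {T\<in>TS. T \<subseteq> D ys} = card (D ys) choose t" using n_subsets[OF fD] by simp
      moreover have "real (card (D ys)) \<ge> c/2*n" using that by (simp add: P_def)
      moreover from this nt have "t \<le> card (D ys)" by linarith
      then have "(real (card (D ys)) / t) ^ t \<le> card (D ys) choose t"
        using binomial_ge_n_over_k_pow_k[of t "card (D ys)", where 'a=real] by simp
      moreover have "(c/2*n/t) ^ t \<le> (real (card (D ys)) / t) ^ t"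
        using calculation(2) Suc.prems by (intro power_mono divide_right_mono) auto
      ultimately show ?thesis by linarith
    qed
    have "(\<Sum>T\<in>TS. real (card {ys\<in>P. T \<subseteq> D ys})) = (\<Sum>ys\<in>P. real (card {T\<in>TS. T \<subseteq> D ys}))"
      using sum.swap_restrict[OF fTS fP, of "\<lambda>_ _. 1::real" "\<lambda>T ys. T \<subseteq> D ys"] by simp
    moreover have "(\<Sum>ys\<in>P. real (card {T\<in>TS. T \<subseteq> D ys})) \<ge> card P * (c/2*n/t) ^ t"
      using sum_bounded_below[of P "(c/2*n/t) ^ t" "\<lambda>ys. real (card {T\<in>TS. T \<subseteq> D ys})"] Dch by simp
    moreover have "card P * (c/2*n/t) ^ t \<ge> (c/2 * n ^ r) * (c/2*n/t) ^ t"
      using cP Suc.prems by (intro mult_right_mono) auto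
    moreover have "(c/2 * n ^ r) * (c/2*n/t) ^ t = (c1 * n^r) * n^t"
      by (simp add: c1_def power_divide power_mult_distrib)
    ultimately have big: "(\<Sum>T\<in>TS. real (card {ys\<in>P. T \<subseteq> D ys})) \<ge> (c1 * n^r) * n^t" by linarith
    have "\<exists>T\<in>TS. real (card {ys\<in>P. T \<subseteq> D ys}) \<ge> c1 * n^r"
    proof (rule ccontr)
      assume "\<not> ?thesis"
      then have small: "real (card {ys\<in>P. T \<subseteq> D ys}) < c1 * n^r" if "T \<in> TS" for T
        using that by (simp add: not_le)
      have "t \<le> n"
      proof -
        have "0 < c/2 * n ^ r" using Suc.prems npos by simp
        with cP have "P \<noteq> {}" by auto
        then obtain ys where "ys \<in> P" by blast
        then have "c/2*n \<le> card (D ys)" by (simp add: P_def)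
        also have "\<dots> \<le> n" using Dn[of ys] by simp
        finally have "c/2*n \<le> n" .
        then show ?thesis using nt by linarith
      qed
      then have "TS \<noteq> {}" using cTS by (metis card.empty binomial_eq_0_iff not_le)
      then have "(\<Sum>T\<in>TS. real (card {ys\<in>P. T \<subseteq> D ys})) < (\<Sum>T\<in>TS. c1 * n^r)"
        using fTS small by (intro sum_strict_mono) auto
      also have "\<dots> = real (n choose t) * (c1 * n^r)" by (simp add: cTS)
      also have "\<dots> \<le> real (n^t) * (c1 * n^r)"
        using binomial_le_pow[OF \<open>t \<le> n\<close>] c1 by (intro mult_right_mono) (simp_all only: of_nat_le_iff, simp)
      finally show False using big by (simp add: mult.commute)
    qed
    then obtain T where T: "T \<in> TS" "real (card {ys\<in>P. T \<subseteq> D ys}) \<ge> c1 * n^r" by blast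
    have "card {ys\<in>P. T \<subseteq> D ys} \<ge> c1 * real (card S)^r" using T by (simp add: n_def)
    moreover have "{ys\<in>P. T \<subseteq> D ys} \<subseteq> {xs. set xs \<subseteq> S \<and> length xs = r}" by (auto simp: P_def L_def)
    moreover have "card S \<ge> n1" using nS by (simp add: n0_def)
    ultimately obtain As where As: "length As = r" "\<forall>A\<in>set As. A \<subseteq> S \<and> card A = t"
      "listset As \<subseteq> {ys\<in>P. T \<subseteq> D ys}" using n1[rule_format, OF fS] by blast
    have "listset (T # As) \<subseteq> R"
      by (rule listset_Cons_subset) (use As(3) in \<open>auto simp: D_def\<close>)
    then show "\<exists>As. length As = Suc r \<and> (\<forall>A\<in>set As. A \<subseteq> S \<and> card A = t) \<and> listset As \<subseteq> R"
      using As T(1) by (intro exI[of _ "T # As"]) (auto simp: TS_def)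
  qed
qed

section \<open>Ordered cliques\<close>

locale finite_graph =
  fixes S :: "'a set" and adj :: "'a \<Rightarrow> 'a \<Rightarrow> bool"
  assumes finite_vertices: "finite S"
    and adj_sym: "adj x y \<Longrightarrow> adj y x"
    and adj_irrefl: "\<not> adj x x"
begin

text \<open>Lists instead of sets: each clique is counted \<open>r!\<close> times, which makes
  extension by a new head an exact recursion and allows averages over positions. As
  \<open>adj\<close> is symmetric and irreflexive, \<open>sorted_wrt adj\<close> amounts to distinct
  and pairwise adjacent.\<close>

definition cliques :: "nat \<Rightarrow> 'a list set" where
  "cliques r = {xs. set xs \<subseteq> S \<and> length xs = r \<and> sorted_wrt adj xs}"

definition nbrs :: "'a set \<Rightarrow> 'a set" where
  "nbrs A = {v\<in>S. \<forall>y\<in>A. adj v y}"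

definition arcs :: "'a set \<Rightarrow> ('a \<times> 'a) set" where
  "arcs A = {(u, v). u \<in> A \<and> v \<in> A \<and> adj u v}"

lemma finite_cliques: "finite (cliques r)"
  by (rule finite_subset[OF _ finite_lists_length_eq[OF finite_vertices, of r]])
     (auto simp: cliques_def)

lemma finite_nbrs: "finite (nbrs A)"
  using finite_vertices by (simp add: nbrs_def)

lemma finite_arcs: "A \<subseteq> S \<Longrightarrow> finite (arcs A)"
  by (rule finite_subset[of _ "S \<times> S"]) (use finite_vertices in \<open>auto simp: arcs_def\<close>)

lemma card_nbrs_le: "card (nbrs A) \<le> card S"
  using finite_vertices by (auto simp: nbrs_def intro: card_mono)

lemma mem_cliques_iff:
  "xs \<in> cliques r \<longleftrightarrow> set xs \<subseteq> S \<and> length xs = r \<and> distinct xs \<and>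
     (\<forall>x\<in>set xs. \<forall>y\<in>set xs. x \<noteq> y \<longrightarrow> adj x y)"
proof -
  have "sorted_wrt adj xs \<longleftrightarrow> distinct xs \<and> (\<forall>x\<in>set xs. \<forall>y\<in>set xs. x \<noteq> y \<longrightarrow> adj x y)"
  proof (induction xs)
    case (Cons a xs)
    have "(\<forall>x\<in>set xs. adj a x) \<longleftrightarrow>
      a \<notin> set xs \<and> (\<forall>y\<in>set xs. a \<noteq> y \<longrightarrow> adj a y) \<and> (\<forall>x\<in>set xs. x \<noteq> a \<longrightarrow> adj x a)"
      by (metis adj_sym adj_irrefl)
    moreover have "sorted_wrt adj (a # xs) \<longleftrightarrow> (\<forall>x\<in>set xs. adj a x) \<and> sorted_wrt adj xs" by simp
    ultimately show ?case using Cons.IH by auto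
  qed simp
  then show ?thesis by (auto simp: cliques_def)
qed

lemma cliques_Suc: "cliques (Suc r) = (\<lambda>(ys, x). x # ys) ` (SIGMA ys:cliques r. nbrs (set ys))"
proof (intro equalityI subsetI)
  fix xs assume "xs \<in> cliques (Suc r)"
  then show "xs \<in> (\<lambda>(ys, x). x # ys) ` (SIGMA ys:cliques r. nbrs (set ys))"
    by (cases xs) (auto simp: cliques_def nbrs_def image_iff)
qed (auto simp: cliques_def nbrs_def)

lemma sum_cliques_Suc:
  "(\<Sum>xs\<in>cliques (Suc r). g (hd xs) (tl xs)) = (\<Sum>ys\<in>cliques r. \<Sum>x\<in>nbrs (set ys). g x ys)"
  unfolding cliques_Suc
  by (subst sum.reindex)
     (auto simp: inj_on_def sum.Sigma finite_cliques finite_nbrs split_beta)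

lemma card_cliques_Suc: "card (cliques (Suc r)) = (\<Sum>ys\<in>cliques r. card (nbrs (set ys)))"
  using sum_cliques_Suc[of "\<lambda>_ _. 1::nat" r] by simp

lemma cliques_Suc_Suc:
  "cliques (Suc (Suc r)) = (\<lambda>(ys, u, v). u # v # ys) ` (SIGMA ys:cliques r. arcs (nbrs (set ys)))"
proof (intro equalityI subsetI)
  fix xs assume xs: "xs \<in> cliques (Suc (Suc r))"
  then obtain u v ys where "xs = u # v # ys" 
    by (cases xs; cases "tl xs") (auto simp: cliques_def)
  then show "xs \<in> (\<lambda>(ys, u, v). u # v # ys) ` (SIGMA ys:cliques r. arcs (nbrs (set ys)))"
    using xs by (auto simp: cliques_def nbrs_def arcs_def image_iff)
qed (auto simp: cliques_def nbrs_def arcs_def)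

lemma card_cliques_Suc_Suc:
  "card (cliques (Suc (Suc r))) = (\<Sum>ys\<in>cliques r. card (arcs (nbrs (set ys))))"
proof -
  have f: "finite (arcs (nbrs A))" for A by (rule finite_arcs) (auto simp: nbrs_def)
  have "card (cliques (Suc (Suc r))) = card (SIGMA ys:cliques r. arcs (nbrs (set ys)))"
    unfolding cliques_Suc_Suc by (intro card_image) (auto simp: inj_on_def)
  then show ?thesis using f by (simp add: finite_cliques)
qed

lemma cliques_0: "cliques 0 = {[]}" by (auto simp: cliques_def)

lemma nbrs_empty: "nbrs {} = S" by (simp add: nbrs_def)

lemma card_cliques_1: "card (cliques (Suc 0)) = card S"
  by (simp add: card_cliques_Suc cliques_0 nbrs_empty)

lemma card_cliques_2: "card (cliques 2) = card (arcs S)"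
  using card_cliques_Suc_Suc[of 0] by (simp add: cliques_0 nbrs_empty numeral_2_eq_2)

lemma card_cliques_Suc_le: "card (cliques (Suc r)) \<le> card S * card (cliques r)"
proof -
  have "card (cliques (Suc r)) \<le> (\<Sum>ys\<in>cliques r. card S)"
    unfolding card_cliques_Suc by (intro sum_mono card_nbrs_le)
  then show ?thesis by (simp add: mult.commute)
qed

text \<open>Moving entry \<open>i\<close> to the front (\<open>h\<close>, undone by
  \<open>k\<close>) permutes the ordered cliques, so deleting position \<open>i\<close> amounts to
  deleting the head; every \<open>ys\<close> then arises once for each common neighbour.\<close>

lemma sum_cliques_delete_nth:
  fixes f :: "'a set \<Rightarrow> 'b::comm_semiring_1"
  assumes "i \<le> r"
  shows "(\<Sum>xs\<in>cliques (Suc r). f (set xs - {xs ! i})) =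
         (\<Sum>ys\<in>cliques r. of_nat (card (nbrs (set ys))) * f (set ys))"
proof -
  define h where "h xs = xs ! i # take i xs @ drop (Suc i) xs" for xs :: "'a list"
  define k where "k ys = take i (tl ys) @ hd ys # drop i (tl ys)" for ys :: "'a list"
  have hk: "k (h xs) = xs" "set (h xs) = set xs" "length (h xs) = Suc r" "distinct (h xs) = distinct xs"
    "distinct xs \<Longrightarrow> set (tl (h xs)) = set xs - {xs ! i}"
    if "length xs = Suc r" for xs
  proof -
    have il: "i < length xs" using that assms by simp
    note e = id_take_nth_drop[OF il]
    show "k (h xs) = xs" using il e by (simp add: h_def k_def)
    have "mset xs = mset (take i xs @ xs ! i # drop (Suc i) xs)" using e by simp
    then have ms: "mset (h xs) = mset xs" by (simp add: h_def)
    show s: "set (h xs) = set xs" using ms mset_eq_setD by blast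
    show "length (h xs) = Suc r" using ms that mset_eq_length by metis
    show d: "distinct (h xs) = distinct xs" using ms mset_eq_imp_distinct_iff by blast
    assume "distinct xs"
    then have "distinct (xs ! i # tl (h xs))" using d by (simp add: h_def)
    moreover have "set (xs ! i # tl (h xs)) = set xs" using s by (simp add: h_def)
    ultimately show "set (tl (h xs)) = set xs - {xs ! i}" by auto
  qed
  have kh: "h (k ys) = ys \<and> set (k ys) = set ys \<and> length (k ys) = Suc r \<and> distinct (k ys) = distinct ys"
    if len: "length ys = Suc r" for ys
  proof -
    obtain y zs where ys: "ys = y # zs" "length zs = r" using len by (cases ys) auto
    then have "length (take i zs) = i" using assms by simp
    then have a: "h (k ys) = ys" using ys by (simp add: h_def k_def nth_append)
    have "mset (k ys) = mset ys"
      using ys by (simp add: k_def) (metis append_take_drop_id mset_append)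
    then show ?thesis using a len mset_eq_setD mset_eq_length mset_eq_imp_distinct_iff by metis
  qed
  have "bij_betw h (cliques (Suc r)) (cliques (Suc r))"
    by (rule bij_betw_byWitness[where f' = k]) (use hk kh in \<open>auto simp: mem_cliques_iff\<close>)
  then have "(\<Sum>xs\<in>cliques (Suc r). f (set (tl xs))) = (\<Sum>xs\<in>cliques (Suc r). f (set (tl (h xs))))"
    by (rule sum.reindex_bij_betw[symmetric])
  also have "\<dots> = (\<Sum>xs\<in>cliques (Suc r). f (set xs - {xs ! i}))"
    by (intro sum.cong) (use hk(5) in \<open>auto simp: mem_cliques_iff\<close>)
  finally show ?thesis using sum_cliques_Suc[of "\<lambda>x ys. f (set ys)" r] by simp
qed

text \<open>For a clique these are the vertices that miss exactly the entry \<open>xs ! i\<close>,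
  including that entry itself. In a complete \<open>l\<close>-partite graph the private parts of an
  \<open>l\<close>-clique are the \<open>l\<close> parts, which is the origin of the approximate
  partition.\<close>

definition private_part :: "'a list \<Rightarrow> nat \<Rightarrow> 'a set" where
  "private_part xs i = nbrs (set xs - {xs ! i}) - nbrs (set xs)"

lemma disjoint_private_parts:
  assumes "distinct xs"
  shows "disjoint_family_on (private_part xs) {..<length xs}"
proof -
  have "m = n" if h: "m < length xs" "n < length xs" "v \<in> private_part xs m" "v \<in> private_part xs n"
    for m n v
  proof -
    obtain y where "y \<in> set xs" "\<not> adj v y" using h(3) by (auto simp: private_part_def nbrs_def)
    then have "y = xs ! m" "y = xs ! n" using h(3,4) by (auto simp: private_part_def nbrs_def)
    then show ?thesis using assms h nth_eq_iff_index_eq by blast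
  qed
  then show ?thesis unfolding disjoint_family_on_def by blast
qed

lemma card_private_part:
  "card (nbrs (set xs - {xs ! i})) = card (private_part xs i) + card (nbrs (set xs))"
proof -
  have "nbrs (set xs) \<subseteq> nbrs (set xs - {xs ! i})" by (auto simp: nbrs_def)
  then show ?thesis unfolding private_part_def
    using finite_nbrs by (simp add: card_Diff_subset card_mono)
qed

lemma sum_card_private_part_le:
  assumes "distinct xs"
  shows "(\<Sum>i<length xs. card (private_part xs i)) + card (nbrs (set xs)) \<le> card S"
proof -
  let ?U = "\<Union>i<length xs. private_part xs i"
  have "card ?U = (\<Sum>i<length xs. card (private_part xs i))"
    using disjoint_private_parts[OF assms] finite_nbrs
    by (intro card_UN_disjoint) (auto simp: disjoint_family_on_def private_part_def)
  moreover have "card ?U + card (nbrs (set xs)) = card (?U \<union> nbrs (set xs))"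
    using finite_nbrs by (intro card_Un_disjoint[symmetric]) (auto simp: private_part_def)
  moreover have "card (?U \<union> nbrs (set xs)) \<le> card S"
    using finite_vertices by (intro card_mono) (auto simp: private_part_def nbrs_def)
  ultimately show ?thesis by simp
qed

text \<open>Cauchy-Schwarz, since the numbers \<open>card (nbrs (set ys))\<close> add up to
  \<open>card (cliques (Suc r))\<close>.\<close>

lemma sum_squares_nbrs_ge:
  "real (card (cliques (Suc r))) ^ 2 \<le>
     real (card (cliques r)) * (\<Sum>ys\<in>cliques r. real (card (nbrs (set ys))) ^ 2)"
  using sum_squared_le_sum_of_squares[of "\<lambda>ys. real (card (nbrs (set ys)))" "cliques r"]
  by (cases "cliques r = {}") (auto simp: card_cliques_Suc finite_cliques mult.commute)

lemma sum_delete_nth_nbrs: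
  "(\<Sum>xs\<in>cliques (Suc r). \<Sum>i<Suc r. real (card (nbrs (set xs - {xs ! i})))) =
     real (Suc r) * (\<Sum>ys\<in>cliques r. real (card (nbrs (set ys))) ^ 2)"
proof -
  have "(\<Sum>xs\<in>cliques (Suc r). \<Sum>i<Suc r. real (card (nbrs (set xs - {xs ! i})))) =
     (\<Sum>i<Suc r. \<Sum>xs\<in>cliques (Suc r). real (card (nbrs (set xs - {xs ! i}))))"
    by (rule sum.swap)
  also have "\<dots> = (\<Sum>i<Suc r. \<Sum>ys\<in>cliques r. real (card (nbrs (set ys))) ^ 2)"
    using sum_cliques_delete_nth[of _ r "\<lambda>A. real (card (nbrs A))"]
    by (intro sum.cong[OF refl, of "{..<Suc r}"]) (auto simp: power2_eq_square)
  finally show ?thesis by simp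
qed

text \<open>A vertex outside \<open>nbrs (set xs)\<close> is adjacent to all but one entry of \<open>xs\<close> for at most one entry.\<close>

lemma moon_moser:
  "real (Suc r) * real (card (cliques (Suc r))) ^ 2 \<le>
    real (card (cliques r)) * (real (card S) * real (card (cliques (Suc r)))
       + real r * real (card (cliques (Suc (Suc r)))))"
proof -
  \<comment> \<open>Vertices of private parts are counted once, common neighbours of
    \<open>xs\<close> once for each of the \<open>r + 1\<close> positions, all others never.\<close>
  have one: "(\<Sum>i<Suc r. real (card (nbrs (set xs - {xs ! i})))) \<le> card S + r * real (card (nbrs (set xs)))"
    if "xs \<in> cliques (Suc r)" for xs
  proof -
    have "distinct xs" "length xs = Suc r" using that by (auto simp: mem_cliques_iff)
    then have "(\<Sum>i<Suc r. card (private_part xs i)) + card (nbrs (set xs)) \<le> card S"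
      using sum_card_private_part_le by metis
    then have "(\<Sum>i<Suc r. real (card (private_part xs i))) + card (nbrs (set xs)) \<le> card S"
      by (simp only: of_nat_sum[symmetric] of_nat_add[symmetric] of_nat_le_iff)
    moreover have "(\<Sum>i<Suc r. real (card (nbrs (set xs - {xs ! i})))) =
      (\<Sum>i<Suc r. real (card (private_part xs i))) + Suc r * real (card (nbrs (set xs)))"
      by (simp only: card_private_part of_nat_add sum.distrib) simp
    ultimately show ?thesis by (simp add: algebra_simps)
  qed
  have "real (Suc r) * (\<Sum>ys\<in>cliques r. real (card (nbrs (set ys))) ^ 2) \<le>
    (\<Sum>xs\<in>cliques (Suc r). card S + r * real (card (nbrs (set xs))))"
    unfolding sum_delete_nth_nbrs[symmetric] by (rule sum_mono) (rule one)
  also have "\<dots> = card S * card (cliques (Suc r)) + r * card (cliques (Suc (Suc r)))"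
    by (simp add: sum.distrib sum_distrib_left[symmetric] card_cliques_Suc[of "Suc r"])
  finally have "real (card (cliques r)) * (real (Suc r) * (\<Sum>ys\<in>cliques r. real (card (nbrs (set ys))) ^ 2))
     \<le> card (cliques r) * (real (card S * card (cliques (Suc r)) + r * card (cliques (Suc (Suc r)))))"
    by (rule mult_left_mono) simp
  moreover have "real (Suc r) * real (card (cliques (Suc r))) ^ 2 \<le>
     real (Suc r) * (real (card (cliques r)) * (\<Sum>ys\<in>cliques r. real (card (nbrs (set ys))) ^ 2))"
    using sum_squares_nbrs_ge by (rule mult_left_mono) simp
  ultimately show ?thesis by (simp add: algebra_simps)
qed

lemma arcs_mono: "A \<subseteq> B \<Longrightarrow> arcs A \<subseteq> arcs B" by (auto simp: arcs_def)

text \<open>Averaging over all cliques of size \<open>l = Suc r\<close>: the hypothesis bounds from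
  below the mean of the total size of the private parts minus a penalty for arcs inside them. The
  mean penalty is small because an \<open>r\<close>-clique \<open>ys\<close> together with an arc
  among its common neighbours is an \<open>(r+2)\<close>-clique, and these are few.\<close>

lemma near_partition_from_clique:
  fixes e :: real
  assumes n: "card S > 0" and cl: "cliques (Suc r) \<noteq> {}"
    and e: "real (Suc r) * card (cliques (Suc r)) / (card S * card (cliques r))
      - (real (Suc r) + real (Suc r) ^ 2) * card (cliques (Suc (Suc r))) / (card S * card (cliques (Suc r))) \<ge> 1 - e"
  obtains V where "disjoint_family_on V {..<Suc r}" "\<And>i. V i \<subseteq> S"
    "(\<Sum>i<Suc r. real (card (V i))) \<ge> (1 - e) * card S"
    "(\<Sum>i<Suc r. real (card (arcs (V i)))) \<le> e * card S ^ 2"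
proof -
  define n where "n = real (card S)"
  define N where "N k = real (card (cliques k))" for k
  define l where "l = real (Suc r)"
  have npos: "n > 0" using assms(1) by (simp add: n_def)
  have Npos: "N (Suc r) > 0" using cl finite_cliques by (simp add: N_def card_gt_0_iff)
  have "N (Suc r) \<le> n * N r" using card_cliques_Suc_le[of r] unfolding N_def n_def
    by (metis of_nat_le_iff of_nat_mult)
  then have Npos': "N r > 0" using Npos npos by (smt (verit) N_def mult_eq_0_iff of_nat_0_le_iff)
  have lpos: "l \<ge> 1" by (simp add: l_def)
  \<comment> \<open>\<open>a xs - l * d xs\<close> is the total size of the private parts of
    \<open>xs\<close>; \<open>b xs\<close> counts arcs in slightly larger sets, for which the sum
    over all cliques can be computed.\<close>
  define a where "a xs = (\<Sum>i<Suc r. real (card (nbrs (set xs - {xs ! i}))))" for xs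
  define b where "b xs = (\<Sum>i<Suc r. real (card (arcs (nbrs (set xs - {xs ! i})))))" for xs
  define d where "d xs = real (card (nbrs (set xs)))" for xs
  have A: "(\<Sum>xs\<in>cliques (Suc r). a xs) \<ge> l * N (Suc r) ^ 2 / N r"
  proof -
    have "N (Suc r) ^ 2 / N r \<le> (\<Sum>ys\<in>cliques r. real (card (nbrs (set ys))) ^ 2)"
      using sum_squares_nbrs_ge[of r] Npos' by (simp add: N_def field_simps)
    then have "l * (N (Suc r) ^ 2 / N r) \<le> l * (\<Sum>ys\<in>cliques r. real (card (nbrs (set ys))) ^ 2)"
      using lpos by (intro mult_left_mono) auto
    then show ?thesis unfolding a_def sum_delete_nth_nbrs l_def by simp
  qed
  have D: "(\<Sum>xs\<in>cliques (Suc r). d xs) = N (Suc (Suc r))"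
    by (simp add: d_def N_def card_cliques_Suc[of "Suc r"])
  have B: "(\<Sum>xs\<in>cliques (Suc r). b xs) \<le> l * n * N (Suc (Suc r))"
  proof -
    have "(\<Sum>xs\<in>cliques (Suc r). b xs) =
     (\<Sum>i<Suc r. \<Sum>xs\<in>cliques (Suc r). real (card (arcs (nbrs (set xs - {xs ! i})))))"
      unfolding b_def by (rule sum.swap)
    also have "\<dots> = (\<Sum>i<Suc r. \<Sum>ys\<in>cliques r. real (card (nbrs (set ys))) * card (arcs (nbrs (set ys))))"
      using sum_cliques_delete_nth[of _ r "\<lambda>A. real (card (arcs (nbrs A)))"]
      by (intro sum.cong[OF refl, of "{..<Suc r}"]) auto
    also have "\<dots> = l * (\<Sum>ys\<in>cliques r. real (card (nbrs (set ys))) * card (arcs (nbrs (set ys))))"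
      by (simp add: l_def)
    also have "\<dots> \<le> l * (\<Sum>ys\<in>cliques r. n * card (arcs (nbrs (set ys))))"
      using lpos card_nbrs_le by (intro mult_left_mono sum_mono mult_right_mono) (auto simp: n_def)
    also have "\<dots> = l * n * N (Suc (Suc r))"
      by (simp add: sum_distrib_left[symmetric] N_def card_cliques_Suc_Suc)
    finally show ?thesis .
  qed
  \<comment> \<open>One functional serves both goals: the private parts have total size at most
    \<open>n\<close>, so a value of at least \<open>(1 - e) * n\<close> forces a large total size
    and few arcs for the same clique.\<close>
  have "\<exists>xs\<in>cliques (Suc r). a xs - l * d xs - l / n * b xs \<ge> (1 - e) * n"
  proof (rule ccontr)
    assume "\<not> ?thesis"
    then have "(\<Sum>xs\<in>cliques (Suc r). a xs - l * d xs - l / n * b xs) < (\<Sum>xs\<in>cliques (Suc r). (1 - e) * n)"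
      using cl finite_cliques by (intro sum_strict_mono) auto
    also have "\<dots> = N (Suc r) * ((1 - e) * n)" by (simp add: N_def)
    also have "\<dots> \<le> N (Suc r) * n * (l * N (Suc r) / (n * N r) - (l + l^2) * N (Suc (Suc r)) / (n * N (Suc r)))"
      using e Npos npos by (simp add: N_def[symmetric] n_def[symmetric] l_def mult.commute)
    also have "\<dots> = l * N (Suc r) ^ 2 / N r - (l + l^2) * N (Suc (Suc r))"
      using Npos Npos' npos by (simp add: field_simps power2_eq_square)
    also have "\<dots> \<le> (\<Sum>xs\<in>cliques (Suc r). a xs) - l * (\<Sum>xs\<in>cliques (Suc r). d xs) - l / n * (\<Sum>xs\<in>cliques (Suc r). b xs)"
    proof -
      have "l / n * (\<Sum>xs\<in>cliques (Suc r). b xs) \<le> l / n * (l * n * N (Suc (Suc r)))"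
        using B lpos npos by (intro mult_left_mono) auto
      also have "\<dots> = l^2 * N (Suc (Suc r))" using npos by (simp add: power2_eq_square)
      finally show ?thesis using A D by (simp add: algebra_simps)
    qed
    also have "\<dots> = (\<Sum>xs\<in>cliques (Suc r). a xs - l * d xs - l / n * b xs)"
      by (simp add: sum_subtractf sum_distrib_left)
    finally show False by simp
  qed
  then obtain xs where xs: "xs \<in> cliques (Suc r)" and ge: "a xs - l * d xs - l / n * b xs \<ge> (1 - e) * n" by blast
  have dl: "distinct xs" "length xs = Suc r" using xs by (auto simp: mem_cliques_iff)
  define v where "v = (\<Sum>i<Suc r. real (card (private_part xs i)))"
  have av: "a xs = v + l * d xs" unfolding a_def v_def d_def
    by (simp only: card_private_part of_nat_add sum.distrib) (simp add: l_def)
  have "(\<Sum>i<Suc r. card (private_part xs i)) \<le> card S"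
    using sum_card_private_part_le[OF dl(1)] dl(2) by simp
  then have vn: "v \<le> n" unfolding v_def n_def by (metis of_nat_le_iff of_nat_sum)
  have b0: "b xs \<ge> 0" unfolding b_def by (intro sum_nonneg) auto
  have "v \<ge> (1 - e) * n"
  proof -
    have "0 \<le> l / n * b xs" using b0 lpos npos by simp
    then show ?thesis using ge av by linarith
  qed
  moreover have "b xs \<le> e * n ^ 2"
  proof -
    have "l / n * b xs \<le> e * n" using ge av vn by (simp add: algebra_simps)
    then have "l * b xs \<le> e * n^2" using npos by (simp add: field_simps power2_eq_square)
    moreover have "1 * b xs \<le> l * b xs" using lpos b0 by (intro mult_right_mono) auto
    ultimately show ?thesis by linarith
  qed
  moreover have "(\<Sum>i<Suc r. real (card (arcs (private_part xs i)))) \<le> b xs"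
    unfolding b_def
    by (intro sum_mono of_nat_mono card_mono finite_arcs arcs_mono) (auto simp: private_part_def nbrs_def)
  ultimately show thesis
    using disjoint_private_parts[OF dl(1)] dl(2)
    by (intro that[of "private_part xs"]) (auto simp: v_def n_def private_part_def nbrs_def)
qed

end

section \<open>Stability for the number of triangles\<close>

text \<open>The \<open>p r\<close> stand for the densities \<open>N r / n ^ r\<close> of ordered
  cliques. In a balanced complete \<open>k\<close>-partite graph the ratio
  \<open>p (Suc r) / p r\<close> is \<open>1 - r / k\<close>; the Moon-Moser inequality carries a
  bound \<open>1 - r * u\<close> on one ratio over to the next. The number \<open>b\<close> bounds
  the ratios up to index \<open>k\<close> from below and so keeps the densities in range
  positive.\<close>

lemma moon_moser_chain:
  fixes p :: "nat \<Rightarrow> real"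
  assumes mm: "\<And>r. real (Suc r) * p (Suc r) ^ 2 \<le> p r * (p (Suc r) + real r * p (Suc (Suc r)))"
    and s: "s \<ge> 1" "p s > 0" "p (Suc s) \<ge> (1 - real s * u) * p s"
    and b: "b > 0" "u \<ge> 0" "1 - real k * u \<ge> b"
  shows "s \<le> r \<Longrightarrow> r \<le> Suc k \<Longrightarrow> p r \<ge> b ^ (r - s) * p s \<and> p (Suc r) \<ge> (1 - real r * u) * p r"
proof (induction r rule: dec_induct)
  case base
  then show ?case using s by simp
next
  case (step r)
  then have IH: "p r \<ge> b ^ (r - s) * p s" "p (Suc r) \<ge> (1 - real r * u) * p r" by auto
  have rk: "r \<le> k" using step by simp
  have ru: "1 - real r * u \<ge> b"
  proof -
    have "real r * u \<le> real k * u" using rk b by (intro mult_right_mono) auto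
    then show ?thesis using b by linarith
  qed
  have "b ^ (r - s) * p s > 0" using b s by simp
  then have y: "p r > 0" using IH by linarith
  have "p (Suc r) \<ge> b * p r"
    using mult_right_mono[OF ru, of "p r"] y IH(2) by linarith
  moreover have "b * p r \<ge> b * (b ^ (r - s) * p s)" using IH(1) b by (intro mult_left_mono) auto
  moreover have "b * (b ^ (r - s) * p s) = b ^ (Suc r - s) * p s"
    using step(1) by (simp add: Suc_diff_le)
  ultimately have 1: "p (Suc r) \<ge> b ^ (Suc r - s) * p s" by linarith
  have x: "p (Suc r) > 0" using \<open>p (Suc r) \<ge> b * p r\<close> y b by (smt (verit) mult_pos_pos)
  have rpos: "real r > 0" using step(1) s(1) by simp
  define x' y' z' R where "x' = p (Suc r)" "y' = p r" "z' = p (Suc (Suc r))" "R = real r"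
  have "(1 + R) * x'^2 \<le> y' * (x' + R * z')" using mm[of r] by (simp add: x'_y'_z'_R_def)
  moreover have "(1 + R) * x' * x' \<ge> (1 + R) * x' * ((1 - R * u) * y')"
    using IH(2) rpos x by (intro mult_left_mono) (auto simp: x'_y'_z'_R_def)
  ultimately have "y' * R * ((1 - (1 + R) * u) * x') \<le> y' * R * z'"
    by (simp add: algebra_simps power2_eq_square)
  moreover have "y' * R > 0" using y rpos by (simp add: x'_y'_z'_R_def)
  ultimately have "(1 - (1 + R) * u) * x' \<le> z'" using mult_le_cancel_left_pos by blast
  then show ?case using 1 by (simp add: x'_y'_z'_R_def)
qed

text \<open>Three uses of \<open>moon_moser_chain\<close> with \<open>u\<close> slightly below or
  above \<open>1/l\<close>. An edge density above \<open>1 - 1/l\<close>, or a ratio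
  \<open>p 3 / p 2\<close> above \<open>1 - 2/l\<close>, by a fixed amount would propagate to a
  density of \<open>(l+1)\<close>-cliques above \<open>d\<close>. So \<open>p 2\<close> is not too
  large, hence \<open>p 3 / p 2\<close> not too small, and this lower bound propagates to
  \<open>p l / p (l - 1)\<close>. Likewise \<open>p 3 / p 2\<close> is not too large, hence
  \<open>p 2\<close> not too small.\<close>

lemma near_extremal_clique_densities:
  fixes e :: real
  assumes l: "l \<ge> 3" and e0: "e > 0"
  shows "\<exists>d::real. d > 0 \<and> (\<forall>p::nat \<Rightarrow> real.
     (\<forall>r. real (Suc r) * p (Suc r) ^ 2 \<le> p r * (p (Suc r) + real r * p (Suc (Suc r)))) \<longrightarrow>
     p 1 = 1 \<longrightarrow> p 3 \<le> p 2 \<longrightarrow> p 3 \<ge> (1 - 1/l) * (1 - 2/l) - d \<longrightarrow> p (Suc l) \<le> d \<longrightarrow>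
     p 2 \<ge> 1 - 1/l - e \<and> p l > 0 \<and> l * p l / p (l - 1) - (real l + real l ^ 2) * p (Suc l) / p l \<ge> 1 - e)"
proof -
  define L where "L = real l"
  have L: "L \<ge> 3" using l by (simp add: L_def)
  define e' where "e' = min e 1"
  define e2 where "e2 = e' / (2 * L^2)"
  define e1 where "e1 = e2 / 2"
  define e3 where "e3 = e' / 12"
  define b where "b = 1 / (2 * L)"
  \<comment> \<open>One entry for each use of the smallness of \<open>d\<close>, in order: the
    contradiction that bounds \<open>p 2\<close> from above, the lower bound on
    \<open>p 3 / p 2\<close>, the positivity of \<open>p 3\<close>, the final estimate for the lower
    bound on \<open>p 2\<close>, the contradiction behind that bound, and the term with
    \<open>p (Suc l) / p l\<close>.\<close>
  define ds where "ds = [(L * e1) ^ l / 2, e2 / 2, 1/9, e' / 6, (L * e3) ^ (l - 1) / 18, e' * b ^ l / (18 * (L + L^2))]"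
  define d where "d = Min (set ds)"
  have e': "0 < e'" "e' \<le> 1" "e' \<le> e" using e0 by (auto simp: e'_def)
  have pos: "e2 > 0" "e1 > 0" "e3 > 0" "b > 0" using e' L by (auto simp: e2_def e1_def e3_def b_def)
  have d0: "d > 0" using pos L e' unfolding d_def ds_def by (auto intro!: divide_pos_pos mult_pos_pos add_pos_pos)
  have mem: "d \<le> x" if "x \<in> set ds" for x unfolding d_def using that by (intro Min_le) auto
  have dle: "d \<le> (L * e1) ^ l / 2" "d \<le> e2 / 2" "d \<le> 1/9" "d \<le> e' / 6" "d \<le> (L * e3) ^ (l - 1) / 18"
     "d \<le> e' * b ^ l / (18 * (L + L^2))"
    by (rule mem, simp add: ds_def)+
  have L2: "L^2 \<ge> 9" using power_mono[of 3 L 2] L by simp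
  have e2le: "e2 \<le> 1 / (2 * L^2)" using e' L by (simp add: e2_def divide_right_mono)
  have e2s: "e2 \<le> 1/18" using e2le L2 by (smt (verit) frac_le)
  have Le2: "L * e2 \<le> 1 / (2*L)" using e2le L by (simp add: field_simps power2_eq_square)
  have invL: "1/L \<le> 1/3" "1/L > 0" using L by (auto simp: field_simps)
  define w where "w = 1/L"
  have w: "1/L = w" "2/L = 2*w" by (auto simp: w_def)
  have winv: "w \<le> 1/3" "w > 0" using invL by (simp_all only: w)
  have base: "(1 - 1/L) * (1 - 2/L) \<ge> 2/9"
  proof -
    have "1 - 2/L = 1 - 2 * (1/L)" by simp
    then have "2/3 \<le> 1 - 1/L" "1/3 \<le> 1 - 2/L" using invL by linarith+
    then have "(2/3::real) * (1/3) \<le> (1 - 1/L) * (1 - 2/L)" by (intro mult_mono) auto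
    then show ?thesis by simp
  qed
  show ?thesis
  proof (rule exI[of _ d], rule conjI[OF d0], intro allI impI)
    fix p :: "nat \<Rightarrow> real"
    assume mm0: "\<forall>r. real (Suc r) * p (Suc r) ^ 2 \<le> p r * (p (Suc r) + real r * p (Suc (Suc r)))"
      and p1: "p 1 = 1" and p32: "p 3 \<le> p 2" and p3: "p 3 \<ge> (1 - 1/l) * (1 - 2/l) - d"
      and pl: "p (Suc l) \<le> d"
    note mm = mm0[rule_format]
    have p3': "p 3 \<ge> (1 - 1/L) * (1 - 2/L) - d" using p3 by (simp add: L_def)
    have p3'': "p 3 \<ge> 1/9" using p3' base dle(3) by linarith
    have p2pos: "p 2 \<ge> 1/9" using p3'' p32 by linarith
    have p2up: "p 2 \<le> 1 - 1/L + e1"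
    proof (rule ccontr)
      assume "\<not> ?thesis"
      then have a: "p (Suc 1) \<ge> (1 - real 1 * (1/L - e1)) * p 1" using p1 by (simp add: numeral_2_eq_2)
      have u: "1/L - e1 \<ge> 0"
      proof -
        have "1 / (2*L) = (1/L) / 2" by simp
        then have "L * e2 \<le> 1/2" using Le2 invL by linarith
        then show ?thesis using L unfolding e1_def by (simp add: field_simps)
      qed
      \<comment> \<open>With \<open>u = 1/L - e1\<close> the left side equals \<open>L * e1\<close>,
        so the \<open>l\<close> ratios from index 1 on contribute
        \<open>(L * e1) ^ l\<close>.\<close>
      have bb: "1 - real l * (1/L - e1) \<ge> L * e1" using L by (simp add: L_def field_simps)
      have "p (Suc l) \<ge> (L * e1) ^ (Suc l - 1) * p 1"
        using moon_moser_chain[OF mm _ _ a _ u bb, of "Suc l"] p1 pos L l by auto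
      then have "(L * e1) ^ l \<le> d" using pl p1 by simp
      moreover have "(L * e1) ^ l > 0" using pos L by simp
      ultimately show False using dle(1) by linarith
    qed
    have step2: "p (Suc 2) \<ge> (1 - real 2 * (1/L + e2)) * p 2"
    proof -
      have c0: "1 - 2 * (1/L + e2) \<ge> 0" using invL e2s by argo
      have "(1 - 2 * (1/L + e2)) * p 2 \<le> (1 - 2 * (1/L + e2)) * (1 - 1/L + e1)"
        using p2up c0 by (intro mult_left_mono) auto
      also have "\<dots> = (1 - 1/L) * (1 - 2/L) + e1 * (1 - 2 * (1/L)) - 2*e2*(1 - 1/L + e1)"
        unfolding w by algebra
      also have "\<dots> \<le> (1 - 1/L) * (1 - 2/L) - d"
      proof -
        have "e1 * (1 - 2 * (1/L)) \<le> e1 * 1" unfolding w using winv pos by (intro mult_left_mono) auto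
        moreover have "2*e2*(1 - 1/L + e1) \<ge> 2*e2*(2/3)" unfolding w using winv pos by (intro mult_left_mono) auto
        ultimately show ?thesis using dle(2) pos unfolding e1_def by linarith
      qed
      also have "\<dots> \<le> p 3" by (rule p3')
      finally show ?thesis by (simp add: numeral_3_eq_3 numeral_2_eq_2)
    qed
    have u2: "1/L + e2 \<ge> 0" using invL pos by linarith
    \<comment> \<open>The chain now runs with \<open>k = l - 1\<close>, where
      \<open>1 - k / L = 1 / L\<close>; the loss \<open>(L - 1) * e2 \<le> 1 / (2 * L)\<close>
      leaves half of it as \<open>b\<close>.\<close>
    have bb2: "1 - real (l - 1) * (1/L + e2) \<ge> b"
    proof -
      have "real (l - 1) = L - 1" using l by (simp add: L_def of_nat_diff)
      moreover have "1 - (L - 1) * (1/L + e2) = 1/L - (L - 1) * e2" using L by (simp add: field_simps)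
      moreover have "(L - 1) * e2 \<le> L * e2" using pos by (intro mult_right_mono) auto
      moreover have "b = 1/L - 1 / (2*L)" by (simp add: b_def)
      ultimately show ?thesis using Le2 by simp
    qed
    have ch: "p r \<ge> b ^ (r - 2) * p 2 \<and> p (Suc r) \<ge> (1 - real r * (1/L + e2)) * p r"
      if "2 \<le> r" "r \<le> Suc (l - 1)" for r
      using moon_moser_chain[OF mm _ _ step2 pos(4) u2 bb2, of r] that p2pos by auto
    have l1: "2 \<le> l - 1" "l - 1 \<le> Suc (l - 1)" "Suc (l - 1) = l" using l by auto
    note ch1 = ch[OF l1(1,2), unfolded l1(3)]
    have b1: "b \<le> 1" using L by (simp add: b_def)
    have plb: "p l \<ge> b ^ l * (1/9)"
    proof -
      have "b ^ l * (1/9) \<le> b ^ (l - 2) * p 2"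
        using p2pos b1 pos by (intro mult_mono power_decreasing) auto
      then show ?thesis using ch[of l] l by simp
    qed
    have bl: "b ^ l > 0" using pos by simp
    have plpos: "p l > 0" using plb bl by (smt (verit) mult_pos_pos divide_pos_pos)
    have pl1: "p (l - 1) > 0"
    proof -
      have "b ^ (l - 1 - 2) * p 2 > 0" using pos p2pos by simp
      then show ?thesis using ch1 by linarith
    qed
    have R1: "p 2 \<ge> 1 - 1/l - e"
    proof -
      have up: "p (Suc 2) < (1 - real 2 * (1/L - e3)) * p 2"
      proof (rule ccontr)
        assume "\<not> ?thesis"
        then have a: "p (Suc 2) \<ge> (1 - real 2 * (1/L - e3)) * p 2" by simp
        show False
        proof (cases "1/L - e3 \<ge> 0")
          case True
          have bb: "1 - real l * (1/L - e3) \<ge> L * e3" using L by (simp add: L_def field_simps)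
          have "p (Suc l) \<ge> (L * e3) ^ (Suc l - 2) * p 2"
            using moon_moser_chain[OF mm _ _ a _ True bb, of "Suc l"] p2pos pos L l by auto
          moreover have "(L * e3) ^ (Suc l - 2) * p 2 \<ge> (L * e3) ^ (l - 1) * (1/9)"
            using p2pos pos L l by (intro mult_mono) (auto simp: numeral_2_eq_2)
          moreover have "(L * e3) ^ (l - 1) > 0" using pos L by simp
          ultimately show False using pl dle(5) by linarith
        next
          \<comment> \<open>The chain needs \<open>u \<ge> 0\<close>; a negative \<open>u\<close>
            would give \<open>p 3 > p 2\<close> at once.\<close>
          case False
          then have "1 * p 2 < (1 - real 2 * (1/L - e3)) * p 2"
            using p2pos by (intro mult_strict_right_mono) auto
          then have "p 2 < p (Suc 2)" using a by linarith
          then show False using p32 by simp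
        qed
      qed
      have X: "1 - 2/L + 2*e3 > 0" unfolding w using winv pos by linarith
      have "(1 - 1/L) * (1 - 2/L) - d < (1 - 2/L + 2*e3) * p 2"
      proof -
        have "(1 - real 2 * (1/L - e3)) = 1 - 2/L + 2*e3" unfolding w by simp
        from up[unfolded this] have "p 3 < (1 - 2/L + 2*e3) * p 2" by simp
        then show ?thesis using p3' by linarith
      qed
      moreover have "(1 - 2/L + 2*e3) * (1 - 1/L - e') \<le> (1 - 1/L) * (1 - 2/L) - d"
      proof -
        have "(1 - 2/L + 2*e3) * (1 - 1/L - e') = (1 - 1/L) * (1 - 2/L) - e' * (1 - 2*(1/L)) + 2*e3*(1 - 1/L - e')"
          unfolding w by algebra
        moreover have "e' * (1 - 2*(1/L)) \<ge> e' * (1/3)" unfolding w using winv e' by (intro mult_left_mono) auto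
        moreover have "2*e3*(1 - 1/L - e') \<le> 2*e3*1" unfolding w using winv e' pos by (intro mult_left_mono) auto
        ultimately show ?thesis using dle(4) unfolding e3_def by linarith
      qed
      ultimately have "(1 - 2/L + 2*e3) * (1 - 1/L - e') < (1 - 2/L + 2*e3) * p 2" by linarith
      then have "1 - 1/L - e' < p 2" using X by simp
      then show ?thesis using e' by (simp add: L_def)
    qed
    have R2: "l * p l / p (l - 1) - (real l + real l ^ 2) * p (Suc l) / p l \<ge> 1 - e"
    proof -
      have "p l / p (l - 1) \<ge> 1 - real (l - 1) * (1/L + e2)" using pl1 ch1 pos_le_divide_eq by blast
      moreover have "real (l - 1) = L - 1" using l by (simp add: L_def of_nat_diff)
      moreover have "1 - (L - 1) * (1/L + e2) = 1/L - (L - 1) * e2" using L by (simp add: field_simps)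
      moreover have "(L - 1) * e2 \<le> L * e2" using pos by (intro mult_right_mono) auto
      ultimately have "p l / p (l - 1) \<ge> 1/L - L * e2" by simp
      then have "L * (p l / p (l - 1)) \<ge> L * (1/L - L * e2)" using L by (intro mult_left_mono) auto
      also have "L * (1/L - L * e2) = 1 - e'/2" using L by (simp add: e2_def field_simps power2_eq_square)
      finally have A: "L * p l / p (l - 1) \<ge> 1 - e'/2" by simp
      have LL: "L + L^2 > 0" using L by (simp add: add_pos_pos)
      have "(L + L^2) * p (Suc l) / p l \<le> (L + L^2) * d / p l"
        using pl plpos LL by (intro divide_right_mono mult_left_mono) auto
      also have "\<dots> \<le> (L + L^2) * d / (b ^ l * (1/9))"
        using plb bl LL d0 by (intro divide_left_mono) auto
      also have "\<dots> \<le> (L + L^2) * (e' * b ^ l / (18 * (L + L^2))) / (b ^ l * (1/9))"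
        using dle(6) LL bl by (intro divide_right_mono mult_left_mono) auto
      also have "\<dots> = e'/2" using LL bl pos by (simp add: divide_simps)
      finally show ?thesis using A e' by (simp add: L_def)
    qed
    show "p 2 \<ge> 1 - 1/l - e \<and> p l > 0 \<and> l * p l / p (l - 1) - (real l + real l ^ 2) * p (Suc l) / p l \<ge> 1 - e"
      using R1 plpos R2 by blast
  qed
qed

section \<open>Parts with few missing pairs\<close>

context finite_graph begin

text \<open>The non-adjacent ordered pairs inside the \<open>V i\<close> already number about the
  sum of the squared sizes, hence at least about \<open>n^2 / card I\<close>, and the whole graph
  has hardly more. So the squared deviations of the sizes from \<open>n / card I\<close> and the
  missing pairs between different parts add up to at most
  \<open>4 * e * n^2 = (q / 2 * n)^2\<close>, which is where \<open>e = q^2 / 16\<close> comes from.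
  Deleting from each part the vertices with more than \<open>q * n\<close> missing pairs into
  another part then costs little.\<close>

lemma typical_parts:
  fixes q e :: real and I :: "'i set"
  assumes n: "card S > 0" and I: "finite I" "I \<noteq> {}"
    and q: "q > 0" and eq: "e = q^2 / 16"
    and V: "disjoint_family_on V I" "\<And>i. V i \<subseteq> S"
    and sV: "(\<Sum>i\<in>I. real (card (V i))) \<ge> (1 - e) * card S"
    and aV: "(\<Sum>i\<in>I. real (card (arcs (V i)))) \<le> e * card S ^ 2"
    and aS: "real (card (arcs S)) \<ge> (1 - 1 / card I - e) * card S ^ 2"
  shows "\<exists>W. disjoint_family_on W I \<and> (\<forall>i. W i \<subseteq> S) \<and>
    (\<forall>i\<in>I. real (card (W i)) \<ge> (1 / card I - q) * card S) \<and>
    (\<forall>i\<in>I. \<forall>j\<in>I. i \<noteq> j \<longrightarrow> (\<forall>v\<in>W i. real (card {u\<in>W j. \<not> adj v u}) \<le> q * card S))"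
proof -
  define n where "n = real (card S)"
  have npos: "n > 0" using assms(1) by (simp add: n_def)
  define L where "L = real (card I)"
  have L: "L \<ge> 1" using I by (simp add: L_def Suc_leI card_gt_0_iff)
  have fV: "finite (V i)" for i using V(2) finite_vertices finite_subset by blast
  have disj: "i = j" if "x \<in> V i" "x \<in> V j" "i \<in> I" "j \<in> I" for i j x
    using V(1) that by (auto simp: disjoint_family_on_def)
  define v where "v i = real (card (V i))" for i
  define M where "M i = {(x, y). x \<in> V i \<and> (\<exists>j\<in>I. j \<noteq> i \<and> y \<in> V j) \<and> \<not> adj x y}" for i
  \<comment> \<open>Disjoint sets of non-adjacent ordered pairs, sorted by the part of the first
    entry; the diagonal pairs belong to them.\<close>
  define Q where "Q i = (V i \<times> V i - arcs (V i)) \<union> M i" for i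
  have fM: "finite (M i)" for i
    by (rule finite_subset[of _ "S \<times> S"]) (use V(2) finite_vertices in \<open>auto simp: M_def\<close>)
  have fQ: "finite (Q i)" for i using fM fV by (simp add: Q_def)
  have cQ: "real (card (Q i)) = v i ^ 2 - card (arcs (V i)) + card (M i)" if "i \<in> I" for i
  proof -
    have sub: "arcs (V i) \<subseteq> V i \<times> V i" by (auto simp: arcs_def)
    have "card (Q i) = card (V i \<times> V i - arcs (V i)) + card (M i)"
      unfolding Q_def using fV fM disj that
      by (intro card_Un_disjoint) (auto simp: M_def)
    moreover have "card (V i \<times> V i - arcs (V i)) = card (V i \<times> V i) - card (arcs (V i))"
      using sub fV by (intro card_Diff_subset finite_arcs V) auto
    moreover have "card (arcs (V i)) \<le> card (V i \<times> V i)" using sub fV by (intro card_mono) auto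
    ultimately show ?thesis by (simp add: v_def of_nat_diff card_cartesian_product power2_eq_square)
  qed
  have "(\<Sum>i\<in>I. card (Q i)) = card (\<Union>i\<in>I. Q i)"
    using I fQ disj by (intro card_UN_disjoint[symmetric]) (auto simp: Q_def M_def)
  also have "\<dots> \<le> card (S \<times> S - arcs S)"
  proof (intro card_mono)
    show "finite (S \<times> S - arcs S)" using finite_vertices by simp
    show "(\<Union>i\<in>I. Q i) \<subseteq> S \<times> S - arcs S" using V(2) by (fastforce simp: Q_def M_def arcs_def)
  qed
  also have "\<dots> = card (S \<times> S) - card (arcs S)"
    using finite_vertices by (intro card_Diff_subset finite_arcs) (auto simp: arcs_def)
  finally have "(\<Sum>i\<in>I. card (Q i)) \<le> card (S \<times> S) - card (arcs S)" .
  moreover have "card (arcs S) \<le> card (S \<times> S)"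
    using finite_vertices by (intro card_mono) (auto simp: arcs_def)
  ultimately have "(\<Sum>i\<in>I. card (Q i)) + card (arcs S) \<le> card (S \<times> S)" by linarith
  then have "real ((\<Sum>i\<in>I. card (Q i)) + card (arcs S)) \<le> real (card (S \<times> S))" by (simp only: of_nat_le_iff)
  then have "(\<Sum>i\<in>I. real (card (Q i))) + card (arcs S) \<le> n^2"
    by (simp add: n_def card_cartesian_product power2_eq_square)
  moreover have "(\<Sum>i\<in>I. real (card (Q i))) = (\<Sum>i\<in>I. v i ^ 2) - (\<Sum>i\<in>I. real (card (arcs (V i)))) + (\<Sum>i\<in>I. real (card (M i)))"
    by (simp add: cQ sum.distrib sum_subtractf)
  ultimately have main: "(\<Sum>i\<in>I. v i ^ 2) + (\<Sum>i\<in>I. real (card (M i))) \<le> (1/L + 2*e) * n^2"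
    using aV aS by (simp add: n_def L_def algebra_simps)
  define m where "m = (\<Sum>i\<in>I. real (card (M i)))"
  have m0: "m \<ge> 0" unfolding m_def by (intro sum_nonneg) auto
  have e0: "e > 0" using q unfolding eq by simp
  have sv: "(\<Sum>i\<in>I. v i) \<ge> (1 - e) * n" using sV by (simp add: v_def n_def)
  have "(\<Sum>i\<in>I. (v i - n/L)^2) = (\<Sum>i\<in>I. v i ^ 2) - 2*n/L * (\<Sum>i\<in>I. v i) + n^2/L"
  proof -
    have "(\<Sum>i\<in>I. (v i - n/L)^2) = (\<Sum>i\<in>I. v i ^ 2 - 2*n/L * v i + (n/L)^2)"
      by (intro sum.cong) (auto simp: power2_eq_square algebra_simps)
    also have "\<dots> = (\<Sum>i\<in>I. v i ^ 2) - 2*n/L * (\<Sum>i\<in>I. v i) + L * (n/L)^2"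
      by (simp add: sum.distrib sum_subtractf sum_distrib_left L_def)
    finally show ?thesis using L by (simp add: power2_eq_square)
  qed
  moreover have "2*n/L * (\<Sum>i\<in>I. v i) \<ge> 2*n/L * ((1 - e) * n)"
    using sv npos L by (intro mult_left_mono) auto
  ultimately have "(\<Sum>i\<in>I. (v i - n/L)^2) + m \<le> (1/L + 2*e) * n^2 - 2*n/L * ((1 - e) * n) + n^2/L"
    using main m_def by linarith
  also have "\<dots> = (2*e + 2*e/L) * n^2" using L by (simp add: field_simps power2_eq_square)
  also have "\<dots> \<le> 4*e * n^2"
  proof -
    have "2*e/L \<le> 2*e/1" using L e0 by (intro divide_left_mono) auto
    then show ?thesis by (intro mult_right_mono) auto
  qed
  finally have dev: "(\<Sum>i\<in>I. (v i - n/L)^2) + m \<le> 4*e * n^2" .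
  have dev0: "(\<Sum>i\<in>I. (v i - n/L)^2) \<ge> 0" by (intro sum_nonneg) auto
  have en: "4*e*n^2 = (q/2*n)^2" by (simp add: eq power2_eq_square)
  have vi: "v i \<ge> n/L - q/2*n" if "i \<in> I" for i
  proof -
    have "(v i - n/L)^2 \<le> (\<Sum>i\<in>I. (v i - n/L)^2)" using that I by (intro member_le_sum) auto
    then have "(v i - n/L)^2 \<le> (q/2*n)^2" using dev m0 en by linarith
    then have "\<bar>v i - n/L\<bar> \<le> \<bar>q/2*n\<bar>" using abs_le_square_iff by blast
    moreover have "\<bar>q/2*n\<bar> = q/2*n" using q npos by simp
    ultimately show ?thesis by linarith
  qed
  define B where "B i = {x\<in>V i. \<exists>j\<in>I. j \<noteq> i \<and> real (card {y\<in>V j. \<not> adj x y}) > q * n}" for i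
  have cB: "real (card (B i)) \<le> q/2 * n" if "i \<in> I" for i
  proof -
    have "real (card (B i)) * (q * n) \<le> (\<Sum>x\<in>B i. real (card {y. (x, y) \<in> M i}))"
    proof -
      have "q * n \<le> real (card {y. (x, y) \<in> M i})" if x: "x \<in> B i" for x
      proof -
        obtain j where j: "j \<in> I" "j \<noteq> i" "real (card {y\<in>V j. \<not> adj x y}) > q * n"
          using x by (auto simp: B_def)
        have "{y. (x, y) \<in> M i} \<subseteq> S" using V(2) by (auto simp: M_def)
        then have "finite {y. (x, y) \<in> M i}" using finite_vertices finite_subset by blast
        then have "card {y\<in>V j. \<not> adj x y} \<le> card {y. (x, y) \<in> M i}"
          using j x by (intro card_mono) (auto simp: M_def B_def)
        then show ?thesis using j(3) by linarith
      qed
      then show ?thesis using sum_bounded_below[of "B i" "q * n"] by simp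
    qed
    also have "\<dots> = real (card (SIGMA x:B i. {y. (x, y) \<in> M i}))"
    proof -
      have "finite (B i)" using fV by (simp add: B_def)
      moreover have "finite {y. (x, y) \<in> M i}" for x
        by (rule finite_subset[OF _ finite_vertices]) (use V(2) in \<open>auto simp: M_def\<close>)
      ultimately show ?thesis by simp
    qed
    also have "\<dots> \<le> real (card (M i))" using fM by (intro of_nat_mono card_mono) auto
    also have "\<dots> \<le> m" unfolding m_def using that I by (intro member_le_sum) auto
    also have "\<dots> \<le> (q/2*n)^2" using dev dev0 en by linarith
    finally have "real (card (B i)) * (q * n) \<le> (q/4 * n) * (q * n)" by (simp add: power2_eq_square algebra_simps)
    moreover have qn: "q * n > 0" using q npos by simp
    ultimately have "real (card (B i)) \<le> q/4*n" using mult_le_cancel_right_pos by blast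
    then show ?thesis using qn by linarith
  qed
  show ?thesis
  proof (intro exI[of _ "\<lambda>i. V i - B i"] conjI allI ballI impI)
    show "disjoint_family_on (\<lambda>i. V i - B i) I" using V(1) by (auto simp: disjoint_family_on_def)
    show "V i - B i \<subseteq> S" for i using V(2) by auto
    show "real (card (V i - B i)) \<ge> (1 / card I - q) * card S" if "i \<in> I" for i
    proof -
      have "card (V i - B i) = card (V i) - card (B i)" using fV
        by (intro card_Diff_subset) (auto simp: B_def)
      then have "real (card (V i - B i)) \<ge> v i - card (B i)" by (simp add: v_def)
      then have "real (card (V i - B i)) \<ge> n/L - q * n" using vi[OF that] cB[OF that] by linarith
      then show ?thesis by (simp add: n_def L_def algebra_simps)
    qed
    show "real (card {u\<in>V j - B j. \<not> adj x u}) \<le> q * card S"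
      if "i \<in> I" "j \<in> I" "i \<noteq> j" "x \<in> V i - B i" for i j x
    proof -
      have "card {u\<in>V j - B j. \<not> adj x u} \<le> card {u\<in>V j. \<not> adj x u}" using fV by (intro card_mono) auto
      moreover have "real (card {u\<in>V j. \<not> adj x u}) \<le> q * n" using that by (force simp: B_def)
      ultimately show ?thesis by (simp add: n_def)
    qed
  qed
qed

end

text \<open>Here \<open>d\<close> depends on \<open>l\<close> and \<open>q\<close> only. As ordered
  cliques are counted, \<open>(1 - 1/l) * (1 - 2/l)\<close> is the triangle density of the balanced
  complete \<open>l\<close>-partite graph. Division by \<open>n ^ k\<close> leads to the sequences
  \<open>p\<close> of the density lemma, and the parts found are shifted to the index set
  \<open>{1..l}\<close>.\<close>

lemma triangle_stability:
  fixes q :: real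
  assumes l: "l \<ge> 3" and q: "q > 0"
  shows "\<exists>d::real. d > 0 \<and> (\<forall>(S::'a set) adj. finite_graph S adj \<longrightarrow> S \<noteq> {} \<longrightarrow>
    real (card (finite_graph.cliques S adj 3)) \<ge> ((1 - 1/l) * (1 - 2/l) - d) * card S ^ 3 \<longrightarrow>
    real (card (finite_graph.cliques S adj (Suc l))) \<le> d * card S ^ (Suc l) \<longrightarrow>
    (\<exists>W. disjoint_family_on W {1..l} \<and> (\<forall>i. W i \<subseteq> S) \<and>
      (\<forall>i\<in>{1..l}. real (card (W i)) \<ge> (1/l - q) * card S) \<and>
      (\<forall>i\<in>{1..l}. \<forall>j\<in>{1..l}. i \<noteq> j \<longrightarrow> (\<forall>v\<in>W i. real (card {u\<in>W j. \<not> adj v u}) \<le> q * card S))))"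
proof -
  define e where "e = q^2 / 16"
  have "e > 0" using q by (simp add: e_def)
  from near_extremal_clique_densities[OF l this] obtain d where d: "d > 0" and
    D: "\<And>p::nat \<Rightarrow> real.
     (\<And>r. real (Suc r) * p (Suc r) ^ 2 \<le> p r * (p (Suc r) + real r * p (Suc (Suc r)))) \<Longrightarrow>
     p 1 = 1 \<Longrightarrow> p 3 \<le> p 2 \<Longrightarrow> p 3 \<ge> (1 - 1/l) * (1 - 2/l) - d \<Longrightarrow> p (Suc l) \<le> d \<Longrightarrow>
     p 2 \<ge> 1 - 1/l - e \<and> p l > 0 \<and> l * p l / p (l - 1) - (real l + real l ^ 2) * p (Suc l) / p l \<ge> 1 - e"
    by blast
  show ?thesis
  proof (intro exI[of _ d] conjI allI impI d)
    fix S :: "'a set" and adj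
    assume G: "finite_graph S adj" and S: "S \<noteq> {}"
    interpret finite_graph S adj by (rule G)
    assume c3: "((1 - 1/l) * (1 - 2/l) - d) * card S ^ 3 \<le> real (card (cliques 3))"
      and cl: "real (card (cliques (Suc l))) \<le> d * card S ^ Suc l"
    define n where "n = real (card S)"
    have npos: "n > 0" using S finite_vertices by (simp add: n_def card_gt_0_iff)
    define N where "N k = real (card (cliques k))" for k
    define p where "p k = N k / n ^ k" for k
    have step: "N (Suc k) \<le> n * N k" for k
      using card_cliques_Suc_le[of k] unfolding N_def n_def by (simp only: of_nat_mult[symmetric] of_nat_le_iff)
    have mm: "real (Suc r) * p (Suc r) ^ 2 \<le> p r * (p (Suc r) + real r * p (Suc (Suc r)))" for r
    proof -
      have "real (Suc r) * N (Suc r) ^ 2 \<le> N r * (n * N (Suc r) + real r * N (Suc (Suc r)))"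
        using moon_moser[of r] by (simp add: N_def n_def)
      then have "real (Suc r) * N (Suc r) ^ 2 / (n ^ Suc r)^2 \<le> N r * (n * N (Suc r) + real r * N (Suc (Suc r))) / (n ^ Suc r)^2"
        using npos by (intro divide_right_mono) auto
      also have "\<dots> = p r * (p (Suc r) + real r * p (Suc (Suc r)))"
        using npos by (simp add: p_def field_simps power2_eq_square)
      finally show ?thesis by (simp add: p_def power_divide)
    qed
    have p1: "p 1 = 1" using card_cliques_1 npos by (simp add: p_def N_def n_def)
    have p32: "p 3 \<le> p 2"
      using step[of 2] npos by (simp add: p_def numeral_3_eq_3 numeral_2_eq_2 field_simps)
    have p3: "p 3 \<ge> (1 - 1/l) * (1 - 2/l) - d" using c3 npos by (simp add: p_def N_def n_def pos_le_divide_eq)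
    have pl: "p (Suc l) \<le> d" unfolding p_def using cl npos by (subst pos_divide_le_eq) (auto simp: N_def n_def)
    from D[of p, OF mm p1 p32 p3 pl] have
      R: "p 2 \<ge> 1 - 1/l - e" "p l > 0" "l * p l / p (l - 1) - (real l + real l ^ 2) * p (Suc l) / p l \<ge> 1 - e" by auto
    obtain r where r: "l = Suc r" using l by (cases l) auto
    have Nl: "N l > 0" using R(2) npos by (simp add: p_def zero_less_divide_iff)
    then have ne: "cliques (Suc r) \<noteq> {}" using r by (auto simp: N_def)
    have E1: "p l / p (l - 1) = N l / (n * N (l - 1))" using npos r by (simp add: p_def)
    have E2: "p (Suc l) / p l = N (Suc l) / (n * N l)" using npos r by (simp add: p_def)
    have "l * (p l / p (l - 1)) - (real l + real l ^ 2) * (p (Suc l) / p l) \<ge> 1 - e" using R(3) by simp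
    then have "real (Suc r) * card (cliques (Suc r)) / (card S * card (cliques r))
      - (real (Suc r) + real (Suc r) ^ 2) * card (cliques (Suc (Suc r))) / (card S * card (cliques (Suc r))) \<ge> 1 - e"
      unfolding E1 E2 by (simp add: N_def n_def r add.assoc)
    from near_partition_from_clique[OF _ ne this] npos
    obtain V where V: "disjoint_family_on V {..<Suc r}" "\<And>i. V i \<subseteq> S"
      "(\<Sum>i<Suc r. real (card (V i))) \<ge> (1 - e) * card S"
      "(\<Sum>i<Suc r. real (card (arcs (V i)))) \<le> e * card S ^ 2" by (auto simp: n_def)
    define V' where "V' i = V (i - 1)" for i
    have reindex: "(\<Sum>i\<in>{1..l}. f (V' i)) = (\<Sum>i<Suc r. f (V i))" for f :: "'a set \<Rightarrow> real"
      unfolding V'_def r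
      using sum.atLeast1_atMost_eq[of "\<lambda>i. f (V (i - 1))" "Suc r"] by simp
    have dV: "disjoint_family_on V' {1..l}"
      unfolding disjoint_family_on_def
    proof (intro ballI impI)
      fix i j assume "i \<in> {1..l}" "j \<in> {1..l}" "i \<noteq> j"
      then have "i - 1 \<in> {..<Suc r}" "j - 1 \<in> {..<Suc r}" "i - 1 \<noteq> j - 1" using r by auto
      then show "V' i \<inter> V' j = {}" using V(1) unfolding disjoint_family_on_def V'_def by blast
    qed
    have aS: "real (card (arcs S)) \<ge> (1 - 1 / card {1..l} - e) * card S ^ 2"
      using R(1) npos by (simp add: p_def N_def card_cliques_2 n_def pos_le_divide_eq)
    have cS: "card S > 0" using npos by (simp add: n_def)
    have sV: "(1 - e) * card S \<le> (\<Sum>i\<in>{1..l}. real (card (V' i)))"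
      using V(3) reindex[of "\<lambda>A. real (card A)"] by simp
    have aV: "(\<Sum>i\<in>{1..l}. real (card (arcs (V' i)))) \<le> e * card S ^ 2"
      using V(4) reindex[of "\<lambda>A. real (card (arcs A))"] by simp
    have ne1: "{1..l} \<noteq> {}" and V'S: "V' i \<subseteq> S" for i using l V(2) by (auto simp: V'_def)
    show "\<exists>W. disjoint_family_on W {1..l} \<and> (\<forall>i. W i \<subseteq> S) \<and>
      (\<forall>i\<in>{1..l}. real (card (W i)) \<ge> (1/l - q) * card S) \<and>
      (\<forall>i\<in>{1..l}. \<forall>j\<in>{1..l}. i \<noteq> j \<longrightarrow> (\<forall>v\<in>W i. real (card {u\<in>W j. \<not> adj v u}) \<le> q * card S))"
      using typical_parts[OF cS finite_atLeastAtMost ne1 q e_def dV V'S sV aV aS] by simp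
  qed
qed

section \<open>Transversal triples and the Turan number\<close>

definition triples :: "'a set \<Rightarrow> 'a set set" where
  "triples S = {e. e \<subseteq> S \<and> card e = 3}"

definition cross_triples :: "('a \<Rightarrow> nat) \<Rightarrow> 'a set \<Rightarrow> 'a set set" where
  "cross_triples p S = {e \<in> triples S. inj_on p e}"

definition class_size :: "('a \<Rightarrow> nat) \<Rightarrow> 'a set \<Rightarrow> nat \<Rightarrow> nat" where
  "class_size p S i = card {x\<in>S. p x = i}"

lemma finite_triples: "finite S \<Longrightarrow> finite (triples S)"
  by (rule finite_subset[of _ "Pow S"]) (auto simp: triples_def)

lemma card_triples_le: "finite S \<Longrightarrow> card (triples S) \<le> card S ^ 3"
proof -
  assume S: "finite S"
  have "card (triples S) = card S choose 3" using n_subsets[OF S] by (simp add: triples_def)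
  also have "\<dots> \<le> card S ^ 3"
    by (cases "3 \<le> card S") (auto simp: binomial_le_pow binomial_eq_0)
  finally show ?thesis .
qed

section \<open>Counting transversal triples by class sizes\<close>

lemma card_distinct_lists_of_triples:
  assumes "finite T" "\<And>e. e \<in> T \<Longrightarrow> card e = 3"
  shows "card {xs. distinct xs \<and> set xs \<in> T} = 6 * card T"
proof -
  have f: "finite e" if "e \<in> T" for e using assms(2)[OF that] by (intro card_ge_0_finite) simp
  have "{xs. distinct xs \<and> set xs \<in> T} = (\<Union>e\<in>T. permutations_of_set e)"
    by (auto simp: permutations_of_set_def)
  also have "card \<dots> = (\<Sum>e\<in>T. card (permutations_of_set e))"
    using assms(1) f by (intro card_UN_disjoint) (auto dest: permutations_of_setD)
  also have "\<dots> = (\<Sum>e\<in>T. 6)"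
    using assms(2) f by (intro sum.cong) (auto simp: fact_numeral)
  finally show ?thesis by simp
qed

lemma sum_by_class:
  fixes g :: "nat \<Rightarrow> int"
  assumes "finite S" "finite I" "p ` S \<subseteq> I"
  shows "(\<Sum>x\<in>S. g (p x)) = (\<Sum>i\<in>I. int (class_size p S i) * g i)"
proof -
  have "(\<Sum>x\<in>S. g (p x)) = (\<Sum>i\<in>I. \<Sum>x | x \<in> S \<and> p x = i. g (p x))"
    by (rule sum.group[OF assms, symmetric])
  also have "\<dots> = (\<Sum>i\<in>I. \<Sum>x | x \<in> S \<and> p x = i. g i)"
    by (intro sum.cong) auto
  finally show ?thesis by (simp add: class_size_def)
qed

text \<open>Newton's formula for the third elementary symmetric polynomial of the class sizes in
  terms of power sums, with 6 for the orderings of a triple. It comes from writing the indicator of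
  three distinct classes as 1, minus the three indicators of a coincidence of two classes, plus
  twice the indicator that all coincide.\<close>

lemma card_cross_triples:
  assumes S: "finite S" and I: "finite I" "p ` S \<subseteq> I"
  shows "6 * int (card (cross_triples p S)) =
    int (card S) ^ 3 - 3 * int (card S) * (\<Sum>i\<in>I. int (class_size p S i) ^ 2)
      + 2 * (\<Sum>i\<in>I. int (class_size p S i) ^ 3)"
proof -
  define O3 where "O3 = {(x, y, z). x \<in> S \<and> y \<in> S \<and> z \<in> S \<and> p x \<noteq> p y \<and> p x \<noteq> p z \<and> p y \<noteq> p z}"
  have fin: "finite (cross_triples p S)" using finite_triples[OF S] by (simp add: cross_triples_def)
  have "{xs. distinct xs \<and> set xs \<in> cross_triples p S} = (\<lambda>(x, y, z). [x, y, z]) ` O3"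
  proof (intro equalityI subsetI)
    fix xs assume xs: "xs \<in> {xs. distinct xs \<and> set xs \<in> cross_triples p S}"
    then have "length xs = 3"
      by (metis (mono_tags, lifting) cross_triples_def distinct_card mem_Collect_eq triples_def)
    then obtain x y z where e: "xs = [x, y, z]" by (auto simp: length_Suc_conv numeral_3_eq_3)
    then have "(x, y, z) \<in> O3"
      using xs by (auto simp: O3_def cross_triples_def triples_def)
    then show "xs \<in> (\<lambda>(x, y, z). [x, y, z]) ` O3" using e by (auto simp: image_iff intro!: bexI)
  next
    fix xs assume "xs \<in> (\<lambda>(x, y, z). [x, y, z]) ` O3"
    then show "xs \<in> {xs. distinct xs \<and> set xs \<in> cross_triples p S}"
      by (auto simp: O3_def cross_triples_def triples_def card_insert_if)
  qed
  then have "card O3 = card {xs. distinct xs \<and> set xs \<in> cross_triples p S}"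
    by (simp add: card_image inj_on_def split_beta prod_eq_iff)
  also have "\<dots> = 6 * card (cross_triples p S)"
    by (rule card_distinct_lists_of_triples[OF fin]) (auto simp: cross_triples_def triples_def)
  finally have six: "6 * int (card (cross_triples p S)) = int (card O3)" by simp
  let ?e = "\<lambda>b::bool. if b then 1 else 0 :: int"
  have "int (card O3) = (\<Sum>w\<in>S \<times> S \<times> S. ?e (w \<in> O3))"
  proof -
    have "O3 \<subseteq> S \<times> S \<times> S" by (auto simp: O3_def)
    then show ?thesis using S by (simp add: sum.If_cases Int_absorb1)
  qed
  also have "\<dots> = (\<Sum>x\<in>S. \<Sum>y\<in>S. \<Sum>z\<in>S. ?e ((x, y, z) \<in> O3))"
    by (simp add: sum.cartesian_product split_beta)
  also have "\<dots> = (\<Sum>x\<in>S. \<Sum>y\<in>S. \<Sum>z\<in>S. 1 - ?e (p y = p x) - ?e (p z = p x) - ?e (p z = p y)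
      + 2 * (?e (p y = p x) * ?e (p z = p x)))"
    by (intro sum.cong refl) (auto simp: O3_def)
  finally have c: "int (card O3) = \<dots>" .
  define s where "s i = int (class_size p S i)" for i
  have eq: "(\<Sum>y\<in>S. ?e (p y = i)) = s i" for i
    using S by (simp add: s_def class_size_def sum.If_cases Int_def)
  have sx: "(\<Sum>x\<in>S. s (p x)) = (\<Sum>i\<in>I. s i ^ 2)"
    using sum_by_class[OF S I, of s] by (simp add: s_def power2_eq_square)
  have sx2: "(\<Sum>x\<in>S. s (p x) * s (p x)) = (\<Sum>i\<in>I. s i ^ 3)"
    using sum_by_class[OF S I, of "\<lambda>i. s i * s i"] by (simp add: s_def power3_eq_cube mult.assoc)
  define n where "n = int (card S)"
  have one: "(\<Sum>x\<in>S. (1::int)) = n" by (simp add: n_def)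
  have "(\<Sum>x\<in>S. \<Sum>y\<in>S. \<Sum>z\<in>S. 1 - ?e (p y = p x) - ?e (p z = p x) - ?e (p z = p y)
      + 2 * (?e (p y = p x) * ?e (p z = p x)))
    = (\<Sum>x\<in>S. \<Sum>y\<in>S. n - n * ?e (p y = p x) - s (p x) - s (p y) + 2 * (?e (p y = p x) * s (p x)))"
    by (intro sum.cong refl)
       (simp only: sum.distrib sum_subtractf eq sum_distrib_left[symmetric] sum_constant, simp add: n_def)
  also have "\<dots> = (\<Sum>x\<in>S. n * n - n * s (p x) - n * s (p x) - (\<Sum>i\<in>I. s i ^ 2) + 2 * (s (p x) * s (p x)))"
    by (intro sum.cong refl)
       (simp only: sum.distrib sum_subtractf eq sx sum_distrib_left[symmetric] sum_distrib_right[symmetric] sum_constant, simp add: n_def)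
  also have "\<dots> = n * (n * n) - n * (\<Sum>i\<in>I. s i ^ 2) - n * (\<Sum>i\<in>I. s i ^ 2) - n * (\<Sum>i\<in>I. s i ^ 2) + 2 * (\<Sum>i\<in>I. s i ^ 3)"
    by (simp only: sum.distrib sum_subtractf sx sx2 sum_distrib_left[symmetric] sum_constant, simp add: n_def)
  finally show ?thesis using six c
    by (simp add: s_def n_def power3_eq_cube algebra_simps)
qed

lemma sum_class_size:
  assumes "finite S" "finite I" "p ` S \<subseteq> I"
  shows "(\<Sum>i\<in>I. class_size p S i) = card S"
proof -
  have "int (\<Sum>i\<in>I. class_size p S i) = int (card S)"
    using sum_by_class[OF assms, of "\<lambda>_. 1"] by simp
  then show ?thesis by (simp only: of_nat_eq_iff)
qed

text \<open>Moving one unit from \<open>i\<close> to \<open>j\<close> changes the sum by \<open>-6 (n - s i - s j) (s i - s j - 1)\<close>.\<close>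

lemma balanced_minimizes:
  fixes b s :: "'i \<Rightarrow> int" and n :: int
  assumes I: "finite I" and b: "(\<Sum>i\<in>I. b i) = n" "\<And>i j. i \<in> I \<Longrightarrow> j \<in> I \<Longrightarrow> b i \<le> b j + 1"
  shows "(\<Sum>i\<in>I. s i) = n \<Longrightarrow> (\<And>i. i \<in> I \<Longrightarrow> s i \<ge> 0) \<Longrightarrow>
    (\<Sum>i\<in>I. 3 * n * b i ^ 2 - 2 * b i ^ 3) \<le> (\<Sum>i\<in>I. 3 * n * s i ^ 2 - 2 * s i ^ 3)"
proof (induction "nat (\<Sum>i\<in>I. \<bar>s i - b i\<bar>)" arbitrary: s rule: less_induct)
  case less
  let ?g = "\<lambda>x::int. 3 * n * x ^ 2 - 2 * x ^ 3"
  show ?case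
  proof (cases "\<forall>i\<in>I. s i = b i")
    case True
    then have "(\<Sum>i\<in>I. ?g (b i)) = (\<Sum>i\<in>I. ?g (s i))" by (intro sum.cong) auto
    then show ?thesis by simp
  next
    case False
    have "\<exists>i\<in>I. s i > b i"
    proof (rule ccontr)
      assume "\<not> ?thesis"
      then have a: "\<forall>i\<in>I. s i \<le> b i" by auto
      moreover obtain k where "k \<in> I" "s k < b k" using False a by force
      ultimately have "(\<Sum>i\<in>I. s i) < (\<Sum>i\<in>I. b i)" using I by (intro sum_strict_mono_ex1) auto
      then show False using less.prems b by simp
    qed
    then obtain i where i: "i \<in> I" "s i > b i" by blast
    have "\<exists>j\<in>I. s j < b j"
    proof (rule ccontr)
      assume "\<not> ?thesis"
      then have a: "\<forall>i\<in>I. b i \<le> s i" by auto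
      then have "(\<Sum>i\<in>I. b i) < (\<Sum>i\<in>I. s i)" using I i by (intro sum_strict_mono_ex1) auto
      then show False using less.prems b by simp
    qed
    then obtain j where j: "j \<in> I" "s j < b j" by blast
    have ij: "i \<noteq> j" using i j by auto
    define R where "R = I - {i, j}"
    define s' where "s' = s(i := s i - 1, j := s j + 1)"
    have split: "(\<Sum>k\<in>I. f (r k)) = f (r i) + f (r j) + (\<Sum>k\<in>R. f (r k))" for f :: "int \<Rightarrow> int" and r
    proof -
      have "I - {i} - {j} = R" by (auto simp: R_def)
      then show ?thesis
        using sum.remove[OF I i(1), of "\<lambda>k. f (r k)"] sum.remove[of "I - {i}" j "\<lambda>k. f (r k)"] I j ij by simp
    qed
    have sR: "(\<Sum>k\<in>R. f (s' k)) = (\<Sum>k\<in>R. f (s k))" for f :: "int \<Rightarrow> int"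
      by (intro sum.cong) (auto simp: s'_def R_def)
    have s'v: "s' i = s i - 1" "s' j = s j + 1" using ij by (auto simp: s'_def)
    have "(\<Sum>k\<in>I. s' k) = n" using split[of "\<lambda>x. x" s'] split[of "\<lambda>x. x" s] sR[of "\<lambda>x. x"] s'v less.prems(1) by simp
    moreover have b_le: "b i \<le> b j + 1" "b j \<le> b i + 1" using b(2) i j by auto
    \<comment> \<open>Together with \<open>s i > b i\<close> this keeps the decreased value
      \<open>s i - 1\<close> nonnegative.\<close>
    moreover have "b k \<ge> 0" if "k \<in> I" for k
    proof (rule ccontr)
      assume "\<not> b k \<ge> 0"
      then have "\<forall>m\<in>I. b m \<le> 0" using b(2) that by force
      then have "b j \<le> 0" using j by blast
      then show False using j less.prems(2)[OF j(1)] by linarith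
    qed
    then have "s' k \<ge> 0" if "k \<in> I" for k
      using less.prems(2)[OF that] less.prems(2)[OF j(1)] i that by (auto simp: s'_def) (smt (verit))
    moreover have dec: "(\<Sum>k\<in>I. \<bar>s' k - b k\<bar>) < (\<Sum>k\<in>I. \<bar>s k - b k\<bar>)"
    proof -
      have "(\<Sum>k\<in>I. \<bar>r k - b k\<bar>) = \<bar>r i - b i\<bar> + \<bar>r j - b j\<bar> + (\<Sum>k\<in>R. \<bar>r k - b k\<bar>)" for r
        using split[of "\<lambda>x. x" "\<lambda>k. \<bar>r k - b k\<bar>"] by simp
      moreover have "(\<Sum>k\<in>R. \<bar>s' k - b k\<bar>) = (\<Sum>k\<in>R. \<bar>s k - b k\<bar>)"
        by (intro sum.cong) (auto simp: s'_def R_def)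
      ultimately show ?thesis using s'v i j by simp
    qed
    moreover have "(\<Sum>k\<in>I. \<bar>s' k - b k\<bar>) \<ge> 0" by (intro sum_nonneg) auto
    moreover from dec this have "(\<Sum>k\<in>I. \<bar>s k - b k\<bar>) > 0" by linarith
    ultimately have "(\<Sum>i\<in>I. ?g (b i)) \<le> (\<Sum>i\<in>I. ?g (s' i))"
      using less.hyps[of s'] by simp
    also have "\<dots> \<le> (\<Sum>i\<in>I. ?g (s i))"
    proof -
      have "s i + s j \<le> n"
      proof -
        have "(\<Sum>k\<in>R. s k) \<ge> 0" using less.prems(2) by (intro sum_nonneg) (auto simp: R_def)
        then show ?thesis using split[of "\<lambda>x. x" s] less.prems(1) by simp
      qed
      moreover have "s i - s j - 1 \<ge> 0" using i j b_le by linarith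
      ultimately have "(n - s i - s j) * (s i - s j - 1) \<ge> 0" by simp
      moreover have "?g (s i) + ?g (s j) - ?g (s i - 1) - ?g (s j + 1) = 6 * ((n - s i - s j) * (s i - s j - 1))"
        by (simp add: power2_eq_square power3_eq_cube algebra_simps)
      ultimately have "?g (s i - 1) + ?g (s j + 1) \<le> ?g (s i) + ?g (s j)" by linarith
      then show ?thesis using split[of ?g s] split[of ?g s'] sR[of ?g] s'v by simp
    qed
    finally show ?thesis .
  qed
qed

section \<open>The Turan number as a count of transversal triples\<close>

lemma complete_hypergraph_3: "complete_hypergraph 3 n = triples {1..n}"
  by (simp add: complete_hypergraph_def triples_def)

text \<open>Trades the partition chosen by \<open>SOME\<close> for a class function, so that the
  Turan number can be compared with the transversal triples of arbitrary class functions.\<close>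

lemma turan_number_colouring:
  assumes l: "l \<ge> 1"
  obtains p where "p ` {1..n} \<subseteq> {1..l}"
    "\<And>i j. i \<in> {1..l} \<Longrightarrow> j \<in> {1..l} \<Longrightarrow> class_size p {1..n} i \<le> class_size p {1..n} j + 1"
    "turan_number 3 n l = card (cross_triples p {1..n})"
proof -
  define V where "V = (SOME V. balanced_partition n l V)"
  have V: "balanced_partition n l V" unfolding V_def by (rule someI_ex[OF balanced_partition_exists[OF l]])
  have disj: "i = j" if "x \<in> V i" "x \<in> V j" "i \<in> {1..l}" "j \<in> {1..l}" for x i j
    using V that unfolding balanced_partition_def disjoint_family_on_def by blast
  have un: "(\<Union>i\<in>{1..l}. V i) = {1..n}" using V by (simp add: balanced_partition_def)
  define p where "p x = (THE i. i \<in> {1..l} \<and> x \<in> V i)" for x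
  have p: "p x = i" if "i \<in> {1..l}" "x \<in> V i" for x i
    unfolding p_def using that disj by (intro the_equality) auto
  have p': "p x \<in> {1..l} \<and> x \<in> V (p x)" if "x \<in> {1..n}" for x
    using that un p by (metis UN_E)
  have cls: "{x\<in>{1..n}. p x = i} = V i" if "i \<in> {1..l}" for i
    using p p' un that by auto
  have mono: "card (V j) \<le> card (V i)" if "i \<in> {1..l}" "j \<in> {1..l}" "i \<le> j" for i j
    using V that by (simp add: balanced_partition_def)
  have bal: "card (V 1) \<le> card (V l) + 1" using V by (simp add: balanced_partition_def)
  show thesis
  proof (rule that)
    show "p ` {1..n} \<subseteq> {1..l}" using p' by blast
    show "class_size p {1..n} i \<le> class_size p {1..n} j + 1" if "i \<in> {1..l}" "j \<in> {1..l}" for i j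
      using mono[of 1 i] mono[of j l] bal that cls by (simp add: class_size_def)
    have "turan_graph 3 n l V = cross_triples p {1..n}"
    proof -
      have "(\<forall>i\<in>{1..l}. card (e \<inter> V i) \<le> 1) \<longleftrightarrow> inj_on p e" if e: "e \<subseteq> {1..n}" "card e = 3" for e
      proof
        have fe: "finite e" using e by (intro card_ge_0_finite) simp
        assume a: "\<forall>i\<in>{1..l}. card (e \<inter> V i) \<le> 1"
        show "inj_on p e"
        proof (rule inj_onI)
          fix x y assume xy: "x \<in> e" "y \<in> e" "p x = p y"
          then have "x \<in> e \<inter> V (p x)" "y \<in> e \<inter> V (p x)" "p x \<in> {1..l}" using p' e(1) by (auto; metis subsetD)+
          then show "x = y" using a fe card_le_Suc0_iff_eq[of "e \<inter> V (p x)"] by auto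
        qed
      next
        have fe: "finite e" using e by (intro card_ge_0_finite) simp
        assume a: "inj_on p e"
        show "\<forall>i\<in>{1..l}. card (e \<inter> V i) \<le> 1"
        proof
          fix i assume i: "i \<in> {1..l}"
          have "x = y" if "x \<in> e \<inter> V i" "y \<in> e \<inter> V i" for x y
            using a p[OF i, of x] p[OF i, of y] that by (auto simp: inj_on_def)
          then show "card (e \<inter> V i) \<le> 1" using fe card_le_Suc0_iff_eq[of "e \<inter> V i"] by auto
        qed
      qed
      then show ?thesis unfolding turan_graph_def cross_triples_def complete_hypergraph_3
        by (auto simp: triples_def)
    qed
    then show "turan_number 3 n l = card (cross_triples p {1..n})" by (simp add: turan_number_def V_def)
  qed
qed

text \<open>Six times the count is \<open>n^3\<close> minus the very sum that balanced class sizes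
  minimise.\<close>

lemma card_cross_triples_le_turan:
  assumes S: "finite S" and l: "l \<ge> 1" and p: "p ` S \<subseteq> {1..l}"
  shows "card (cross_triples p S) \<le> turan_number 3 (card S) l"
proof -
  define n where "n = card S"
  obtain q where q: "q ` {1..n} \<subseteq> {1..l}"
    "\<And>i j. i \<in> {1..l} \<Longrightarrow> j \<in> {1..l} \<Longrightarrow> class_size q {1..n} i \<le> class_size q {1..n} j + 1"
    "turan_number 3 n l = card (cross_triples q {1..n})" using turan_number_colouring[OF l] by metis
  have F: "6 * int (card (cross_triples r T)) =
     int n ^ 3 - (\<Sum>i\<in>{1..l}. 3 * int n * int (class_size r T i) ^ 2 - 2 * int (class_size r T i) ^ 3)"
    if "finite T" "card T = n" "r ` T \<subseteq> {1..l}" for r :: "'c \<Rightarrow> nat" and T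
    using card_cross_triples[OF that(1) _ that(3)] that(2)
    by (simp add: sum_subtractf sum_distrib_left)
  have SS: "(\<Sum>i\<in>{1..l}. int (class_size r T i)) = int n"
    if "finite T" "card T = n" "r ` T \<subseteq> {1..l}" for r :: "'c \<Rightarrow> nat" and T
    using sum_class_size[OF that(1) _ that(3)] that(2) by (simp flip: of_nat_sum)
  have "(\<Sum>i\<in>{1..l}. 3 * int n * int (class_size q {1..n} i) ^ 2 - 2 * int (class_size q {1..n} i) ^ 3)
    \<le> (\<Sum>i\<in>{1..l}. 3 * int n * int (class_size p S i) ^ 2 - 2 * int (class_size p S i) ^ 3)"
    by (rule balanced_minimizes) (use SS[of "{1..n}" q] SS[of S p] q p S n_def in \<open>auto, force+\<close>)
  then show ?thesis using F[of "{1..n}" q] F[of S p] q p S n_def by simp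
qed

lemma balanced_class_bounds:
  fixes b :: "nat \<Rightarrow> nat"
  assumes l: "l \<ge> 1" and s: "(\<Sum>i\<in>{1..l}. b i) = n"
    and b: "\<And>i j. i \<in> {1..l} \<Longrightarrow> j \<in> {1..l} \<Longrightarrow> b i \<le> b j + 1" and i: "i \<in> {1..l}"
  shows "real (b i) \<le> real n / l + 1" "real (b i) \<ge> real n / l - 1"
proof -
  have "(\<Sum>j\<in>{1..l}. b i) \<le> (\<Sum>j\<in>{1..l}. b j + 1)" using b i by (intro sum_mono) auto
  then have "l * b i \<le> n + l" using s by (simp only: sum.distrib) simp
  then have "real (l * b i) \<le> real (n + l)" by (simp only: of_nat_le_iff)
  then show "real (b i) \<le> real n / l + 1" using l by (simp add: field_simps)
  have "(\<Sum>j\<in>{1..l}. b j) \<le> (\<Sum>j\<in>{1..l}. b i + 1)" using b i by (intro sum_mono) auto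
  then have "n \<le> l * (b i + 1)" using s by simp
  then have "real n \<le> real (l * (b i + 1))" by (simp only: of_nat_le_iff)
  then show "real (b i) \<ge> real n / l - 1" using l by (simp add: field_simps)
qed

text \<open>For the second bound the new point joins class 1 of a balanced partition of
  \<open>n\<close> points; whatever class function this gives, its transversal triples bound the
  Turan number from below. The coefficients 30 and 50 are generous bounds on lower order
  terms.\<close>

lemma turan_number_lower_bounds:
  assumes l: "l \<ge> 3" and n: "n \<ge> l"
  shows "6 * real (turan_number 3 n l) \<ge> (1 - 1 / real l) * (1 - 2 / real l) * real n ^ 3 - 30 * (real l * real n ^ 2)"
    and "6 * real (turan_number 3 (Suc n) l) \<ge> 6 * real (turan_number 3 n l) + 3 * (1 - 1 / real l) * (1 - 2 / real l) * real n ^ 2 - 50 * (real l * real n)"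
proof -
  have l1: "l \<ge> 1" using l by simp
  obtain p where p: "p ` {1..n} \<subseteq> {1..l}"
    "\<And>i j. i \<in> {1..l} \<Longrightarrow> j \<in> {1..l} \<Longrightarrow> class_size p {1..n} i \<le> class_size p {1..n} j + 1"
    "turan_number 3 n l = card (cross_triples p {1..n})" using turan_number_colouring[OF l1] by metis
  define b where "b i = class_size p {1..n} i" for i
  have sb: "(\<Sum>i\<in>{1..l}. b i) = n" using sum_class_size[OF _ _ p(1)] by (simp add: b_def)
  have bb: "real (b i) \<le> real n / l + 1" "real (b i) \<ge> real n / l - 1" if "i \<in> {1..l}" for i
    using balanced_class_bounds[OF l1 sb _ that] p(2) by (auto simp: b_def)
  define L N w where "L = real l" and "N = real n" and "w = real n / real l"
  have L: "L \<ge> 3" using l by (simp add: L_def)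
  have N: "N \<ge> L" using n by (simp add: N_def L_def)
  have wL: "N = L * w" using L by (simp add: w_def N_def L_def)
  have w1: "w \<ge> 1" using n l by (simp add: w_def)
  define S2 S3 where "S2 = (\<Sum>i\<in>{1..l}. real (b i) ^ 2)" and "S3 = (\<Sum>i\<in>{1..l}. real (b i) ^ 3)"
  have form: "6 * real (turan_number 3 n l) = N^3 - 3 * N * S2 + 2 * S3"
  proof -
    have "6 * int (card (cross_triples p {1..n})) =
      int n ^ 3 - 3 * int n * (\<Sum>i\<in>{1..l}. int (b i) ^ 2) + 2 * (\<Sum>i\<in>{1..l}. int (b i) ^ 3)"
      using card_cross_triples[OF _ _ p(1)] by (simp add: b_def)
    then have "real_of_int (6 * int (card (cross_triples p {1..n}))) =
      real_of_int (int n ^ 3 - 3 * int n * (\<Sum>i\<in>{1..l}. int (b i) ^ 2) + 2 * (\<Sum>i\<in>{1..l}. int (b i) ^ 3))"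
      by (simp only:)
    then show ?thesis by (simp add: p(3) N_def S2_def S3_def)
  qed
  have S2: "S2 \<le> L * (w + 1)^2"
  proof -
    have "S2 \<le> (\<Sum>i\<in>{1..l}. (w + 1)^2)" unfolding S2_def
      using bb by (intro sum_mono power_mono) (auto simp: w_def)
    then show ?thesis by (simp add: L_def)
  qed
  have S3: "S3 \<ge> L * (w - 1)^3"
  proof -
    have "(\<Sum>i\<in>{1..l}. (w - 1)^3) \<le> S3" unfolding S3_def
      using bb w1 by (intro sum_mono power_mono) (auto simp: w_def)
    then show ?thesis by (simp add: L_def)
  qed
  have NL: "N * L \<le> N^2" using N L by (simp add: power2_eq_square mult_left_mono)
  have N3: "N \<ge> 3" using N L by linarith
  have LN2: "L * N \<le> L * N^2" using L N3 by (simp add: power2_eq_square)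
  have f1: "(1 - 1/L) * (1 - 2/L) * N^3 = N^3 - 3 * N^2 * w + 2 * N * w^2"
    using L by (simp add: wL field_simps power2_eq_square power3_eq_cube)
  show "6 * real (turan_number 3 n l) \<ge> (1 - 1 / real l) * (1 - 2 / real l) * real n ^ 3 - 30 * (real l * real n ^ 2)"
  proof -
    have "3 * N * S2 \<le> 3 * N * (L * (w + 1)^2)" using S2 N L by (intro mult_left_mono) auto
    moreover have "3 * N * (L * (w + 1)^2) = 3 * N^2 * w + 6 * N^2 + 3 * (N * L)"
      by (simp add: wL power2_eq_square algebra_simps)
    moreover have "2 * (L * (w - 1)^3) = 2 * N * w^2 - 6 * N * w + 6 * N - 2 * L"
      by (simp add: wL power2_eq_square power3_eq_cube algebra_simps)
    moreover have "N * w \<le> N^2" using N L w1 by (simp add: wL power2_eq_square mult_left_mono)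
    moreover have "N^2 \<le> L * N^2" using mult_right_mono[of 1 L "N^2"] L by simp
    ultimately have "6 * real (turan_number 3 n l) \<ge> (1 - 1/L) * (1 - 2/L) * N^3 - 30 * (L * N^2)"
      using S3 f1 form NL N3 N L zero_le_power2[of N] by linarith
    then show ?thesis by (simp add: L_def N_def)
  qed
  define p' where "p' = p(Suc n := 1)"
  have p'I: "p' ` {1..Suc n} \<subseteq> {1..l}" using p(1) l by (auto simp: p'_def le_Suc_eq)
  have cs: "class_size p' {1..Suc n} i = (if i = 1 then b 1 + 1 else b i)" for i
  proof -
    have "{x\<in>{1..Suc n}. p' x = i} = (if i = 1 then insert (Suc n) {x\<in>{1..n}. p x = i} else {x\<in>{1..n}. p x = i})"
      by (auto simp: p'_def le_Suc_eq)
    then show ?thesis by (simp add: class_size_def b_def)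
  qed
  define a where "a = real (b 1)"
  have one: "(1::nat) \<in> {1..l}" using l by simp
  have a: "a \<le> w + 1" "a \<ge> w - 1" using bb[OF one] by (auto simp: a_def w_def)
  have upd: "(\<Sum>i\<in>{1..l}. f (class_size p' {1..Suc n} i)) = (\<Sum>i\<in>{1..l}. f (b i)) - f (b 1) + f (b 1 + 1)"
    for f :: "nat \<Rightarrow> int"
  proof -
    have "(\<Sum>i\<in>{1..l}. f (class_size p' {1..Suc n} i)) = f (b 1 + 1) + (\<Sum>i\<in>{1..l} - {1}. f (class_size p' {1..Suc n} i))"
      using one cs[of 1] by (subst sum.remove[of _ 1]) auto
    moreover have "(\<Sum>i\<in>{1..l} - {1}. f (class_size p' {1..Suc n} i)) = (\<Sum>i\<in>{1..l} - {1}. f (b i))"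
      by (intro sum.cong refl) (simp add: cs[simplified])
    moreover have "(\<Sum>i\<in>{1..l}. f (b i)) = f (b 1) + (\<Sum>i\<in>{1..l} - {1}. f (b i))"
      using one by (subst sum.remove[of _ 1]) auto
    ultimately show ?thesis by simp
  qed
  have form': "6 * real (card (cross_triples p' {1..Suc n})) =
     (N + 1)^3 - 3 * (N + 1) * (S2 - a^2 + (a + 1)^2) + 2 * (S3 - a^3 + (a + 1)^3)"
  proof -
    have "6 * int (card (cross_triples p' {1..Suc n})) =
      int (Suc n) ^ 3 - 3 * int (Suc n) * ((\<Sum>i\<in>{1..l}. int (b i) ^ 2) - int (b 1)^2 + int (b 1 + 1)^2)
       + 2 * ((\<Sum>i\<in>{1..l}. int (b i) ^ 3) - int (b 1)^3 + int (b 1 + 1)^3)"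
      using card_cross_triples[OF _ _ p'I] upd[of "\<lambda>x. int x ^ 2"] upd[of "\<lambda>x. int x ^ 3"] by simp
    then have "real_of_int (6 * int (card (cross_triples p' {1..Suc n}))) =
      real_of_int (int (Suc n) ^ 3 - 3 * int (Suc n) * ((\<Sum>i\<in>{1..l}. int (b i) ^ 2) - int (b 1)^2 + int (b 1 + 1)^2)
       + 2 * ((\<Sum>i\<in>{1..l}. int (b i) ^ 3) - int (b 1)^3 + int (b 1 + 1)^3))"
      by (simp only:)
    then show ?thesis by (simp add: N_def S2_def S3_def a_def add.commute)
  qed
  have "card (cross_triples p' {1..Suc n}) \<le> turan_number 3 (Suc n) l"
    using card_cross_triples_le_turan[OF _ l1 p'I] by simp
  then have ge: "6 * real (turan_number 3 (Suc n) l) \<ge> 6 * real (card (cross_triples p' {1..Suc n}))" by simp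
  show "6 * real (turan_number 3 (Suc n) l) \<ge> 6 * real (turan_number 3 n l) + 3 * (1 - 1 / real l) * (1 - 2 / real l) * real n ^ 2 - 50 * (real l * real n)"
  proof -
    have diff: "(N + 1)^3 - 3 * (N + 1) * (S2 - a^2 + (a + 1)^2) + 2 * (S3 - a^3 + (a + 1)^3) - (N^3 - 3 * N * S2 + 2 * S3)
      = 3 * N^2 + 3 * N + 1 - 3 * S2 - 3 * (N + 1) * (2 * a + 1) + 6 * a^2 + 6 * a + 2"
      by (simp add: power2_eq_square power3_eq_cube algebra_simps)
    have f2: "3 * (1 - 1/L) * (1 - 2/L) * N^2 = 3 * N^2 - 9 * N * w + 6 * w^2"
      using L by (simp add: wL field_simps power2_eq_square)
    have "3 * S2 \<le> 3 * N * w + 6 * N + 3 * L"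
      using S2 by (simp add: wL power2_eq_square algebra_simps)
    moreover have "3 * (N + 1) * (2 * a + 1) \<le> 3 * (N + 1) * (2 * (w + 1) + 1)"
      using a N L by (intro mult_left_mono) auto
    moreover have "3 * (N + 1) * (2 * (w + 1) + 1) = 6 * N * w + 9 * N + 6 * w + 9" by (simp add: algebra_simps)
    moreover have "a^2 \<ge> (w - 1)^2" using a w1 by (intro power_mono) auto
    moreover have "(w - 1)^2 = w^2 - 2 * w + 1" by (simp add: power2_eq_square algebra_simps)
    moreover have "w \<le> N" using L w1 by (simp add: wL)
    moreover have "3 * N \<le> L * N" using L N3 by (intro mult_right_mono) auto
    ultimately have "6 * real (card (cross_triples p' {1..Suc n})) \<ge> 6 * real (turan_number 3 n l) + 3 * (1 - 1/L) * (1 - 2/L) * N^2 - 50 * (L * N)"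
      using diff f2 form form' N3 N L w1 a by linarith
    then show ?thesis using ge by (simp add: L_def N_def)
  qed
qed

section \<open>Colourings without rainbow copies\<close>

lemma blowup_KI:
  "i \<in> {1..l} \<Longrightarrow> j \<in> {1..l} \<Longrightarrow> i \<noteq> j \<Longrightarrow> a \<in> {1..t} \<Longrightarrow> b \<in> {1..t} \<Longrightarrow> {(i, a), (j, b)} \<in> blowup_K l t"
  unfolding blowup_K_def by blast

text \<open>As \<open>t > l\<close>, every part repeats some class. If the class repeated in part
  \<open>k\<close> occurred at a vertex of another part, that vertex would form monochromatic edges
  with both repeated vertices, against \<open>uniq\<close>. So the repeated classes of different
  parts differ, together they are all \<open>l\<close> classes, and every part has only its own
  class left.\<close>

lemma rigid_blowup_colouring:
  fixes q :: "nat \<times> nat \<Rightarrow> nat"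
  assumes tl: "l < t"
    and q: "\<And>i a. i \<in> {1..l} \<Longrightarrow> a \<in> {1..t} \<Longrightarrow> q (i, a) \<in> {1..l}"
    and uniq: "\<And>u v x y. {u, v} \<in> blowup_K l t \<Longrightarrow> {x, y} \<in> blowup_K l t \<Longrightarrow>
      q u = q v \<Longrightarrow> q x = q y \<Longrightarrow> q u = q x \<Longrightarrow> {u, v} = {x, y}"
    and i: "i \<in> {1..l}" and ab: "a \<in> {1..t}" "b \<in> {1..t}"
  shows "q (i, a) = q (i, b)"
proof -
  have "\<exists>a b. a \<in> {1..t} \<and> b \<in> {1..t} \<and> a \<noteq> b \<and> q (j, a) = q (j, b)" if "j \<in> {1..l}" for j
  proof -
    have "card ((\<lambda>a. q (j, a)) ` {1..t}) \<le> card {1..l}" using q[OF that] by (intro card_mono) auto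
    then have "\<not> inj_on (\<lambda>a. q (j, a)) {1..t}" using tl by (intro pigeonhole) simp
    then show ?thesis unfolding inj_on_def by blast
  qed
  then obtain A B where AB: "\<And>j. j \<in> {1..l} \<Longrightarrow> A j \<in> {1..t} \<and> B j \<in> {1..t} \<and> A j \<noteq> B j \<and> q (j, A j) = q (j, B j)"
    by metis
  have clash: False if "j \<in> {1..l}" "k \<in> {1..l}" "j \<noteq> k" "a \<in> {1..t}" "q (j, a) = q (k, A k)" for j k a
  proof -
    have "{(j, a), (k, A k)} = {(j, a), (k, B k)}"
      by (rule uniq) (use AB[OF that(2)] that blowup_KI in auto)
    then show False using AB[OF that(2)] that(3) by (auto simp: doubleton_eq_iff)
  qed
  have "inj_on (\<lambda>j. q (j, A j)) {1..l}"
    by (rule inj_onI) (use clash AB in blast)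
  moreover have "(\<lambda>j. q (j, A j)) ` {1..l} \<subseteq> {1..l}" using q AB by blast
  ultimately have sur: "(\<lambda>j. q (j, A j)) ` {1..l} = {1..l}"
    by (intro endo_inj_surj) auto
  have "q (i, a) = q (i, A i)" if a: "a \<in> {1..t}" for a
  proof -
    have "q (i, a) \<in> (\<lambda>j. q (j, A j)) ` {1..l}" using q[OF i a] sur by simp
    then obtain j where "j \<in> {1..l}" "q (i, a) = q (j, A j)" by blast
    then show ?thesis using clash[of i j a] i a by (cases "i = j") auto
  qed
  then show ?thesis using ab by simp
qed

text \<open>Well defined on triples that are not transversal, because two pairs in a triple always
  meet.\<close>

definition repeated_class :: "('a \<Rightarrow> nat) \<Rightarrow> 'a set \<Rightarrow> nat" where
  "repeated_class p e = (THE i. \<exists>x\<in>e. \<exists>y\<in>e. x \<noteq> y \<and> p x = i \<and> p y = i)"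

lemma repeated_class_eq:
  assumes e: "card e = 3" and x: "x \<in> e" "y \<in> e" "x \<noteq> y" "p x = i" "p y = i"
  shows "repeated_class p e = i"
  unfolding repeated_class_def
proof (rule the_equality)
  show "\<exists>x\<in>e. \<exists>y\<in>e. x \<noteq> y \<and> p x = i \<and> p y = i" using x by blast
  fix j assume "\<exists>x\<in>e. \<exists>y\<in>e. x \<noteq> y \<and> p x = j \<and> p y = j"
  then obtain x' y' where x': "x' \<in> e" "y' \<in> e" "x' \<noteq> y'" "p x' = j" "p y' = j" by blast
  have fe: "finite e" using e by (intro card_ge_0_finite) simp
  have "{x, y} \<inter> {x', y'} \<noteq> {}"
  proof
    assume "{x, y} \<inter> {x', y'} = {}"
    then have "card {x, y, x', y'} = 4" using x(3) x'(3) by auto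
    moreover have "card {x, y, x', y'} \<le> card e" using fe x x' by (intro card_mono) auto
    ultimately show False using e by simp
  qed
  then show "j = i" using x x' by auto
qed

text \<open>The map \<open>g\<close> merges the \<open>l\<close> class colours into
  \<open>k\<close>: the identity keeps all of them, a constant leaves one. Fewer colours, down to
  any \<open>m \<ge> 1\<close>, are obtained by truncation with \<open>min m\<close>, which only
  identifies colours and so creates no rainbow copy.\<close>

lemma rainbow_free_colouring:
  fixes F :: "'v set set" and g p :: "nat \<Rightarrow> nat" and n :: nat
  assumes p: "p ` {1..n} \<subseteq> {1..l}" and big: "\<And>i. i \<in> {1..l} \<Longrightarrow> class_size p {1..n} i \<ge> 2" and n: "n \<ge> 3"
    and g: "g ` {1..l} = {1..k}"
    and F: "\<And>q. (\<And>x. x \<in> \<Union>F \<Longrightarrow> q x \<in> {1..l}) \<Longrightarrow>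
      \<exists>u v x y. {u, v} \<in> F \<and> {x, y} \<in> F \<and> {u, v} \<noteq> {x, y} \<and> u \<noteq> v \<and> x \<noteq> y \<and>
        q u = q v \<and> q x = q y \<and> g (q u) = g (q x)"
    and m: "1 \<le> m" "m \<le> card (cross_triples p {1..n}) + k"
  shows "\<exists>\<chi>. \<chi> ` triples {1..n} = {1..m} \<and>
    \<not> (\<exists>H \<subseteq> triples {1..n}. is_copy_of H (expansion F) \<and> rainbow \<chi> H)"
proof -
  define T where "T = cross_triples p {1..n}"
  have fT: "finite T" using finite_triples[of "{1..n}"] by (simp add: T_def cross_triples_def)
  obtain h0 where "bij_betw h0 {1..card T} T" using ex_bij_betw_nat_finite_1[OF fT] by blast
  then obtain h where h: "bij_betw h T {1..card T}" using bij_betw_inv by blast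
  define c0 where "c0 e = (if inj_on p e then h e else card T + g (repeated_class p e))" for e
  have bad: "c0 e = card T + g i" if "card e = 3" "x \<in> e" "y \<in> e" "x \<noteq> y" "p x = i" "p y = i" for e x y i
  proof -
    have "\<not> inj_on p e" using that by (auto simp: inj_on_def)
    then show ?thesis using repeated_class_eq[of e x y p i] that by (simp add: c0_def)
  qed
  have good: "c0 e \<in> {1..card T}" if "e \<in> T" for e
    using bij_betwE[OF h] that by (auto simp: c0_def T_def cross_triples_def)
  have img: "c0 ` triples {1..n} = {1..card T + k}"
  proof (intro equalityI subsetI)
    fix c assume "c \<in> c0 ` triples {1..n}"
    then obtain e where e: "e \<in> triples {1..n}" "c = c0 e" by blast
    show "c \<in> {1..card T + k}"
    proof (cases "inj_on p e")
      case True
      then have "e \<in> T" using e by (simp add: T_def cross_triples_def)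
      then show ?thesis using good e by fastforce
    next
      case False
      then obtain x y where xy: "x \<in> e" "y \<in> e" "x \<noteq> y" "p x = p y" by (auto simp: inj_on_def)
      have "card e = 3" using e(1) by (simp add: triples_def)
      then have "c = card T + g (p x)" unfolding e(2) by (rule bad[OF _ xy(1-3) refl xy(4)[symmetric]])
      moreover have "x \<in> {1..n}" using e xy(1) unfolding triples_def by blast
      then have "p x \<in> {1..l}" using p by blast
      then have "g (p x) \<in> {1..k}" using g by blast
      ultimately show ?thesis by auto
    qed
  next
    fix c assume c: "c \<in> {1..card T + k}"
    show "c \<in> c0 ` triples {1..n}"
    proof (cases "c \<le> card T")
      case True
      then have "c \<in> h ` T" using c h by (auto simp: bij_betw_def)
      then obtain e where e: "e \<in> T" "c = h e" by blast
      then have "c = c0 e" "e \<in> triples {1..n}" by (auto simp: c0_def T_def cross_triples_def)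
      then show ?thesis by blast
    next
      case False
      then have "c - card T \<in> g ` {1..l}" using c g by auto
      then obtain i where i: "i \<in> {1..l}" "c - card T = g i" by blast
      \<comment> \<open>The colour of class \<open>i\<close> is realised by two of its points and an
        arbitrary third point.\<close>
      have "\<exists>x y. x \<noteq> y \<and> x \<in> {x\<in>{1..n}. p x = i} \<and> y \<in> {x\<in>{1..n}. p x = i}"
      proof (rule ccontr)
        assume "\<not> ?thesis"
        then have "card {x\<in>{1..n}. p x = i} \<le> Suc 0" by (subst card_le_Suc0_iff_eq) auto
        then show False using big[OF i(1)] by (simp add: class_size_def)
      qed
      then obtain x y where xy: "x \<noteq> y" "x \<in> {1..n}" "y \<in> {1..n}" "p x = i" "p y = i" by blast
      have "card ({1..n} - {x, y}) > 0" using n xy by (simp add: card_Diff_subset)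
      then have "{1..n} - {x, y} \<noteq> {}" by (auto simp only: card_gt_0_iff)
      then obtain z where z: "z \<in> {1..n}" "z \<noteq> x" "z \<noteq> y" by blast
      have e3: "card {x, y, z} = 3" using xy z by simp
      then have "c0 {x, y, z} = card T + g i" using bad[of "{x, y, z}" x y i] xy by simp
      also have "\<dots> = c" using i(2) False by simp
      finally show ?thesis using e3 xy z by (intro rev_image_eqI[of "{x, y, z}"]) (auto simp: triples_def)
    qed
  qed
  have norain: False if H: "H \<subseteq> triples {1..n}" "is_copy_of H (expansion F)" "rainbow c0 H" for H
  proof -
    obtain \<phi> where phi: "inj_on \<phi> (\<Union>(expansion F))" and Heq: "H = (\<lambda>e. \<phi> ` e) ` expansion F"
      using H(2) by (auto simp: is_copy_of_def)
    define E where "E e = insert (Inr e) (Inl ` e)" for e :: "'v set"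
    have EF: "E e \<in> expansion F" if "e \<in> F" for e using that by (auto simp: expansion_def E_def)
    have tr: "\<phi> ` E e \<subseteq> {1..n}" "card (\<phi> ` E e) = 3" "\<phi> ` E e \<in> H" if "e \<in> F" for e
      using H(1) EF[OF that] Heq by (auto simp: triples_def)
    have "p (\<phi> (Inl x)) \<in> {1..l}" if xF: "x \<in> \<Union>F" for x
    proof -
      obtain e where e: "e \<in> F" "x \<in> e" using xF by blast
      then have "\<phi> (Inl x) \<in> \<phi> ` E e" by (simp add: E_def)
      then have "\<phi> (Inl x) \<in> {1..n}" using tr(1)[OF e(1)] by blast
      then show ?thesis using p by blast
    qed
    from F[of "\<lambda>x. p (\<phi> (Inl x))", OF this] obtain u v x y where
      uv: "{u, v} \<in> F" "{x, y} \<in> F" "{u, v} \<noteq> {x, y}" "u \<noteq> v" "x \<noteq> y" "p (\<phi> (Inl u)) = p (\<phi> (Inl v))"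
      "p (\<phi> (Inl x)) = p (\<phi> (Inl y))" "g (p (\<phi> (Inl u))) = g (p (\<phi> (Inl x)))" by blast
    have col: "c0 (\<phi> ` E {a, b}) = card T + g (p (\<phi> (Inl a)))"
      if "{a, b} \<in> F" "a \<noteq> b" "p (\<phi> (Inl a)) = p (\<phi> (Inl b))" for a b
    proof -
      have "Inl a \<in> E {a, b}" "Inl b \<in> E {a, b}" by (auto simp: E_def)
      then have "Inl a \<in> \<Union>(expansion F)" "Inl b \<in> \<Union>(expansion F)" using EF[OF that(1)] by blast+
      then have "\<phi> (Inl a) \<noteq> \<phi> (Inl b)" using phi that(2) by (auto dest: inj_onD)
      then show ?thesis using tr(2)[OF that(1)] that(3)
        by (intro bad[where x = "\<phi> (Inl a)" and y = "\<phi> (Inl b)"]) (auto simp: E_def)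
    qed
    have "c0 (\<phi> ` E {u, v}) = c0 (\<phi> ` E {x, y})" using col[of u v] col[of x y] uv by simp
    then have "\<phi> ` E {u, v} = \<phi> ` E {x, y}"
      using H(3) tr(3) uv by (auto simp: rainbow_def dest: inj_onD)
    then have "E {u, v} = E {x, y}"
      using inj_on_image_eq_iff[OF phi, of "E {u, v}" "E {x, y}"] EF uv by blast
    \<comment> \<open>The new vertex \<open>Inr e\<close> remembers \<open>e\<close>, so different
      core edges have different expanded edges.\<close>
    moreover have "Inr {u, v} \<in> E {u, v}" by (simp add: E_def)
    ultimately have "Inr {u, v} \<in> E {x, y}" by simp
    then show False using uv(3) by (auto simp: E_def)
  qed
  define c where "c e = min m (c0 e)" for e
  have "c ` triples {1..n} = (min m) ` {1..card T + k}" unfolding img[symmetric] c_def image_image by (rule refl)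
  also have "\<dots> = {1..m}"
  proof (intro equalityI subsetI)
    fix x assume "x \<in> {1..m}"
    then show "x \<in> min m ` {1..card T + k}" using m by (intro rev_image_eqI[of x]) (auto simp: T_def)
  qed (use m in auto)
  finally have "c ` triples {1..n} = {1..m}" .
  moreover have "rainbow c0 H" if "rainbow c H" for H
    using that by (auto simp: rainbow_def inj_on_def c_def)
  ultimately show ?thesis using norain by blast
qed

text \<open>The property minimised in \<open>anti_ramsey\<close> is not monotone in \<open>m\<close>
  by its form, so a colouring is asked for with every number of colours up to
  \<open>N\<close>.\<close>

lemma anti_ramsey_eqI:
  assumes F: "\<And>m. 1 \<le> m \<Longrightarrow> m \<le> N \<Longrightarrow> \<exists>\<chi>. \<chi> ` triples {1..n} = {1..m} \<and>
    \<not> (\<exists>H \<subseteq> triples {1..n}. is_copy_of H F \<and> rainbow \<chi> H)"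
    and ub: "\<And>\<chi> :: nat set \<Rightarrow> nat. card (\<chi> ` triples {1..n}) = N + 1 \<Longrightarrow>
      \<exists>H \<subseteq> triples {1..n}. is_copy_of H F \<and> rainbow \<chi> H"
  shows "anti_ramsey n F = N + 1"
  unfolding anti_ramsey_def complete_hypergraph_3
proof (rule Least_equality)
  show "N + 1 \<ge> 1 \<and> (\<forall>\<chi> :: nat set \<Rightarrow> nat. \<chi> ` triples {1..n} = {1..N + 1} \<longrightarrow>
        (\<exists>H \<subseteq> triples {1..n}. is_copy_of H F \<and> rainbow \<chi> H))"
    using ub by simp
next
  fix m assume m: "m \<ge> 1 \<and> (\<forall>\<chi> :: nat set \<Rightarrow> nat. \<chi> ` triples {1..n} = {1..m} \<longrightarrow>
        (\<exists>H \<subseteq> triples {1..n}. is_copy_of H F \<and> rainbow \<chi> H))"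
  show "N + 1 \<le> m"
  proof (rule ccontr)
    assume "\<not> N + 1 \<le> m"
    then have "m \<le> N" by simp
    then show False using F[of m] m by blast
  qed
qed

text \<open>Without such a pair of edges every class contains at most one monochromatic edge of the
  blowup, so \<open>rigid_blowup_colouring\<close> makes \<open>q\<close> constant on each part;
  then the two extra edges are such a pair. Their class colours agree either because they lie in the
  same part or because \<open>g\<close> is constant.\<close>

lemma two_monochromatic_edges_in_part:
  assumes tl: "l < t" and F: "blowup_K l t \<subseteq> F" and q: "\<And>x. x \<in> \<Union>F \<Longrightarrow> q x \<in> {1..l}"
    and l2: "l \<ge> 2"
    and E: "{(1, a), (1, b)} \<in> F" "{(j, c), (j, d)} \<in> F" "{(1, a), (1, b)} \<noteq> {(j, c), (j, d)}" "a \<noteq> b" "c \<noteq> d"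
      "{a, b, c, d} \<subseteq> {1..t}" "j \<in> {1..l}"
    and g: "j = 1 \<or> (\<forall>i\<in>{1..l}. \<forall>i'\<in>{1..l}. g i = g i')"
  shows "\<exists>u v x y. {u, v} \<in> F \<and> {x, y} \<in> F \<and> {u, v} \<noteq> {x, y} \<and> u \<noteq> v \<and> x \<noteq> y \<and>
        q u = q v \<and> q x = q y \<and> g (q u) = g (q x)"
proof (rule ccontr)
  assume "\<not> ?thesis"
  then have neg: "\<not> ({u, v} \<in> F \<and> {x, y} \<in> F \<and> {u, v} \<noteq> {x, y} \<and> u \<noteq> v \<and> x \<noteq> y \<and>
        q u = q v \<and> q x = q y \<and> g (q u) = g (q x))" for u v x y by blast
  have ver: "(i, a) \<in> \<Union>F" if ia: "i \<in> {1..l}" "a \<in> {1..t}" for i a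
  proof -
    have "\<exists>k\<in>{1..l}. k \<noteq> i"
      using l2 by (intro bexI[of _ "if i = 1 then 2 else 1"]) auto
    then obtain k where "k \<in> {1..l}" "k \<noteq> i" by blast
    then show ?thesis using blowup_KI[of i l k a t a] ia F by blast
  qed
  have con: "q (i, a) = q (i, b)" if "i \<in> {1..l}" "a \<in> {1..t}" "b \<in> {1..t}" for i a b
  proof (rule rigid_blowup_colouring[OF tl _ _ that])
    show "q (i, a) \<in> {1..l}" if "i \<in> {1..l}" "a \<in> {1..t}" for i a using q ver[OF that] by blast
    fix u v x y assume a: "{u, v} \<in> blowup_K l t" "{x, y} \<in> blowup_K l t" "q u = q v" "q x = q y" "q u = q x"
    have "u \<noteq> v" "x \<noteq> y" using a(1,2) by (auto simp: blowup_K_def doubleton_eq_iff)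
    moreover have "{u, v} \<in> F" "{x, y} \<in> F" using a F by auto
    ultimately show "{u, v} = {x, y}" using neg[of u v x y] a(3-5) by auto
  qed
  have one: "1 \<in> {1..l}" using l2 by simp
  have "q (1, a) = q (1, b)" "q (j, c) = q (j, d)" using con E one by auto
  moreover have "g (q (1, a)) = g (q (j, c))"
    using g
  proof
    assume "j = 1"
    then show ?thesis using con[OF one, of a c] E by simp
  next
    assume "\<forall>i\<in>{1..l}. \<forall>i'\<in>{1..l}. g i = g i'"
    moreover have "q (1, a) \<in> {1..l}" "q (j, c) \<in> {1..l}" using q[OF ver] E one by auto
    ultimately show ?thesis by blast
  qed
  ultimately show False using neg[of "(1, a)" "(1, b)" "(j, c)" "(j, d)"] E(1-5) by simp
qed

section \<open>Greedy rainbow expansion\<close>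

lemma triples_mono: "S \<subseteq> T \<Longrightarrow> triples S \<subseteq> triples T"
  by (auto simp: triples_def)

text \<open>Every new edge has more colours available than are blocked by the vertices and the colours
  already in use.\<close>

lemma rainbow_expansion:
  fixes F :: "'v set set" and \<chi> :: "'w set \<Rightarrow> nat"
  assumes F: "finite F" "\<And>e. e \<in> F \<Longrightarrow> card e = 2" and S: "finite S"
    and phi: "inj_on \<phi> (\<Union>F)" "\<phi> ` (\<Union>F) \<subseteq> S" and X: "X \<subseteq> F"
    and rich: "\<And>e. e \<in> F - X \<Longrightarrow> card (\<chi> ` {f \<in> triples S. \<phi> ` e \<subseteq> f}) > card (\<Union>F) + 2 * card F"
    and w: "inj_on w X" "w ` X \<subseteq> S - \<phi> ` (\<Union>F)" "inj_on (\<lambda>e. \<chi> (insert (w e) (\<phi> ` e))) X"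
  shows "\<exists>H \<subseteq> triples S. is_copy_of H (expansion F) \<and> rainbow \<chi> H"
proof -
  have fe: "finite e" if "e \<in> F" for e using F(2)[OF that] by (intro card_ge_0_finite) simp
  have fU: "finite (\<Union>F)" using F(1) fe by blast
  \<comment> \<open>The edges in \<open>X\<close> keep the prescribed new vertices \<open>w\<close>
    and need not be rich; the others join one at a time.\<close>
  have ext: "\<exists>w. inj_on w (X \<union> Z) \<and> w ` (X \<union> Z) \<subseteq> S - \<phi> ` (\<Union>F) \<and>
      inj_on (\<lambda>e. \<chi> (insert (w e) (\<phi> ` e))) (X \<union> Z)" if "finite Z" "Z \<subseteq> F - X" for Z
    using that
  proof (induction Z rule: finite_induct)
    case empty
    then show ?case using w by auto
  next
    case (insert e Z)
    then obtain w where w: "inj_on w (X \<union> Z)" "w ` (X \<union> Z) \<subseteq> S - \<phi> ` (\<Union>F)"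
      "inj_on (\<lambda>e. \<chi> (insert (w e) (\<phi> ` e))) (X \<union> Z)" by auto
    define Y where "Y = X \<union> Z"
    have YF: "Y \<subseteq> F" using X insert.prems by (auto simp: Y_def)
    have eF: "e \<in> F - X" and eY: "e \<notin> Y" using insert by (auto simp: Y_def)
    have fY: "finite Y" and cY: "card Y \<le> card F" using YF F(1) finite_subset card_mono by (blast, blast)
    \<comment> \<open>Colours lost because the new vertex would be a core vertex or an earlier new
      vertex: at most \<open>card (\<Union>F) + card F\<close>. The colours \<open>B2\<close>
      already in use add at most \<open>card F\<close>.\<close>
    define B1 where "B1 = (\<lambda>z. \<chi> (insert z (\<phi> ` e))) ` (\<phi> ` (\<Union>F) \<union> w ` Y)"
    define B2 where "B2 = (\<lambda>e. \<chi> (insert (w e) (\<phi> ` e))) ` Y"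
    have "card B1 \<le> card (\<phi> ` (\<Union>F) \<union> w ` Y)" unfolding B1_def using fU fY by (intro card_image_le) auto
    also have "\<dots> \<le> card (\<phi> ` (\<Union>F)) + card (w ` Y)" by (rule card_Un_le)
    also have "\<dots> \<le> card (\<Union>F) + card Y" using fU fY by (intro add_mono card_image_le) auto
    finally have B1: "card B1 \<le> card (\<Union>F) + card Y" .
    have B2: "card B2 \<le> card Y" unfolding B2_def using fY by (rule card_image_le)
    have "card (B1 \<union> B2) \<le> card (\<Union>F) + 2 * card F"
      using card_Un_le[of B1 B2] B1 B2 cY by linarith
    then have "card (B1 \<union> B2) < card (\<chi> ` {f \<in> triples S. \<phi> ` e \<subseteq> f})" using rich[OF eF] by linarith
    moreover have "finite (B1 \<union> B2)" using fU fY by (simp add: B1_def B2_def)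
    ultimately have "\<not> \<chi> ` {f \<in> triples S. \<phi> ` e \<subseteq> f} \<subseteq> B1 \<union> B2"
      using card_mono by (metis not_le)
    then obtain f where f: "f \<in> triples S" "\<phi> ` e \<subseteq> f" "\<chi> f \<notin> B1" "\<chi> f \<notin> B2" by blast
    have ff: "finite f" using f(1) by (auto simp: triples_def intro: card_ge_0_finite)
    have c2: "card (\<phi> ` e) = 2"
      using F(2) eF phi(1) by (subst card_image) (auto intro: inj_on_subset)
    have "card (f - \<phi> ` e) = 1"
      using f(1,2) c2 ff finite_subset[OF f(2) ff] by (simp add: card_Diff_subset triples_def)
    then obtain z where z: "f - \<phi> ` e = {z}" by (auto simp: card_1_singleton_iff)
    have feq: "f = insert z (\<phi> ` e)" using z f(2) by blast
    have zS: "z \<in> S" using z f(1) by (auto simp: triples_def)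
    have znot: "z \<notin> \<phi> ` (\<Union>F) \<union> w ` Y" using f(3) unfolding feq B1_def by blast
    define w' where "w' = w(e := z)"
    have w'Y: "w' y = w y" if "y \<in> Y" for y using that eY by (auto simp: w'_def)
    have w'e: "w' e = z" by (simp add: w'_def)
    have i1: "inj_on w' (insert e Y)"
    proof -
      have "inj_on w' Y" using w(1) w'Y by (auto simp: inj_on_def Y_def)
      moreover have "w' e \<notin> w' ` Y" using znot w'Y w'e by auto
      ultimately show ?thesis using eY by auto
    qed
    have i2: "w' ` (insert e Y) \<subseteq> S - \<phi> ` (\<Union>F)"
    proof -
      have "w' ` Y = w ` Y" using w'Y by (intro image_cong) auto
      then show ?thesis using w(2) zS znot w'e by (simp add: Y_def)
    qed
    have i3: "inj_on (\<lambda>e. \<chi> (insert (w' e) (\<phi> ` e))) (insert e Y)"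
    proof -
      have im: "(\<lambda>e. \<chi> (insert (w' e) (\<phi> ` e))) ` Y = B2" unfolding B2_def using w'Y by (intro image_cong) auto
      have "inj_on (\<lambda>e. \<chi> (insert (w' e) (\<phi> ` e))) Y"
        using w(3) w'Y by (simp add: Y_def inj_on_def)
      moreover have "\<chi> (insert (w' e) (\<phi> ` e)) \<notin> (\<lambda>e. \<chi> (insert (w' e) (\<phi> ` e))) ` Y"
        unfolding im w'e using f(4) feq by simp
      ultimately show ?thesis using eY by auto
    qed
    have XZ: "X \<union> insert e Z = insert e Y" by (auto simp: Y_def)
    show ?case unfolding XZ using i1 i2 i3 by blast
  qed
  have "X \<union> (F - X) = F" using X by auto
  then obtain w where w: "inj_on w F" "w ` F \<subseteq> S - \<phi> ` (\<Union>F)" "inj_on (\<lambda>e. \<chi> (insert (w e) (\<phi> ` e))) F"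
    using ext[of "F - X"] F(1) by auto
  define \<Phi> where "\<Phi> = case_sum \<phi> w"
  define H where "H = (\<lambda>e. \<Phi> ` e) ` expansion F"
  have Phi: "\<Phi> ` (insert (Inr e) (Inl ` e)) = insert (w e) (\<phi> ` e)" for e
    by (simp add: \<Phi>_def image_image)
  have Heq: "H = (\<lambda>e. insert (w e) (\<phi> ` e)) ` F"
    unfolding H_def expansion_def image_image Phi ..
  have Un: "\<Union>(expansion F) = Inl ` (\<Union>F) \<union> Inr ` F" by (auto simp: expansion_def)
  have "inj_on \<Phi> (\<Union>(expansion F))"
    unfolding Un
  proof (rule inj_onI)
    fix x y assume "x \<in> Inl ` \<Union> F \<union> Inr ` F" "y \<in> Inl ` \<Union> F \<union> Inr ` F" "\<Phi> x = \<Phi> y"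
    moreover have "w e \<noteq> \<phi> u" "\<phi> u \<noteq> w e" if "e \<in> F" "u \<in> \<Union>F" for e u using w(2) that by (metis DiffD2 image_eqI subsetD)+
    ultimately show "x = y"
      by (elim UnE imageE) (use phi(1) w(1) in \<open>simp_all add: \<Phi>_def inj_on_eq_iff del: Union_iff\<close>)
  qed
  then have "is_copy_of H (expansion F)" unfolding is_copy_of_def H_def by blast
  moreover have "rainbow \<chi> H"
    unfolding rainbow_def Heq using w(3) by (intro inj_on_imageI) (simp add: comp_def)
  moreover have "H \<subseteq> triples S"
  proof
    fix h assume "h \<in> H"
    then obtain e where e: "e \<in> F" "h = insert (w e) (\<phi> ` e)" using Heq by blast
    have "card (\<phi> ` e) = 2" using F(2)[OF e(1)] phi(1) e by (subst card_image) (auto intro: inj_on_subset)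
    moreover have we: "w e \<in> S - \<phi> ` (\<Union>F)" using w(2) e(1) by blast
    then have "w e \<notin> \<phi> ` e" using e(1) by blast
    ultimately have "card h = 3" using e fe[OF e(1)] by simp
    moreover have "\<phi> ` e \<subseteq> S" using phi(2) e(1) by blast
    ultimately show "h \<in> triples S" using we e(2) by (simp add: triples_def)
  qed
  ultimately show ?thesis by blast
qed

text \<open>If every step lost too few colours, the surplus over \<open>\<tau>\<close> would grow beyond the number of triples
  on \<open>n1\<close> vertices.\<close>

lemma colour_dense_subset:
  fixes \<chi> :: "'a set \<Rightarrow> nat" and \<tau> :: "nat \<Rightarrow> nat"
  assumes S0: "finite S0" "card S0 \<ge> n1 + n1 ^ 3 + 1" and c: "card (\<chi> ` triples S0) \<ge> \<tau> (card S0) + K"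
  shows "\<exists>S \<subseteq> S0. card S \<ge> n1 \<and> card (\<chi> ` triples S) \<ge> \<tau> (card S) + K \<and>
    (\<forall>v\<in>S. card (\<chi> ` triples S) + \<tau> (card S - 1) \<ge> card (\<chi> ` triples (S - {v})) + \<tau> (card S))"
proof (rule ccontr)
  assume neg: "\<not> ?thesis"
  define n where "n = card S0"
  \<comment> \<open>After \<open>n - n1 \<ge> n1 ^ 3 + 1\<close> deletions the surplus, growing by
    at least one each time, exceeds \<open>n1 ^ 3\<close>.\<close>
  have "\<exists>S \<subseteq> S0. card S = n - j \<and> card (\<chi> ` triples S) \<ge> \<tau> (card S) + K + j" if "j \<le> n - n1" for j
    using that
  proof (induction j)
    case 0
    then show ?case using c by (intro exI[of _ S0]) (simp add: n_def)
  next
    case (Suc j)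
    then obtain S where S: "S \<subseteq> S0" "card S = n - j" "card (\<chi> ` triples S) \<ge> \<tau> (card S) + K + j" by auto
    have "card S \<ge> n1" using S(2) Suc.prems by simp
    moreover have "card (\<chi> ` triples S) \<ge> \<tau> (card S) + K" using S(3) by simp
    ultimately obtain v where v: "v \<in> S" "card (\<chi> ` triples S) + \<tau> (card S - 1) < card (\<chi> ` triples (S - {v})) + \<tau> (card S)"
      using neg S(1) by (meson not_le)
    have "card (S - {v}) = card S - 1" using v(1) by simp
    moreover from this have "card (S - {v}) = n - Suc j" using S(2) by simp
    moreover have "card (\<chi> ` triples (S - {v})) \<ge> \<tau> (card S - 1) + K + Suc j" using v(2) S(3) by linarith
    ultimately show ?case using S(1) by (intro exI[of _ "S - {v}"]) auto
  qed
  from this[of "n - n1"] obtain S where S: "S \<subseteq> S0" "card S = n - (n - n1)"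
    "card (\<chi> ` triples S) \<ge> \<tau> (card S) + K + (n - n1)" by auto
  have fS: "finite S" using S(1) S0(1) finite_subset by blast
  have "card S = n1" using S(2) S0(2) by (simp add: n_def)
  moreover have "card (\<chi> ` triples S) \<le> card (triples S)" using finite_triples[OF fS] by (rule card_image_le)
  moreover have "card (triples S) \<le> card S ^ 3" by (rule card_triples_le[OF fS])
  ultimately show False using S(3) S0(2) by (simp add: n_def)
qed

lemma listset_eq_nth: "listset As = {xs. length xs = length As \<and> (\<forall>i<length As. xs ! i \<in> As ! i)}"
proof (induction As)
  case (Cons A As)
  have "x # ys \<in> listset (A # As) \<longleftrightarrow> x \<in> A \<and> ys \<in> listset As" for x ys by (simp add: set_Cons_def)
  moreover have "[] \<notin> listset (A # As)" by (simp add: set_Cons_def)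
  moreover have "(\<forall>i<Suc k. P i) \<longleftrightarrow> P 0 \<and> (\<forall>i<k. P (Suc i))" for P k by (metis less_Suc_eq_0_disj)
  ultimately have "xs \<in> listset (A # As) \<longleftrightarrow> length xs = length (A # As) \<and> (\<forall>i<length (A # As). xs ! i \<in> (A # As) ! i)" for xs
    using Cons.IH by (cases xs) auto
  then show ?case by blast
qed auto

text \<open>The extra edges of the fixed graphs lie in parts 1 and 2; the permutation transports
  them to any two parts of a host.\<close>

lemma permutation_of_two_indices:
  fixes i k l :: nat
  assumes "i \<in> {1..l}" "k \<in> {1..l}" "i \<noteq> k"
  obtains \<sigma> where "bij_betw \<sigma> {1..l} {1..l}" "\<sigma> 1 = i" "\<sigma> 2 = k"
proof -
  have "l \<ge> 2" using assms by auto
  \<comment> \<open>The preimage of \<open>k\<close> under the transposition of 1 and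
    \<open>i\<close>; it differs from 1 because \<open>i \<noteq> k\<close>.\<close>
  define k' where "k' = transpose 1 i k"
  have k': "k' \<in> {1..l}" "k' \<noteq> 1" using assms by (auto simp: k'_def transpose_def)
  have b: "bij_betw (transpose a b) {1..l} {1..l}" if "a \<in> {1..l}" "b \<in> {1..l}" for a b
    using permutes_imp_bij[OF permutes_swap_id[OF that]] by simp
  show thesis
  proof (rule that[of "transpose 1 i \<circ> transpose 2 k'"])
    show "bij_betw (transpose 1 i \<circ> transpose 2 k') {1..l} {1..l}"
      by (rule bij_betw_trans[OF b b]) (use k' assms \<open>l \<ge> 2\<close> in auto)
    show "(transpose 1 i \<circ> transpose 2 k') 1 = i" using k' by (simp add: transpose_def)
    show "(transpose 1 i \<circ> transpose 2 k') 2 = k" by (simp add: k'_def)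
  qed
qed

section \<open>Colour-rich pairs\<close>

text \<open>The three graphs share one extra edge in part 1, so a single parameter \<open>E\<close>
  for the other one treats them together.\<close>

definition pattern :: "nat \<Rightarrow> nat \<Rightarrow> (nat \<times> nat) set \<Rightarrow> (nat \<times> nat) set set" where
  "pattern l t E = blowup_K l t \<union> {{(1, 1), (1, 2)}, E}"

text \<open>The number of colours that a greedy expansion can block, as in the hypothesis of
  \<open>rainbow_expansion\<close>.\<close>

definition richness :: "nat \<Rightarrow> nat \<Rightarrow> (nat \<times> nat) set \<Rightarrow> nat" where
  "richness l t E = card (\<Union>(pattern l t E)) + 2 * card (pattern l t E)"

locale coloured_triples =
  fixes l t :: nat and E :: "(nat \<times> nat) set" and \<chi> :: "nat set \<Rightarrow> nat" and S :: "nat set"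
  assumes l: "3 \<le> l" and tl: "l < t" and S: "finite S" and large: "card S > l * t"
    and E: "E \<in> {{(1, 2), (1, 3)}, {(1, 3), (1, 4)}, {(2, 1), (2, 2)}}"
    and no_rainbow: "\<not> (\<exists>H \<subseteq> triples S. is_copy_of H (expansion (pattern l t E)) \<and> rainbow \<chi> H)"
begin

definition grid :: "(nat \<times> nat) set" where "grid = {1..l} \<times> {1..t}"

definition adj :: "nat \<Rightarrow> nat \<Rightarrow> bool" where
  "adj u v \<longleftrightarrow> u \<in> S \<and> v \<in> S \<and> u \<noteq> v \<and> card (\<chi> ` {f \<in> triples S. u \<in> f \<and> v \<in> f}) > richness l t E"

text \<open>Stated for subsets of the grid because embeddings grow from a few prescribed
  vertices.\<close>

definition cross_adj :: "(nat \<times> nat \<Rightarrow> nat) \<Rightarrow> (nat \<times> nat) set \<Rightarrow> bool" where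
  "cross_adj \<phi> P \<longleftrightarrow> (\<forall>x\<in>P. \<forall>y\<in>P. fst x \<noteq> fst y \<longrightarrow> adj (\<phi> x) (\<phi> y))"

lemma finite_grid: "finite grid" and card_grid: "card grid = l * t"
  by (auto simp: grid_def)

lemma special_edges: "{(1, 1), (1, 2)} \<subseteq> grid" "E \<subseteq> grid" "card E = 2" "{(1, 1), (1, 2)} \<noteq> E"
  "card ({(1, 1), (1, 2)} \<union> E) \<le> 4"
proof -
  have t: "t \<ge> 4" using l tl by simp
  show "{(1, 1), (1, 2)} \<subseteq> grid" "E \<subseteq> grid" using E l t by (auto simp: grid_def)
  show E2: "card E = 2" using E by auto
  have "(1, 1) \<notin> E" using E by auto
  then show "{(1, 1), (1, 2)} \<noteq> E" by blast
  show "card ({(1, 1), (1, 2)} \<union> E) \<le> 4"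
    using card_Un_le[of "{(1, 1), (1, 2)}" E] E2 by simp
qed

lemma blowup_edge:
  assumes "e \<in> blowup_K l t"
  obtains x y where "e = {x, y}" "x \<in> grid" "y \<in> grid" "fst x \<noteq> fst y"
  using assms unfolding blowup_K_def grid_def by force

lemma pattern_edges: "finite (pattern l t E)" "\<And>e. e \<in> pattern l t E \<Longrightarrow> card e = 2" "\<Union>(pattern l t E) = grid"
proof -
  have sub: "e \<subseteq> grid \<and> card e = 2" if "e \<in> pattern l t E" for e
  proof (cases "e \<in> blowup_K l t")
    case True
    then obtain x y where "e = {x, y}" "x \<in> grid" "y \<in> grid" "fst x \<noteq> fst y" by (rule blowup_edge)
    then show ?thesis by (auto simp: card_insert_if)
  next
    case False
    then show ?thesis using that special_edges by (auto simp: pattern_def)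
  qed
  then show "\<And>e. e \<in> pattern l t E \<Longrightarrow> card e = 2" by blast
  have "pattern l t E \<subseteq> Pow grid" using sub by blast
  then show "finite (pattern l t E)" using finite_grid finite_subset by blast
  have "z \<in> \<Union>(pattern l t E)" if zg: "z \<in> grid" for z
  proof -
    obtain i a where z: "z = (i, a)" "i \<in> {1..l}" "a \<in> {1..t}" using zg by (cases z) (auto simp: grid_def)
    have "\<exists>k\<in>{1..l}. k \<noteq> i" using l by (intro bexI[of _ "if i = 1 then 2 else 1"]) auto
    then obtain k where "k \<in> {1..l}" "k \<noteq> i" by blast
    then have "{(i, a), (k, a)} \<in> pattern l t E" using blowup_KI[of i l k a t a] z by (simp add: pattern_def)
    then show ?thesis using z(1) by blast
  qed
  then show "\<Union>(pattern l t E) = grid" using sub by blast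
qed

lemma adj_sym: "adj u v \<Longrightarrow> adj v u"
  by (simp add: adj_def conj_commute)

sublocale finite_graph S adj
  by unfold_locales (use S adj_sym in \<open>auto simp: adj_def\<close>)

lemma rich_edge:
  assumes "adj (\<phi> x) (\<phi> y)"
  shows "card (\<chi> ` {f \<in> triples S. \<phi> ` {x, y} \<subseteq> f}) > card (\<Union>(pattern l t E)) + 2 * card (pattern l t E)"
proof -
  have "{f \<in> triples S. \<phi> ` {x, y} \<subseteq> f} = {f \<in> triples S. \<phi> x \<in> f \<and> \<phi> y \<in> f}" by auto
  then show ?thesis using assms by (simp add: adj_def richness_def)
qed

lemma rich_blowup_edge:
  assumes "cross_adj \<phi> grid" "e \<in> blowup_K l t"
  shows "card (\<chi> ` {f \<in> triples S. \<phi> ` e \<subseteq> f}) > card (\<Union>(pattern l t E)) + 2 * card (pattern l t E)"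
proof -
  obtain x y where "e = {x, y}" "x \<in> grid" "y \<in> grid" "fst x \<noteq> fst y" by (rule blowup_edge[OF assms(2)])
  note xy = this
  have "adj (\<phi> x) (\<phi> y)" using assms(1) xy(2-4) unfolding cross_adj_def by blast
  then show ?thesis unfolding xy(1) by (rule rich_edge)
qed

lemma pattern_members: "E \<in> pattern l t E" "{(1, 1), (1, 2)} \<in> pattern l t E"
  by (simp_all add: pattern_def)

text \<open>Only \<open>E\<close> may fail to be rich. It is expanded beforehand by any vertex
  outside the image, which \<open>large\<close> provides; a single prescribed triple has no colour
  conflict, and the greedy steps avoid its colour.\<close>

lemma no_blowup_plus_edge:
  assumes phi: "inj_on \<phi> grid" "\<phi> ` grid \<subseteq> S" "cross_adj \<phi> grid" and one: "adj (\<phi> (1, 1)) (\<phi> (1, 2))"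
  shows False
proof -
  have "card (\<phi> ` grid) < card S" using large card_grid phi(1) by (simp add: card_image)
  then have "\<not> S \<subseteq> \<phi> ` grid" using finite_grid card_mono[of "\<phi> ` grid" S] by auto
  then obtain w where w: "w \<in> S - \<phi> ` grid" by blast
  have "\<exists>H \<subseteq> triples S. is_copy_of H (expansion (pattern l t E)) \<and> rainbow \<chi> H"
  proof (rule rainbow_expansion[OF pattern_edges(1,2) S, where X = "{E}" and w = "\<lambda>_. w" and \<phi> = \<phi>])
    fix e assume "e \<in> pattern l t E - {E}"
    then have "e \<in> blowup_K l t \<or> e = {(1, 1), (1, 2)}" by (auto simp: pattern_def)
    then show "card (\<chi> ` {f \<in> triples S. \<phi> ` e \<subseteq> f}) > card (\<Union>(pattern l t E)) + 2 * card (pattern l t E)"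
    proof
      assume "e \<in> blowup_K l t"
      then show ?thesis by (rule rich_blowup_edge[OF phi(3)])
    next
      assume e: "e = {(1, 1), (1, 2)}"
      show ?thesis unfolding e by (rule rich_edge[where \<phi> = \<phi>, OF one])
    qed
  qed (use phi w pattern_members in \<open>simp_all only: pattern_edges(3)\<close>, simp_all)
  then show False using no_rainbow by blast
qed

text \<open>If the colours differed, both extra edges could be prescribed with the new vertices
  \<open>w1\<close> and \<open>w2\<close>, and the remaining edges, all rich, would expand greedily
  to a rainbow copy.\<close>

lemma special_edges_same_colour:
  assumes phi: "inj_on \<phi> grid" "\<phi> ` grid \<subseteq> S" "cross_adj \<phi> grid"
    and w: "w1 \<in> S - \<phi> ` grid" "w2 \<in> S - \<phi> ` grid" "w1 \<noteq> w2"
  shows "\<chi> (insert w1 (\<phi> ` {(1, 1), (1, 2)})) = \<chi> (insert w2 (\<phi> ` E))"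
proof (rule ccontr)
  assume ne: "\<chi> (insert w1 (\<phi> ` {(1, 1), (1, 2)})) \<noteq> \<chi> (insert w2 (\<phi> ` E))"
  define w where "w e = (if e = E then w2 else w1)" for e
  have ww: "w E = w2" "w {(1, 1), (1, 2)} = w1" using special_edges(4) by (auto simp: w_def)
  have "\<exists>H \<subseteq> triples S. is_copy_of H (expansion (pattern l t E)) \<and> rainbow \<chi> H"
  proof (rule rainbow_expansion[OF pattern_edges(1,2) S, where X = "{{(1, 1), (1, 2)}, E}" and w = w and \<phi> = \<phi>])
    fix e assume "e \<in> pattern l t E - {{(1, 1), (1, 2)}, E}"
    then have "e \<in> blowup_K l t" by (auto simp: pattern_def)
    then show "card (\<chi> ` {f \<in> triples S. \<phi> ` e \<subseteq> f}) > card (\<Union>(pattern l t E)) + 2 * card (pattern l t E)"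
      by (rule rich_blowup_edge[OF phi(3)])
  next
    show "inj_on w {{(1, 1), (1, 2)}, E}" using ww w(3) by (simp add: inj_on_def)
    show "w ` {{(1, 1), (1, 2)}, E} \<subseteq> S - \<phi> ` \<Union> (pattern l t E)"
      unfolding pattern_edges(3) using ww w(1,2) by simp
    show "inj_on (\<lambda>e. \<chi> (insert (w e) (\<phi> ` e))) {{(1, 1), (1, 2)}, E}"
      using ww ne by (simp add: inj_on_def)
  qed (use phi pattern_members in \<open>simp_all only: pattern_edges(3)\<close>, simp_all)
  then show False using no_rainbow by blast
qed

text \<open>Vertices of part \<open>j\<close> are chosen from \<open>N j\<close>. At each step at
  most \<open>l * t\<close> greedily placed vertices spoil at most \<open>m\<close> candidates each,
  at most \<open>l * t\<close> values are taken, and \<open>Q\<close> is forbidden. Adjacency to the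
  prescribed vertices is built into \<open>N\<close>.\<close>

lemma greedy_extension:
  fixes m :: real
  assumes NW: "\<And>j. N j \<subseteq> W j" and WS: "\<And>j. W j \<subseteq> S" and m: "m \<ge> 0"
    and miss: "\<And>i j v. i \<in> {1..l} \<Longrightarrow> j \<in> {1..l} \<Longrightarrow> i \<noteq> j \<Longrightarrow> v \<in> W i \<Longrightarrow> real (card {u\<in>W j. \<not> adj v u}) \<le> m"
    and P0: "P0 \<subseteq> grid" "\<psi> ` P0 \<subseteq> S" "inj_on \<psi> P0" "cross_adj \<psi> P0"
    and N: "\<And>j x z. j \<in> {1..l} \<Longrightarrow> x \<in> N j \<Longrightarrow> z \<in> P0 \<Longrightarrow> fst z \<noteq> j \<Longrightarrow> adj (\<psi> z) x"
    and Q: "finite Q" and size: "\<And>j. j \<in> {1..l} \<Longrightarrow> real (card (N j)) > l * t * m + l * t + card Q"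
  shows "\<exists>\<phi>. inj_on \<phi> grid \<and> \<phi> ` grid \<subseteq> S \<and> cross_adj \<phi> grid \<and> (\<forall>z\<in>P0. \<phi> z = \<psi> z) \<and>
    (\<forall>z\<in>grid - P0. \<phi> z \<in> N (fst z) - Q)"
proof -
  have ext: "\<exists>\<phi>. inj_on \<phi> (P0 \<union> Z) \<and> cross_adj \<phi> (P0 \<union> Z) \<and> (\<forall>z\<in>P0. \<phi> z = \<psi> z) \<and>
    (\<forall>z\<in>Z. \<phi> z \<in> N (fst z) - Q)" if "finite Z" "Z \<subseteq> grid - P0" for Z
    using that
  proof (induction Z rule: finite_induct)
    case empty
    then show ?case using P0 by (intro exI[of _ \<psi>]) auto
  next
    case (insert z Z)
    then obtain \<phi> where phi: "inj_on \<phi> (P0 \<union> Z)" "cross_adj \<phi> (P0 \<union> Z)" "\<forall>z\<in>P0. \<phi> z = \<psi> z"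
      "\<forall>z\<in>Z. \<phi> z \<in> N (fst z) - Q" by auto
    define j where "j = fst z"
    define Y where "Y = P0 \<union> Z"
    have zg: "z \<in> grid" "z \<notin> Y" using insert by (auto simp: Y_def)
    have j: "j \<in> {1..l}" using zg by (auto simp: j_def grid_def)
    have Yg: "Y \<subseteq> grid" using P0(1) insert.prems by (auto simp: Y_def)
    have fY: "finite Y" using Yg finite_grid finite_subset by blast
    have cY: "card Y \<le> l * t" using card_mono[OF finite_grid Yg] card_grid by simp
    have fZ: "finite Z" and cZ: "card Z \<le> l * t"
      using insert.hyps cY card_mono[OF fY, of Z] by (auto simp: Y_def)
    have fN: "finite (N j)" using NW WS S by (meson finite_subset)
    define M where "M y = (if fst y = j then {} else {x\<in>W j. \<not> adj (\<phi> y) x})" for y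
    have cM: "real (card (M y)) \<le> m" if "y \<in> Z" for y
    proof (cases "fst y = j")
      case False
      have "fst y \<in> {1..l}" using that Yg by (auto simp: Y_def grid_def)
      moreover have "\<phi> y \<in> W (fst y)" using phi(4) that NW by blast
      ultimately show ?thesis using miss[of "fst y" j "\<phi> y"] False j by (simp add: M_def)
    qed (use m in \<open>simp add: M_def\<close>)
    have fM: "finite (\<Union>y\<in>Z. M y)"
      using fZ WS S finite_subset[OF WS S] by (auto simp: M_def)
    have "real (card (\<Union>y\<in>Z. M y)) \<le> (\<Sum>y\<in>Z. real (card (M y)))"
      using card_UN_le[OF fZ, of M] by (simp flip: of_nat_sum)
    also have "\<dots> \<le> (\<Sum>y\<in>Z. m)" by (intro sum_mono cM)
    also have "\<dots> = real (card Z) * m" by simp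
    also have "\<dots> \<le> real (l * t) * m" using cZ m by (intro mult_right_mono) (simp_all only: of_nat_le_iff)
    finally have M: "real (card (\<Union>y\<in>Z. M y)) \<le> l * t * m" by simp
    define B where "B = Q \<union> \<phi> ` Y \<union> (\<Union>y\<in>Z. M y)"
    have fB: "finite B" using Q fY fM by (simp add: B_def)
    have "card B \<le> card Q + card (\<phi> ` Y) + card (\<Union>y\<in>Z. M y)"
      unfolding B_def using card_Un_le[of "Q \<union> \<phi> ` Y" "\<Union>y\<in>Z. M y"] card_Un_le[of Q "\<phi> ` Y"] by linarith
    moreover have "card (\<phi> ` Y) \<le> l * t" using card_image_le[OF fY, of \<phi>] cY by linarith
    ultimately have "card B \<le> card Q + l * t + card (\<Union>y\<in>Z. M y)" by linarith
    then have "real (card B) \<le> real (card Q + l * t + card (\<Union>y\<in>Z. M y))" by (simp only: of_nat_le_iff)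
    then have "real (card B) < real (card (N j))" using M size[OF j] by simp
    then have "\<not> N j \<subseteq> B" using card_mono[OF fB, of "N j"] by auto
    then obtain x where x: "x \<in> N j" "x \<notin> B" by blast
    have xadj: "adj (\<phi> y) x" if y: "y \<in> Y" "fst y \<noteq> j" for y
    proof (cases "y \<in> P0")
      case True
      then show ?thesis using N[OF j x(1) True y(2)] phi(3) by simp
    next
      case False
      then have "y \<in> Z" using y(1) by (simp add: Y_def)
      then have "x \<notin> M y" using x(2) by (auto simp: B_def)
      then show ?thesis using y(2) x(1) NW by (auto simp: M_def)
    qed
    define \<phi>' where "\<phi>' = \<phi>(z := x)"
    have p'Y: "\<phi>' y = \<phi> y" if "y \<in> Y" for y using that zg(2) by (auto simp: \<phi>'_def)
    have p'z: "\<phi>' z = x" by (simp add: \<phi>'_def)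
    have "inj_on \<phi>' (insert z Y)"
    proof -
      have "inj_on \<phi>' Y" using phi(1) p'Y by (simp add: Y_def inj_on_def)
      moreover have "\<phi>' z \<notin> \<phi>' ` Y"
      proof
        assume "\<phi>' z \<in> \<phi>' ` Y"
        then have "x \<in> \<phi> ` Y" using p'Y p'z by auto
        then show False using x(2) by (simp add: B_def)
      qed
      ultimately show ?thesis using zg(2) by auto
    qed
    moreover have "cross_adj \<phi>' (insert z Y)"
      unfolding cross_adj_def
    proof (intro ballI impI)
      fix a b assume ab: "a \<in> insert z Y" "b \<in> insert z Y" "fst a \<noteq> fst b"
      consider "a = z" "b \<in> Y" | "b = z" "a \<in> Y" | "a \<in> Y" "b \<in> Y" using ab by blast
      then show "adj (\<phi>' a) (\<phi>' b)"
      proof cases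
        case 1
        then show ?thesis using xadj[of b] ab(3) p'Y p'z adj_sym by (simp add: j_def)
      next
        case 2
        then show ?thesis using xadj[of a] ab(3) p'Y p'z by (simp add: j_def)
      next
        case 3
        then show ?thesis using phi(2) ab(3) p'Y by (simp add: cross_adj_def Y_def)
      qed
    qed
    moreover have "\<forall>y\<in>P0. \<phi>' y = \<psi> y" using phi(3) p'Y by (simp add: Y_def)
    moreover have "\<forall>y\<in>insert z Z. \<phi>' y \<in> N (fst y) - Q"
      using phi(4) p'Y p'z x by (simp add: Y_def j_def B_def)
    moreover have "P0 \<union> insert z Z = insert z Y" by (auto simp: Y_def)
    ultimately show ?case by (intro exI[of _ \<phi>']) simp
  qed
  have "P0 \<union> (grid - P0) = grid" using P0(1) by auto
  then obtain \<phi> where phi: "inj_on \<phi> grid" "cross_adj \<phi> grid" "\<forall>z\<in>P0. \<phi> z = \<psi> z"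
      "\<forall>z\<in>grid - P0. \<phi> z \<in> N (fst z) - Q"
    using ext[of "grid - P0"] finite_grid by auto
  have "\<phi> z \<in> S" if "z \<in> grid" for z
  proof (cases "z \<in> P0")
    case True
    then show ?thesis using phi(3) P0(2) by auto
  next
    case False
    then show ?thesis using phi(4) that NW WS by blast
  qed
  then show ?thesis using phi by blast
qed

text \<open>One of the \<open>l + 1\<close> sets is spare: it supplies the image of
  \<open>(1, 1)\<close>, which is therefore adjacent to the other vertices of part 1 as
  well.\<close>

lemma no_complete_blowup:
  assumes As: "length As = Suc l" "\<And>A. A \<in> set As \<Longrightarrow> A \<subseteq> S \<and> card A = t" "listset As \<subseteq> cliques (Suc l)"
  shows False
proof -
  have Anth: "As ! k \<subseteq> S" "card (As ! k) = t" "finite (As ! k)" if "k < Suc l" for k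
    using As(2)[of "As ! k"] As(1) that S finite_subset by auto
  have "\<exists>f. bij_betw f {1..t} (As ! k)" if "k < Suc l" for k
    using ex_bij_betw_nat_finite_1[OF Anth(3)[OF that]] Anth(2)[OF that] by auto
  then obtain f where f: "\<And>k. k < Suc l \<Longrightarrow> bij_betw (f k) {1..t} (As ! k)" by metis
  have fA: "f k a \<in> As ! k" if "k < Suc l" "a \<in> {1..t}" for k a
    using f[OF that(1)] that(2) by (auto simp: bij_betw_def)
  have adjA: "adj (f i a) (f j b)" if ij: "i < Suc l" "j < Suc l" "i \<noteq> j" "a \<in> {1..t}" "b \<in> {1..t}" for i j a b
  proof -
    \<comment> \<open>A list in \<open>listset As\<close> through the two given vertices; its other
      entries are arbitrary, here the vertices numbered 1.\<close>
    define xs where "xs = map (\<lambda>k. if k = i then f i a else if k = j then f j b else f k 1) [0..<Suc l]"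
    have len: "length xs = Suc l" by (simp add: xs_def)
    have nth: "xs ! k = (if k = i then f i a else if k = j then f j b else f k 1)" if "k < Suc l" for k
      using that by (simp add: xs_def del: upt_Suc)
    have one: "1 \<in> {1..t}" using tl by simp
    have "xs ! k \<in> As ! k" if "k < Suc l" for k
      unfolding nth[OF that] using fA[OF that one] fA[OF ij(1,4)] fA[OF ij(2,5)] by simp
    then have "xs \<in> listset As"
      unfolding listset_eq_nth using len As(1) by simp
    then have "xs \<in> cliques (Suc l)" using As(3) by blast
    then have d: "distinct xs" "\<forall>x\<in>set xs. \<forall>y\<in>set xs. x \<noteq> y \<longrightarrow> adj x y" by (auto simp: mem_cliques_iff)
    have "xs ! i \<noteq> xs ! j" using d(1) len ij by (simp add: nth_eq_iff_index_eq)
    moreover have "xs ! i \<in> set xs" "xs ! j \<in> set xs" using len ij by auto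
    ultimately have "adj (xs ! i) (xs ! j)" using d(2) by blast
    then show ?thesis using nth[OF ij(1)] nth[OF ij(2)] ij(3) by simp
  qed
  define c where "c z = (if z = (1, 1) then l else fst z - 1)" for z :: "nat \<times> nat"
  define \<phi> where "\<phi> z = f (c z) (snd z)" for z
  have c: "c z < Suc l" if "z \<in> grid" for z using that l by (auto simp: c_def grid_def)
  have cne: "c x \<noteq> c y" if "x \<in> grid" "y \<in> grid" "fst x \<noteq> fst y" for x y
    using that l by (auto simp: c_def grid_def)
  have sn: "snd z \<in> {1..t}" if "z \<in> grid" for z using that by (auto simp: grid_def)
  have ca: "cross_adj \<phi> grid"
    unfolding cross_adj_def \<phi>_def
  proof (intro ballI impI)
    fix x y assume "x \<in> grid" "y \<in> grid" "fst x \<noteq> fst y"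
    then show "adj (f (c x) (snd x)) (f (c y) (snd y))" by (intro adjA c cne sn)
  qed
  have "inj_on \<phi> grid"
  proof (rule inj_onI)
    fix x y assume xy: "x \<in> grid" "y \<in> grid" "\<phi> x = \<phi> y"
    have "c x = c y"
    proof (rule ccontr)
      assume "c x \<noteq> c y"
      then have "adj (\<phi> x) (\<phi> y)" unfolding \<phi>_def by (intro adjA c sn xy)
      then show False using xy(3) adj_irrefl by simp
    qed
    moreover have "snd x = snd y"
    proof -
      have "f (c x) (snd x) = f (c x) (snd y)" using xy(3) \<open>c x = c y\<close> by (simp add: \<phi>_def)
      then show ?thesis
        by (rule inj_onD[OF bij_betw_imp_inj_on[OF f[OF c[OF xy(1)]]] _ sn[OF xy(1)] sn[OF xy(2)]])
    qed
    moreover have "fst x = fst y" using cne xy \<open>c x = c y\<close> by blast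
    ultimately show "x = y" by (simp add: prod_eq_iff)
  qed
  moreover have "\<phi> ` grid \<subseteq> S"
  proof (intro image_subsetI)
    fix x assume "x \<in> grid"
    then have "f (c x) (snd x) \<in> As ! c x" "As ! c x \<subseteq> S" by (intro fA Anth(1) c sn; assumption)+
    then show "\<phi> x \<in> S" by (auto simp: \<phi>_def)
  qed
  moreover have "adj (\<phi> (1, 1)) (\<phi> (1, 2))"
    unfolding \<phi>_def using l tl by (intro adjA) (auto simp: c_def)
  ultimately show False using no_blowup_plus_edge ca by blast
qed

text \<open>A colour on no triangle of \<open>adj\<close> occurs on a triple through a non-adjacent
  pair; there are at most \<open>card S ^ 2\<close> of these, each with at most
  \<open>richness l t E\<close> colours. The factor 6 counts orderings of a triangle.\<close>

lemma card_colours_le_cliques: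
  "6 * card (\<chi> ` triples S) \<le> card (cliques 3) + 6 * richness l t E * card S ^ 2"
proof -
  define Tri where "Tri = {e \<in> triples S. \<forall>u\<in>e. \<forall>v\<in>e. u \<noteq> v \<longrightarrow> adj u v}"
  define D where "D = {(u, v) \<in> S \<times> S. u \<noteq> v \<and> \<not> adj u v}"
  define g where "g = (\<lambda>(u, v). \<chi> ` {f \<in> triples S. u \<in> f \<and> v \<in> f})"
  have fT: "finite (triples S)" by (rule finite_triples[OF S])
  have fD: "finite D" by (rule finite_subset[of _ "S \<times> S"]) (use S in \<open>auto simp: D_def\<close>)
  have "\<chi> ` triples S \<subseteq> \<chi> ` Tri \<union> (\<Union>x\<in>D. g x)"
  proof
    fix c assume "c \<in> \<chi> ` triples S"
    then obtain e where e: "e \<in> triples S" "c = \<chi> e" by blast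
    show "c \<in> \<chi> ` Tri \<union> (\<Union>x\<in>D. g x)"
    proof (cases "e \<in> Tri")
      case False
      then obtain u v where "u \<in> e" "v \<in> e" "u \<noteq> v" "\<not> adj u v" using e by (auto simp: Tri_def)
      moreover from this have "(u, v) \<in> D" using e by (auto simp: D_def triples_def)
      moreover have "c \<in> g (u, v)" using e calculation by (auto simp: g_def)
      ultimately show ?thesis by blast
    qed (use e in blast)
  qed
  moreover have "finite (\<chi> ` Tri \<union> (\<Union>x\<in>D. g x))" using fT fD by (auto simp: Tri_def g_def)
  ultimately have "card (\<chi> ` triples S) \<le> card (\<chi> ` Tri \<union> (\<Union>x\<in>D. g x))" by (rule card_mono[rotated])
  also have "\<dots> \<le> card (\<chi> ` Tri) + card (\<Union>x\<in>D. g x)" by (rule card_Un_le)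
  also have "card (\<chi> ` Tri) \<le> card Tri" using fT by (intro card_image_le) (simp add: Tri_def)
  also have "card (\<Union>x\<in>D. g x) \<le> (\<Sum>x\<in>D. card (g x))" by (rule card_UN_le[OF fD])
  also have "\<dots> \<le> (\<Sum>x\<in>D. richness l t E)"
    by (intro sum_mono) (auto simp: D_def g_def adj_def)
  also have "\<dots> = card D * richness l t E" by simp
  also have "\<dots> \<le> card S ^ 2 * richness l t E"
  proof -
    have "card D \<le> card (S \<times> S)" using S by (intro card_mono) (auto simp: D_def)
    then show ?thesis by (simp add: card_cartesian_product power2_eq_square)
  qed
  finally have main: "card (\<chi> ` triples S) \<le> card Tri + card S ^ 2 * richness l t E" by simp
  have fTri: "finite Tri" using fT by (simp add: Tri_def)
  have "6 * card Tri = card {xs. distinct xs \<and> set xs \<in> Tri}"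
    by (rule card_distinct_lists_of_triples[OF fTri, symmetric]) (auto simp: Tri_def triples_def)
  also have "\<dots> \<le> card (cliques 3)"
  proof (intro card_mono finite_cliques subsetI)
    fix xs assume "xs \<in> {xs. distinct xs \<and> set xs \<in> Tri}"
    then have "distinct xs" "set xs \<subseteq> S" "card (set xs) = 3" "\<forall>x\<in>set xs. \<forall>y\<in>set xs. x \<noteq> y \<longrightarrow> adj x y"
      by (auto simp: Tri_def triples_def)
    then show "xs \<in> cliques 3" by (simp add: mem_cliques_iff distinct_card)
  qed
  finally show ?thesis using main by (simp add: algebra_simps)
qed

end

section \<open>Colours of triples that meet a part twice\<close>

locale typical_base = coloured_triples +
  fixes W :: "nat \<Rightarrow> nat set" and m m' :: real
  assumes WS: "W i \<subseteq> S" and Wdisj: "disjoint_family_on W {1..l}"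
    and m: "0 \<le> m" "m \<le> m'"
    and miss: "i \<in> {1..l} \<Longrightarrow> j \<in> {1..l} \<Longrightarrow> i \<noteq> j \<Longrightarrow> v \<in> W i \<Longrightarrow> real (card {u\<in>W j. \<not> adj v u}) \<le> m"
    and big: "j \<in> {1..l} \<Longrightarrow> real (card (W j)) > 4 * m' + l * t * m + l * t + 12"
begin

text \<open>With \<open>m'\<close> in place of \<open>m\<close> this is weaker than what holds in
  \<open>W i\<close>; it is meant also for vertices outside every \<open>W j\<close>, which join
  part \<open>i\<close> on this criterion. Nothing is asked about adjacency to part \<open>i\<close>
  itself.\<close>

definition typical :: "nat \<Rightarrow> nat \<Rightarrow> bool" where
  "typical i v \<longleftrightarrow> v \<in> S \<and> (\<forall>j\<in>{1..l}. j \<noteq> i \<longrightarrow> real (card {u\<in>W j. \<not> adj v u}) \<le> m')"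

lemma W_typical: "i \<in> {1..l} \<Longrightarrow> v \<in> W i \<Longrightarrow> typical i v"
  unfolding typical_def using miss[of i] m WS by fastforce

lemma finite_W: "finite (W j)"
  using WS S finite_subset by blast

text \<open>A union bound over at most four vertices, as many as two extra edges have. After their
  losses of \<open>4 * m'\<close>, what \<open>big\<close> leaves is the room for
  \<open>greedy_extension\<close>, plus 12 for vertices to be avoided.\<close>

lemma card_common_nbrs:
  assumes k: "k \<in> {1..l}" and B: "finite B" "card B \<le> 4" "\<And>b. b \<in> B \<Longrightarrow> real (card {u\<in>W k. \<not> adj b u}) \<le> m'"
  shows "real (card {x\<in>W k. \<forall>b\<in>B. adj b x}) > l * t * m + l * t + 12"
proof -
  have "W k \<subseteq> {x\<in>W k. \<forall>b\<in>B. adj b x} \<union> (\<Union>b\<in>B. {u\<in>W k. \<not> adj b u})" by auto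
  then have "card (W k) \<le> card ({x\<in>W k. \<forall>b\<in>B. adj b x} \<union> (\<Union>b\<in>B. {u\<in>W k. \<not> adj b u}))"
    using finite_W B(1) by (intro card_mono) auto
  also have "\<dots> \<le> card {x\<in>W k. \<forall>b\<in>B. adj b x} + card (\<Union>b\<in>B. {u\<in>W k. \<not> adj b u})" by (rule card_Un_le)
  also have "card (\<Union>b\<in>B. {u\<in>W k. \<not> adj b u}) \<le> (\<Sum>b\<in>B. card {u\<in>W k. \<not> adj b u})" by (rule card_UN_le[OF B(1)])
  finally have "card (W k) \<le> card {x\<in>W k. \<forall>b\<in>B. adj b x} + (\<Sum>b\<in>B. card {u\<in>W k. \<not> adj b u})" by simp
  then have "real (card (W k)) \<le> real (card {x\<in>W k. \<forall>b\<in>B. adj b x} + (\<Sum>b\<in>B. card {u\<in>W k. \<not> adj b u}))"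
    by (simp only: of_nat_le_iff)
  then have "real (card (W k)) \<le> real (card {x\<in>W k. \<forall>b\<in>B. adj b x}) + (\<Sum>b\<in>B. real (card {u\<in>W k. \<not> adj b u}))" by simp
  moreover have "(\<Sum>b\<in>B. real (card {u\<in>W k. \<not> adj b u})) \<le> (\<Sum>b\<in>B. m')" using B(3) by (intro sum_mono) auto
  moreover have "(\<Sum>b\<in>B. m') \<le> 4 * m'" using B(2) m by (simp add: mult_right_mono)
  ultimately show ?thesis using big[OF k] by linarith
qed

text \<open>The prescribed images \<open>\<psi>\<close> of the extra edges extend to the whole grid,
  since typical vertices have enough common neighbours in the other parts, and \<open>w1\<close>,
  \<open>w2\<close> are kept out of the image as new vertices. The bijection \<open>\<sigma>\<close>
  tells which part of \<open>W\<close> hosts which part of the pattern.\<close>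

lemma same_colour:
  fixes \<psi> :: "nat \<times> nat \<Rightarrow> nat"
  defines "P \<equiv> {(1, 1), (1, 2)} \<union> E"
  assumes s: "bij_betw \<sigma> {1..l} {1..l}" and inj: "inj_on \<psi> P" and ca: "cross_adj \<psi> P"
    and ty: "\<And>z. z \<in> P \<Longrightarrow> typical (\<sigma> (fst z)) (\<psi> z)"
    and w: "w1 \<in> S - \<psi> ` P" "w2 \<in> S - \<psi> ` P" "w1 \<noteq> w2"
  shows "\<chi> (insert w1 (\<psi> ` {(1, 1), (1, 2)})) = \<chi> (insert w2 (\<psi> ` E))"
proof -
  have Pg: "P \<subseteq> grid" using special_edges by (auto simp: P_def)
  have fP: "finite P" using Pg finite_grid finite_subset by blast
  have cP: "card P \<le> 4" using special_edges(5) by (simp add: P_def)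
  have sl: "\<sigma> j \<in> {1..l}" if "j \<in> {1..l}" for j using s that by (auto simp: bij_betw_def)
  have sinj: "\<sigma> i \<noteq> \<sigma> j" if "i \<in> {1..l}" "j \<in> {1..l}" "i \<noteq> j" for i j
    using inj_onD[OF bij_betw_imp_inj_on[OF s], of i j] that by blast
  have fst_l: "fst z \<in> {1..l}" if "z \<in> P" for z using that Pg by (auto simp: grid_def)
  define B where "B j = \<psi> ` {z\<in>P. fst z \<noteq> j}" for j
  define N where "N j = {x\<in>W (\<sigma> j). \<forall>b\<in>B j. adj b x}" for j
  have "\<exists>\<phi>. inj_on \<phi> grid \<and> \<phi> ` grid \<subseteq> S \<and> cross_adj \<phi> grid \<and> (\<forall>z\<in>P. \<phi> z = \<psi> z) \<and>
    (\<forall>z\<in>grid - P. \<phi> z \<in> N (fst z) - {w1, w2})"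
  proof (rule greedy_extension[where W = "\<lambda>j. W (\<sigma> j)" and m = m])
    show "N j \<subseteq> W (\<sigma> j)" for j by (auto simp: N_def)
    show "real (card {u\<in>W (\<sigma> j). \<not> adj v u}) \<le> m" if "i \<in> {1..l}" "j \<in> {1..l}" "i \<noteq> j" "v \<in> W (\<sigma> i)" for i j v
      using miss[of "\<sigma> i" "\<sigma> j" v] sl sinj that by blast
    show "\<psi> ` P \<subseteq> S" using ty by (auto simp: typical_def)
    show "adj (\<psi> z) x" if "j \<in> {1..l}" "x \<in> N j" "z \<in> P" "fst z \<noteq> j" for j x z
    proof -
      have "\<psi> z \<in> B j" unfolding B_def using that(3,4) by blast
      then show ?thesis using that(2) by (simp add: N_def)
    qed
    fix j assume j: "j \<in> {1..l}"
    have "finite (B j)" using fP by (simp add: B_def)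
    moreover have "card (B j) \<le> 4"
    proof -
      have "card (B j) \<le> card {z\<in>P. fst z \<noteq> j}" unfolding B_def using fP by (intro card_image_le) auto
      also have "\<dots> \<le> card P" using fP by (intro card_mono) auto
      finally show ?thesis using cP by simp
    qed
    moreover have "real (card {u\<in>W (\<sigma> j). \<not> adj b u}) \<le> m'" if "b \<in> B j" for b
    proof -
      obtain z where z: "z \<in> P" "fst z \<noteq> j" "b = \<psi> z" using \<open>b \<in> B j\<close> by (auto simp: B_def)
      show ?thesis using ty[OF z(1)] sl[OF j] sinj[of "fst z" j] fst_l[OF z(1)] j z by (simp add: typical_def)
    qed
    ultimately have "real (card (N j)) > l * t * m + l * t + 12"
      unfolding N_def using card_common_nbrs[OF sl[OF j]] by blast
    moreover have "card {w1, w2} = 2" using w(3) by simp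
    ultimately show "real (card (N j)) > l * t * m + l * t + card {w1, w2}" by simp
  qed (use WS m Pg inj ca in auto)
  then obtain \<phi> where phi: "inj_on \<phi> grid" "\<phi> ` grid \<subseteq> S" "cross_adj \<phi> grid" "\<forall>z\<in>P. \<phi> z = \<psi> z"
    "\<forall>z\<in>grid - P. \<phi> z \<in> N (fst z) - {w1, w2}" by blast
  have im: "\<phi> ` A = \<psi> ` A" if "A \<subseteq> P" for A using phi(4) that by (intro image_cong) auto
  have "w \<notin> \<phi> ` grid" if "w \<in> {w1, w2}" for w
  proof
    assume "w \<in> \<phi> ` grid"
    then obtain z where z: "z \<in> grid" "w = \<phi> z" by blast
    show False
    proof (cases "z \<in> P")
      case True
      then have "w \<in> \<psi> ` P" using z phi(4) by auto
      then show False using w that by auto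
    next
      case False
      then have "\<phi> z \<notin> {w1, w2}" using phi(5) z(1) by blast
      then show False using z(2) that by simp
    qed
  qed
  then have "w1 \<in> S - \<phi> ` grid" "w2 \<in> S - \<phi> ` grid" using w by auto
  note eq = special_edges_same_colour[OF phi(1-3) this w(3)]
  have sub: "{(1, 1), (1, 2)} \<subseteq> P" "E \<subseteq> P" unfolding P_def by blast+
  note im[OF sub(1)] im[OF sub(2)]
  with eq show ?thesis by (simp only:)
qed

text \<open>More than 12 common neighbours minus the at most 9 members of \<open>A\<close> leave
  three vertices. The first two are meant as a new pair inside the part, the third as the vertex
  expanding it.\<close>

lemma pick_three:
  assumes k: "k \<in> {1..l}" and A: "finite A" "card A \<le> 9"
    and B: "finite B" "card B \<le> 4" "\<And>b. b \<in> B \<Longrightarrow> real (card {u\<in>W k. \<not> adj b u}) \<le> m'"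
  obtains x y z where "x \<in> W k" "y \<in> W k" "z \<in> W k" "x \<notin> A" "y \<notin> A" "z \<notin> A" "x \<noteq> y" "x \<noteq> z" "y \<noteq> z"
    "\<And>b. b \<in> B \<Longrightarrow> adj b x \<and> adj b y"
proof -
  define N where "N = {x\<in>W k. \<forall>b\<in>B. adj b x}"
  have "real (card N) > l * t * m + l * t + 12" unfolding N_def using card_common_nbrs[OF k B] by blast
  moreover have "l * t * m \<ge> 0" using m by simp
  ultimately have "real (card N) > 12" by (smt (verit) of_nat_0_le_iff)
  then have "card N \<ge> 12" by simp
  moreover have "card N - card A \<le> card (N - A)" by (rule diff_card_le_card_Diff[OF A(1)])
  ultimately have "3 \<le> card (N - A)" using A(2) by linarith
  then obtain T where "T \<subseteq> N - A" "card T = 3" by (rule obtain_subset_with_card_n)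
  then obtain x y z where "x \<in> N - A" "y \<in> N - A" "z \<in> N - A" "x \<noteq> y" "x \<noteq> z" "y \<noteq> z"
    by (auto simp: card_3_iff)
  then show thesis by (intro that[of x y z]) (auto simp: N_def)
qed

lemma same_colour_alpha:
  assumes Ea: "E = {(1, 2), (1, 3)}" and i: "i \<in> {1..l}" and ty: "typical i a" "typical i b" "typical i c"
    and d: "a \<noteq> b" "a \<noteq> c" "b \<noteq> c" and w: "w1 \<in> S - {a, b, c}" "w2 \<in> S - {a, b, c}" "w1 \<noteq> w2"
  shows "\<chi> {a, b, w1} = \<chi> {b, c, w2}"
proof -
  \<comment> \<open>Any second part will do, as both extra edges lie in part 1 of the
    pattern.\<close>
  have "\<exists>k\<in>{1..l}. k \<noteq> i" using l by (intro bexI[of _ "if i = 1 then 2 else 1"]) auto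
  then obtain k where "k \<in> {1..l}" "i \<noteq> k" by blast
  from permutation_of_two_indices[OF i this]
  obtain \<sigma> where s: "bij_betw \<sigma> {1..l} {1..l}" "\<sigma> 1 = i" by blast
  define \<psi> where "\<psi> z = (if z = (1, 1) then a else if z = (1, 2) then b else c)" for z :: "nat \<times> nat"
  have "\<chi> (insert w1 (\<psi> ` {(1, 1), (1, 2)})) = \<chi> (insert w2 (\<psi> ` E))"
  proof (rule same_colour[OF s(1)])
    have P: "{(1, 1), (1, 2)} \<union> E = {(1, 1), (1, 2), (1, 3)}" unfolding Ea by auto
    show "inj_on \<psi> ({(1, 1), (1, 2)} \<union> E)" unfolding P using d  by (auto simp: inj_on_def \<psi>_def)
    show "cross_adj \<psi> ({(1, 1), (1, 2)} \<union> E)" unfolding P cross_adj_def  by (simp add: \<psi>_def)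
    show "typical (\<sigma> (fst z)) (\<psi> z)" if "z \<in> {(1, 1), (1, 2)} \<union> E" for z
      using that s ty unfolding P by (auto simp: \<psi>_def)
    show "w1 \<in> S - \<psi> ` ({(1, 1), (1, 2)} \<union> E)" "w2 \<in> S - \<psi> ` ({(1, 1), (1, 2)} \<union> E)"
      unfolding P using w by (simp_all add: \<psi>_def)
  qed (rule w(3))
  then have "\<chi> (insert w1 (\<psi> ` {(1, 1), (1, 2)})) = \<chi> (insert w2 (\<psi> ` {(1, 2), (1, 3)}))" by (simp only: Ea)
  then show ?thesis by (simp add: \<psi>_def insert_commute)
qed

lemma same_colour_beta:
  assumes Ea: "E = {(1, 3), (1, 4)}" and i: "i \<in> {1..l}" and ty: "typical i a" "typical i b" "typical i c" "typical i d"
    and d: "a \<noteq> b" "a \<noteq> c" "a \<noteq> d" "b \<noteq> c" "b \<noteq> d" "c \<noteq> d"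
    and w: "w1 \<in> S - {a, b, c, d}" "w2 \<in> S - {a, b, c, d}" "w1 \<noteq> w2"
  shows "\<chi> {a, b, w1} = \<chi> {c, d, w2}"
proof -
  have "\<exists>k\<in>{1..l}. k \<noteq> i" using l by (intro bexI[of _ "if i = 1 then 2 else 1"]) auto
  then obtain k where "k \<in> {1..l}" "i \<noteq> k" by blast
  from permutation_of_two_indices[OF i this]
  obtain \<sigma> where s: "bij_betw \<sigma> {1..l} {1..l}" "\<sigma> 1 = i" by blast
  define \<psi> where "\<psi> z = (if z = (1, 1) then a else if z = (1, 2) then b else if z = (1, 3) then c else d)" for z :: "nat \<times> nat"
  have "\<chi> (insert w1 (\<psi> ` {(1, 1), (1, 2)})) = \<chi> (insert w2 (\<psi> ` E))"
  proof (rule same_colour[OF s(1)])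
    have P: "{(1, 1), (1, 2)} \<union> E = {(1, 1), (1, 2), (1, 3), (1, 4)}" unfolding Ea by auto
    show "inj_on \<psi> ({(1, 1), (1, 2)} \<union> E)" unfolding P using d  by (auto simp: inj_on_def \<psi>_def)
    show "cross_adj \<psi> ({(1, 1), (1, 2)} \<union> E)" unfolding P cross_adj_def  by (simp add: \<psi>_def)
    show "typical (\<sigma> (fst z)) (\<psi> z)" if "z \<in> {(1, 1), (1, 2)} \<union> E" for z
      using that s ty unfolding P by (auto simp: \<psi>_def)
    show "w1 \<in> S - \<psi> ` ({(1, 1), (1, 2)} \<union> E)" "w2 \<in> S - \<psi> ` ({(1, 1), (1, 2)} \<union> E)"
      unfolding P using w by (simp_all add: \<psi>_def)
  qed (rule w(3))
  then have "\<chi> (insert w1 (\<psi> ` {(1, 1), (1, 2)})) = \<chi> (insert w2 (\<psi> ` {(1, 3), (1, 4)}))" by (simp only: Ea)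
  then show ?thesis by (simp add: \<psi>_def insert_commute)
qed

lemma same_colour_gamma:
  assumes Ea: "E = {(2, 1), (2, 2)}" and i: "i \<in> {1..l}" "k \<in> {1..l}" "i \<noteq> k"
    and ty: "typical i a" "typical i b" "typical k c" "typical k d"
    and d: "a \<noteq> b" "c \<noteq> d" and ad: "adj a c" "adj a d" "adj b c" "adj b d"
    and w: "w1 \<in> S - {a, b, c, d}" "w2 \<in> S - {a, b, c, d}" "w1 \<noteq> w2"
  shows "\<chi> {a, b, w1} = \<chi> {c, d, w2}"
proof -
  from permutation_of_two_indices[OF i]
  obtain \<sigma> where s: "bij_betw \<sigma> {1..l} {1..l}" "\<sigma> 1 = i" "\<sigma> 2 = k" by blast
  define \<psi> where "\<psi> z = (if z = (1, 1) then a else if z = (1, 2) then b else if z = (2, 1) then c else d)" for z :: "nat \<times> nat"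
  have ne: "a \<noteq> c" "a \<noteq> d" "b \<noteq> c" "b \<noteq> d" using ad adj_irrefl by auto
  have ad': "adj c a" "adj d a" "adj c b" "adj d b" using ad adj_sym by auto
  have "\<chi> (insert w1 (\<psi> ` {(1, 1), (1, 2)})) = \<chi> (insert w2 (\<psi> ` E))"
  proof (rule same_colour[OF s(1)])
    have P: "{(1, 1), (1, 2)} \<union> E = {(1, 1), (1, 2), (2, 1), (2, 2)}" unfolding Ea by auto
    show "inj_on \<psi> ({(1, 1), (1, 2)} \<union> E)" unfolding P using d ne by (auto simp: inj_on_def \<psi>_def)
    show "cross_adj \<psi> ({(1, 1), (1, 2)} \<union> E)" unfolding P cross_adj_def using ad ad' ne by (simp add: \<psi>_def)
    show "typical (\<sigma> (fst z)) (\<psi> z)" if "z \<in> {(1, 1), (1, 2)} \<union> E" for z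
      using that s ty unfolding P by (auto simp: \<psi>_def)
    show "w1 \<in> S - \<psi> ` ({(1, 1), (1, 2)} \<union> E)" "w2 \<in> S - \<psi> ` ({(1, 1), (1, 2)} \<union> E)"
      unfolding P using w by (simp_all add: \<psi>_def)
  qed (rule w(3))
  then have "\<chi> (insert w1 (\<psi> ` {(1, 1), (1, 2)})) = \<chi> (insert w2 (\<psi> ` {(2, 1), (2, 2)}))" by (simp only: Ea)
  then show ?thesis by (simp add: \<psi>_def insert_commute)
qed

text \<open>The family \<open>U\<close> is a parameter because it will be \<open>W\<close> when
  private colours are bounded and a partition of all of \<open>S\<close> in the final count.\<close>

definition bad :: "(nat \<Rightarrow> nat set) \<Rightarrow> nat \<Rightarrow> nat set set" where
  "bad U i = {e \<in> triples S. \<exists>u\<in>e. \<exists>v\<in>e. u \<noteq> v \<and> u \<in> U i \<and> v \<in> U i}"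

lemma bad_triple:
  assumes "e \<in> bad U i"
  obtains u v w where "e = {u, v, w}" "u \<noteq> v" "u \<in> U i" "v \<in> U i" "w \<in> S" "w \<noteq> u" "w \<noteq> v" "card e = 3" "finite e"
proof -
  obtain u v where uv: "u \<in> e" "v \<in> e" "u \<noteq> v" "u \<in> U i" "v \<in> U i" using assms by (auto simp: bad_def)
  have e: "card e = 3" "e \<subseteq> S" using assms by (auto simp: bad_def triples_def)
  have fe: "finite e" using e by (intro card_ge_0_finite) simp
  have "card (e - {u, v}) = 1" using e uv fe by (simp add: card_Diff_subset)
  then obtain w where w: "e - {u, v} = {w}" by (auto simp: card_1_singleton_iff)
  have "e = {u, v, w}" using w uv by blast
  moreover have "w \<in> S" "w \<noteq> u" "w \<noteq> v" using w e by auto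
  ultimately show thesis using that uv e fe by blast
qed

text \<open>Both triples are compared with a fresh triple \<open>{x, x', y}\<close> inside
  \<open>W i\<close>. For disjoint extra edges one comparison suffices; for the path the pair
  \<open>u v\<close> is linked to the disjoint pair \<open>x x'\<close> through the pair
  \<open>v x\<close>.\<close>

lemma bad_same_colour_in_part:
  assumes E2: "E \<noteq> {(2, 1), (2, 2)}" and i: "i \<in> {1..l}" and U: "\<And>v. v \<in> U i \<Longrightarrow> typical i v"
    and e: "e \<in> bad U i" "e' \<in> bad U i"
  shows "\<chi> e = \<chi> e'"
proof -
  have fin: "finite e" "card e = 3" "finite e'" "card e' = 3"
    using e by (auto simp: bad_def triples_def intro: card_ge_0_finite)
  have c6: "card (e \<union> e') \<le> 6" using card_Un_le[of e e'] fin by simp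
  obtain x x' y where x: "x \<in> W i" "x' \<in> W i" "y \<in> W i" "x \<notin> e \<union> e'" "x' \<notin> e \<union> e'" "y \<notin> e \<union> e'" "x \<noteq> x'" "x \<noteq> y" "x' \<noteq> y"
    using pick_three[OF i, of "e \<union> e'" "{}"] fin c6 by auto
  have t: "typical i x" "typical i x'" "typical i y" using W_typical[OF i] x by auto
  have yS: "x \<in> S" "x' \<in> S" "y \<in> S" using x WS by auto
  have "\<chi> f = \<chi> {x, x', y}" if f: "f \<in> {e, e'}" for f
  proof -
    have fb: "f \<in> bad U i" using f e by auto
    obtain u v w where uv: "f = {u, v, w}" "u \<noteq> v" "u \<in> U i" "v \<in> U i" "w \<in> S" "w \<noteq> u" "w \<noteq> v"
      by (rule bad_triple[OF fb])
    have tu: "typical i u" "typical i v" using U uv by auto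
    have uS: "u \<in> S" "v \<in> S" using tu by (auto simp: typical_def)
    have nx: "x \<notin> {u, v, w}" "x' \<notin> {u, v, w}" "y \<notin> {u, v, w}" using x f uv(1) by auto
    show ?thesis
    proof (cases "E = {(1, 2), (1, 3)}")
      case True
      have cA: "card (insert x (insert x' (insert y (e \<union> e')))) \<le> 9"
        using c6 fin by (simp add: card_insert_if)
      obtain z where z: "z \<in> W i" "z \<notin> insert x (insert x' (insert y (e \<union> e')))"
        using pick_three[OF i _ cA, of "{}"] fin by auto
      have zz: "z \<notin> {u, v, w}" "z \<noteq> x" "z \<noteq> x'" "z \<noteq> y" "z \<in> S" using z f uv(1) WS by auto
      have "\<chi> {u, v, w} = \<chi> {v, x, z}"
        by (rule same_colour_alpha[OF True i]) (use tu t uv nx zz in auto)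
      also have "\<dots> = \<chi> {x, x', y}"
        by (rule same_colour_alpha[OF True i]) (use tu t uv nx zz x yS in auto)
      finally show ?thesis using uv(1) by simp
    next
      case False
      then have Eb: "E = {(1, 3), (1, 4)}" using E E2 by auto
      have "\<chi> {u, v, w} = \<chi> {x, x', y}"
        by (rule same_colour_beta[OF Eb i]) (use tu t uv nx x yS in auto)
      then show ?thesis using uv(1) by simp
    qed
  qed
  then show ?thesis by simp
qed

text \<open>As \<open>i\<close> and \<open>j\<close> may coincide, the two triples are not compared
  directly but both with a fresh triple inside \<open>W k\<close> for a third part \<open>k\<close>,
  which exists by \<open>l \<ge> 3\<close>. Its pair \<open>x x'\<close> is chosen adjacent to the
  pairs of both triples.\<close>

lemma bad_same_colour_gamma:
  assumes E2: "E = {(2, 1), (2, 2)}" and i: "i \<in> {1..l}" "j \<in> {1..l}"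
    and U: "\<And>i v. i \<in> {1..l} \<Longrightarrow> v \<in> U i \<Longrightarrow> typical i v"
    and e: "e \<in> bad U i" "e' \<in> bad U j"
  shows "\<chi> e = \<chi> e'"
proof -
  obtain u v w where uv: "e = {u, v, w}" "u \<noteq> v" "u \<in> U i" "v \<in> U i" "w \<in> S" "w \<noteq> u" "w \<noteq> v"
    by (rule bad_triple[OF e(1)])
  obtain u' v' w' where uv': "e' = {u', v', w'}" "u' \<noteq> v'" "u' \<in> U j" "v' \<in> U j" "w' \<in> S" "w' \<noteq> u'" "w' \<noteq> v'"
    by (rule bad_triple[OF e(2)])
  have tu: "typical i u" "typical i v" "typical j u'" "typical j v'" using U uv uv' i by auto
  have "\<exists>k\<in>{1..l}. k \<noteq> i \<and> k \<noteq> j"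
  proof -
    have "card {i, j} \<le> 2" using card_length[of "[i, j]"] by simp
    then have "\<not> {1..l} \<subseteq> {i, j}" using card_mono[of "{i, j}" "{1..l}"] l by auto
    then show ?thesis by blast
  qed
  then obtain k where k: "k \<in> {1..l}" "k \<noteq> i" "k \<noteq> j" by blast
  have cA: "card {u, v, w, u', v', w'} \<le> 9"
    using card_length[of "[u, v, w, u', v', w']"] by simp
  have cB: "card {u, v, u', v'} \<le> 4"
    using card_length[of "[u, v, u', v']"] by simp
  obtain x x' y where x: "x \<in> W k" "x' \<in> W k" "y \<in> W k" "x \<notin> {u, v, w, u', v', w'}" "x' \<notin> {u, v, w, u', v', w'}"
    "y \<notin> {u, v, w, u', v', w'}" "x \<noteq> x'" "x \<noteq> y" "x' \<noteq> y" "\<And>b. b \<in> {u, v, u', v'} \<Longrightarrow> adj b x \<and> adj b x'"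
    by (rule pick_three[OF k(1) _ cA _ cB]) (use tu k in \<open>auto simp: typical_def\<close>)
  have t: "typical k x" "typical k x'" using W_typical[OF k(1)] x by auto
  have yS: "y \<in> S" using x WS by auto
  have "\<chi> {u, v, w} = \<chi> {x, x', y}"
    by (rule same_colour_gamma[OF E2 i(1) k(1) k(2)[symmetric] tu(1,2) t]) (use uv x yS in auto)
  moreover have "\<chi> {u', v', w'} = \<chi> {x, x', y}"
    by (rule same_colour_gamma[OF E2 i(2) k(1) k(3)[symmetric] tu(3,4) t]) (use uv' x yS in auto)
  ultimately show ?thesis using uv(1) uv'(1) by simp
qed

lemma card_bad_colours:
  assumes U: "\<And>i v. i \<in> {1..l} \<Longrightarrow> v \<in> U i \<Longrightarrow> typical i v"
  shows "card (\<chi> ` (\<Union>i\<in>{1..l}. bad U i)) \<le> (if E = {(2, 1), (2, 2)} then 1 else l)"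
proof -
  have fb: "finite (bad U i)" for i using finite_triples[OF S] by (simp add: bad_def)
  show ?thesis
  proof (cases "E = {(2, 1), (2, 2)}")
    case True
    have "card (\<chi> ` (\<Union>i\<in>{1..l}. bad U i)) \<le> Suc 0"
      using fb by (subst card_le_Suc0_iff_eq) (use bad_same_colour_gamma[OF True _ _ U] in blast)+
    then show ?thesis using True by simp
  next
    case False
    have one: "card (\<chi> ` bad U i) \<le> 1" if "i \<in> {1..l}" for i
    proof -
      have "card (\<chi> ` bad U i) \<le> Suc 0"
        using fb by (subst card_le_Suc0_iff_eq) (use bad_same_colour_in_part[OF False that U[OF that]] in blast)+
      then show ?thesis by simp
    qed
    have "card (\<chi> ` (\<Union>i\<in>{1..l}. bad U i)) = card (\<Union>i\<in>{1..l}. \<chi> ` bad U i)" by (simp only: image_UN)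
    also have "\<dots> \<le> (\<Sum>i\<in>{1..l}. card (\<chi> ` bad U i))" by (rule card_UN_le) simp
    also have "\<dots> \<le> (\<Sum>i\<in>{1..l}. 1)" using one by (intro sum_mono) auto
    finally show ?thesis using False by simp
  qed
qed

end

section \<open>Extending the partition to all vertices\<close>

text \<open>Here \<open>y i\<close> is the number of neighbours of a vertex in part \<open>i\<close>
  and \<open>B\<close> bounds the part sizes; \<open>big\<close> says that there are about as many
  ordered pairs of neighbours in different parts as \<open>l - 1\<close> full parts allow. Since
  \<open>y k\<close> is almost zero, a deficit of \<open>6 * L^2 * T * q * n\<close> in one more
  part would lose at least \<open>12 * (L - 2) * L * T * q * n^2\<close> pairs, more than all error
  terms together; hence the factor 6.\<close>

lemma near_full_link:
  fixes l t :: nat and y :: "nat \<Rightarrow> real" and L T q n B :: real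
  defines "L \<equiv> real l" and "T \<equiv> real t"
  assumes lt: "3 \<le> l" "l < t" and q: "q = 1 / (100 * L^3 * T)" and n: "n > 0" and B: "B = (1/L + L * q) * n"
    and y: "\<And>i. i \<in> {1..l} \<Longrightarrow> 0 \<le> y i \<and> y i \<le> B" and sy: "(\<Sum>i\<in>{1..l}. y i) \<le> n"
    and k: "k \<in> {1..l}" "y k \<le> (L * T + 1) * q * n"
    and big: "(\<Sum>i\<in>{1..l}. y i)^2 - (\<Sum>i\<in>{1..l}. y i ^ 2) \<ge> ((1 - 1/L) * (1 - 2/L) - 3 * L * q) * n^2"
    and j: "j \<in> {1..l}" "j \<noteq> k"
  shows "B - y j \<le> 6 * L^2 * T * q * n"
proof (rule ccontr)
  assume "\<not> ?thesis"
  then have neg: "y j < B - 6 * L^2 * T * q * n" by simp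
  have L: "L \<ge> 3" and T: "T \<ge> L + 1" using lt by (auto simp: L_def T_def)
  have q0: "q > 0" using L T by (simp add: q)
  define b where "b = 1/L + L * q"
  have b0: "b > 0" using L q0 by (simp add: b_def add_pos_pos)
  have Bb: "B = b * n" using B by (simp add: b_def)
  define R where "R = {1..l} - {k} - {j}"
  define s where "s = (\<Sum>i\<in>R. y i)"
  have fR: "finite R" by (simp add: R_def)
  have cR: "card R = l - 2" using k j by (simp add: R_def)
  have cRr: "real (card R) = L - 2" using cR lt by (simp add: L_def of_nat_diff)
  have split: "(\<Sum>i\<in>{1..l}. f i) = f k + f j + (\<Sum>i\<in>R. f i)" for f :: "nat \<Rightarrow> real"
    using sum.remove[of "{1..l}" k f] sum.remove[of "{1..l} - {k}" j f] k(1) j by (simp add: R_def)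
  have yR: "0 \<le> y i" "y i \<le> B" if "i \<in> R" for i using y that by (auto simp: R_def)
  have B0: "B > 0" using b0 n by (simp add: Bb)
  have s0: "s \<ge> 0" unfolding s_def using yR by (intro sum_nonneg) auto
  have sB: "s \<le> (L - 2) * B"
    using sum_bounded_above[of R y B] yR cRr by (simp add: s_def)
  have sq: "s^2 - (\<Sum>i\<in>R. y i ^ 2) \<le> (L - 2) * ((L - 3) * B^2)"
  proof -
    have "s^2 - (\<Sum>i\<in>R. y i ^ 2) = (\<Sum>i\<in>R. y i * (s - y i))"
      by (simp add: s_def power2_eq_square sum_distrib_right[symmetric] right_diff_distrib sum_subtractf)
    also have "\<dots> \<le> (\<Sum>i\<in>R. B * ((L - 3) * B))"
    proof (intro sum_mono mult_mono)
      fix i assume i: "i \<in> R"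
      have "s - y i = (\<Sum>i\<in>R - {i}. y i)" using sum.remove[OF fR i, of y] by (simp add: s_def)
      also have "\<dots> \<le> real (card (R - {i})) * B" using yR by (intro sum_bounded_above) auto
      also have "real (card (R - {i})) = L - 3"
      proof -
        have "real (Suc (card (R - {i}))) = real (card R)" using card_Suc_Diff1[OF fR i] by (simp only:)
        then show ?thesis using cRr by simp
      qed
      finally show "s - y i \<le> (L - 3) * B" .
      show "0 \<le> s - y i" unfolding s_def using member_le_sum[of i R y] i fR yR by simp
    qed (use yR B0 in auto)
    finally show ?thesis using cRr by (simp add: power2_eq_square algebra_simps)
  qed
  define e where "e = 6 * L^2 * T * q"
  have e0: "e > 0" using L T q0 by (simp add: e_def)
  have yj: "0 \<le> y j" "0 \<le> y k" using y j k by auto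
  have "y j + s \<le> n" using split[of y] sy yj by (simp add: s_def)
  then have t1: "2 * y k * (y j + s) \<le> 2 * ((L * T + 1) * q * n) * n"
    using k(2) yj s0 by (intro mult_mono) auto
  have t2: "2 * y j * s \<le> 2 * (B - e * n) * ((L - 2) * B)"
  proof -
    have "0 \<le> B - e * n" "y j \<le> B - e * n" using neg yj by (simp_all add: e_def)
    then show ?thesis using sB s0 yj by (intro mult_mono) auto
  qed
  \<comment> \<open>Ordered pairs split by whether they involve part \<open>k\<close>, part
    \<open>j\<close> but not \<open>k\<close>, or only the parts in \<open>R\<close>; the terms are
    bounded by the smallness of \<open>y k\<close>, by the assumed deficit of \<open>y j\<close>,
    and by \<open>B\<close>.\<close>
  have "(\<Sum>i\<in>{1..l}. y i)^2 - (\<Sum>i\<in>{1..l}. y i ^ 2) = 2 * y k * (y j + s) + 2 * y j * s + (s^2 - (\<Sum>i\<in>R. y i ^ 2))"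
    unfolding split[of y] split[of "\<lambda>i. y i ^ 2"] by (simp add: s_def power2_eq_square algebra_simps)
  then have "((1 - 1/L) * (1 - 2/L) - 3 * L * q) * n^2 \<le>
      2 * ((L * T + 1) * q * n) * n + 2 * (B - e * n) * ((L - 2) * B) + (L - 2) * ((L - 3) * B^2)"
    using big t1 t2 sq by linarith
  also have "\<dots> = (2 * (L * T + 1) * q + 2 * (b - e) * ((L - 2) * b) + (L - 2) * ((L - 3) * b^2)) * n^2"
    by (simp add: Bb power2_eq_square algebra_simps)
  finally have "(1 - 1/L) * (1 - 2/L) - 3 * L * q \<le> 2 * (L * T + 1) * q + 2 * (b - e) * ((L - 2) * b) + (L - 2) * ((L - 3) * b^2)"
    using n by simp
  then have ineq: "(1 - 1/L) * (1 - 2/L) \<le> 3 * L * q + 2 * (L * T + 1) * q + (L - 1) * (L - 2) * b^2 - 2 * (L - 2) * (e * b)"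
    by (simp add: power2_eq_square algebra_simps)
  \<comment> \<open>The choice of \<open>q\<close> makes the quadratic term \<open>L^2 * q^2\<close>
    of \<open>b^2\<close> at most \<open>q\<close>.\<close>
  have Lq: "L^2 * q \<le> 1"
  proof -
    have "100 * (L * T) * (L^2 * q) = 1" using L T by (simp add: q power2_eq_square power3_eq_cube)
    moreover have "1 * (L^2 * q) \<le> 100 * (L * T) * (L^2 * q)"
    proof (intro mult_right_mono)
      have "1 * 1 \<le> L * T" using L T by (intro mult_mono) auto
      then show "1 \<le> 100 * (L * T)" by simp
    qed (use q0 in simp)
    ultimately show ?thesis by linarith
  qed
  have "b^2 = 1/L^2 + 2 * q + (L^2 * q) * q" using L by (simp add: b_def power2_eq_square field_simps)
  also have "\<dots> \<le> 1/L^2 + 2 * q + 1 * q" using Lq q0 by (intro add_left_mono mult_right_mono) auto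
  finally have b2: "b^2 \<le> 1/L^2 + 3 * q" by simp
  have L12: "(L - 1) * (L - 2) \<ge> 0" using L by simp
  have "(L - 1) * (L - 2) * b^2 \<le> (L - 1) * (L - 2) * (1/L^2 + 3 * q)" using b2 L12 by (intro mult_left_mono)
  moreover have "(L - 1) * (L - 2) * (1/L^2 + 3 * q) = (1 - 1/L) * (1 - 2/L) + 3 * (L - 1) * (L - 2) * q"
    using L by (simp add: power2_eq_square field_simps)
  moreover have "2 * (L - 2) * (e * b) \<ge> 12 * (L - 2) * (L * T) * q"
  proof -
    have "e * b \<ge> e * (1/L)" using e0 L q0 by (intro mult_left_mono) (auto simp: b_def)
    moreover have "e * (1/L) = 6 * L * T * q" using L by (simp add: e_def power2_eq_square)
    ultimately have "2 * (L - 2) * (e * b) \<ge> 2 * (L - 2) * (6 * L * T * q)" using L by (intro mult_left_mono) auto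
    then show ?thesis by (simp add: algebra_simps)
  qed
  ultimately have "12 * (L - 2) * (L * T) * q \<le> 3 * L * q + 2 * (L * T + 1) * q + 3 * (L - 1) * (L - 2) * q"
    using ineq by linarith
  then have "(12 * (L - 2) * (L * T)) * q \<le> (3 * L + 2 * (L * T + 1) + 3 * (L - 1) * (L - 2)) * q"
    by (simp add: algebra_simps)
  then have fin: "12 * (L - 2) * (L * T) \<le> 3 * L + 2 * (L * T + 1) + 3 * (L - 1) * (L - 2)"
    using q0 by simp
  have LT: "L * T \<ge> L * 4" "L * T \<ge> 12"
  proof -
    show "L * T \<ge> L * 4" using L T by (intro mult_left_mono) auto
    then show "L * T \<ge> 12" using L by linarith
  qed
  have a1: "(L - 2) * (L * T) \<ge> 1 * (L * T)" using L LT by (intro mult_right_mono) auto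
  have a2: "(L - 2) * (L * T) \<ge> (L - 2) * (L - 1)" 
  proof (intro mult_left_mono)
    show "L - 1 \<le> L * T" using LT(1) L by linarith
  qed (use L in simp)
  show False using fin a1 a2 LT by (simp add: algebra_simps)
qed

section \<open>Private colours at a vertex\<close>

context typical_base begin

text \<open>A colour lost with \<open>v\<close> lies on a triple that meets some \<open>W i\<close>
  twice (at most \<open>l\<close> such colours), meets the remainder outside all \<open>W j\<close>,
  contains a poor pair at \<open>v\<close>, or joins \<open>v\<close> to two neighbours in different
  parts. Only the last kind is of main order: twice the number of such pairs is at most the square
  of the sum of the \<open>y j\<close> minus the sum of their squares, written additively to avoid
  truncated subtraction.\<close>

lemma card_new_colours_le:
  assumes v: "v \<in> S"
  defines "y \<equiv> \<lambda>j. card {x\<in>W j. adj v x}"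
  shows "2 * card (\<chi> ` triples S) + (\<Sum>j\<in>{1..l}. y j ^ 2) \<le>
    2 * (card (\<chi> ` triples (S - {v})) + l + card (S - (\<Union>j\<in>{1..l}. W j)) * card S + card S * richness l t E)
      + (\<Sum>j\<in>{1..l}. y j) ^ 2"
proof -
  define Z where "Z = S - (\<Union>j\<in>{1..l}. W j)"
  define A2 where "A2 = (\<lambda>(z, x). {v, z, x}) ` (Z \<times> S)"
  define X where "X = {x\<in>S. x \<noteq> v \<and> \<not> adj v x}"
  define g where "g x = \<chi> ` {f \<in> triples S. v \<in> f \<and> x \<in> f}" for x
  define N where "N j = {x\<in>W j. adj v x}" for j
  define Q where "Q = (\<Union>j\<in>{1..l}. N j)"
  \<comment> \<open>The condition \<open>x < x'\<close> lists each pair once; \<open>P\<close>, its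
    mirror image and the pairs within one \<open>N j\<close> are disjoint subsets of
    \<open>Q \<times> Q\<close>.\<close>
  define P where "P = {(x, x'). x \<in> Q \<and> x' \<in> Q \<and> x < x' \<and> \<not> (\<exists>i\<in>{1..l}. x \<in> W i \<and> x' \<in> W i)}"
  define Cr where "Cr = (\<lambda>(x, x'). {v, x, x'}) ` P"
  have fN: "finite (N j)" for j using finite_W by (simp add: N_def)
  have fQ: "finite Q" using fN by (simp add: Q_def)
  have fP: "finite P" by (rule finite_subset[of _ "Q \<times> Q"]) (use fQ in \<open>auto simp: P_def\<close>)
  have fZ: "finite Z" using S by (simp add: Z_def)
  have fX: "finite X" using S by (simp add: X_def)
  have ft: "finite (triples T)" if "T \<subseteq> S" for T using finite_triples finite_subset[OF that S] by blast
  let ?bad = "\<Union>i\<in>{1..l}. bad W i"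
  have fbad: "finite ?bad" using ft[of S] by (auto simp: bad_def)
  have cover: "\<chi> ` triples S \<subseteq> \<chi> ` triples (S - {v}) \<union> \<chi> ` ?bad \<union> \<chi> ` A2 \<union> (\<Union>x\<in>X. g x) \<union> \<chi> ` Cr"
  proof
    fix c assume "c \<in> \<chi> ` triples S"
    then obtain e where e: "e \<in> triples S" "c = \<chi> e" by blast
    have e': "card e = 3" "e \<subseteq> S" "finite e" using e by (auto simp: triples_def intro: card_ge_0_finite)
    show "c \<in> \<chi> ` triples (S - {v}) \<union> \<chi> ` ?bad \<union> \<chi> ` A2 \<union> (\<Union>x\<in>X. g x) \<union> \<chi> ` Cr"
    proof (cases "v \<in> e")
      case False
      then have "e \<in> triples (S - {v})" using e' by (auto simp: triples_def)
      then show ?thesis using e(2) by blast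
    next
      case True
      then have "card (e - {v}) = 2" using e' by simp
      then obtain x0 y0 where xy0: "e - {v} = {x0, y0}" "x0 \<noteq> y0" by (auto simp: card_2_iff)
      have "\<exists>x x'. e - {v} = {x, x'} \<and> x < x'"
      proof (cases "x0 < y0")
        case True
        then show ?thesis using xy0(1) by blast
      next
        case False
        then have "y0 < x0" using xy0(2) by simp
        moreover have "e - {v} = {y0, x0}" using xy0(1) by blast
        ultimately show ?thesis by blast
      qed
      then obtain x x' where xx: "e - {v} = {x, x'}" "x < x'" by blast
      have eq: "e = {v, x, x'}" using xx True by blast
      have xS: "x \<in> S" "x' \<in> S" "x \<noteq> v" "x' \<noteq> v" using xx e' by auto
      consider (Z1) "x \<in> Z" | (Z2) "x' \<in> Z" | (X1) "\<not> adj v x" | (X2) "\<not> adj v x'"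
        | (ok) "x \<notin> Z" "x' \<notin> Z" "adj v x" "adj v x'" by blast
      then show ?thesis
      proof cases
        case Z1
        then have "e \<in> A2" unfolding A2_def eq using xS by (intro image_eqI[of _ _ "(x, x')"]) auto
        then show ?thesis using e(2) by blast
      next
        case Z2
        then have "e \<in> A2" unfolding A2_def eq using xS by (intro image_eqI[of _ _ "(x', x)"]) auto
        then show ?thesis using e(2) by blast
      next
        case X1
        then have "x \<in> X" "c \<in> g x" using xS e eq by (auto simp: X_def g_def)
        then show ?thesis by blast
      next
        case X2
        then have "x' \<in> X" "c \<in> g x'" using xS e eq by (auto simp: X_def g_def)
        then show ?thesis by blast
      next
        case ok
        then have xQ: "x \<in> Q" "x' \<in> Q" using xS by (auto simp: Q_def N_def Z_def)
        show ?thesis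
        proof (cases "\<exists>i\<in>{1..l}. x \<in> W i \<and> x' \<in> W i")
          case True
          then obtain i where i: "i \<in> {1..l}" "x \<in> W i" "x' \<in> W i" by blast
          have "e \<in> bad W i" unfolding bad_def using e(1) eq i xx(2) by auto
          then show ?thesis using i(1) e(2) by blast
        next
          case False
          then have "(x, x') \<in> P" using xQ xx(2) by (simp add: P_def)
          then have "e \<in> Cr" unfolding Cr_def eq by (intro image_eqI[of _ _ "(x, x')"]) auto
          then show ?thesis using e(2) by blast
        qed
      qed
    qed
  qed
  have fg: "finite (\<Union>x\<in>X. g x)" using fX ft[of S] by (auto simp: g_def)
  have "card (\<chi> ` triples S) \<le> card (\<chi> ` triples (S - {v}) \<union> \<chi> ` ?bad \<union> \<chi> ` A2 \<union> (\<Union>x\<in>X. g x) \<union> \<chi> ` Cr)"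
    using ft[of "S - {v}"] fbad fg fZ S fP by (intro card_mono[OF _ cover]) (auto simp: A2_def Cr_def)
  also have "\<dots> \<le> card (\<chi> ` triples (S - {v})) + card (\<chi> ` ?bad) + card (\<chi> ` A2) + card (\<Union>x\<in>X. g x) + card (\<chi> ` Cr)"
    by (meson add_le_mono card_Un_le order.trans order_refl)
  finally have c1: "card (\<chi> ` triples S) \<le> card (\<chi> ` triples (S - {v})) + card (\<chi> ` ?bad) + card (\<chi> ` A2) + card (\<Union>x\<in>X. g x) + card (\<chi> ` Cr)" .
  have c2: "card (\<chi> ` ?bad) \<le> l"
    using card_bad_colours[of W] W_typical l by (simp split: if_splits)
  have c3: "card (\<chi> ` A2) \<le> card Z * card S"
  proof -
    have "card (\<chi> ` A2) \<le> card A2" using fZ S by (intro card_image_le) (simp add: A2_def)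
    also have "\<dots> \<le> card (Z \<times> S)" unfolding A2_def using fZ S by (intro card_image_le) simp
    finally show ?thesis by (simp add: card_cartesian_product)
  qed
  have c4: "card (\<Union>x\<in>X. g x) \<le> card S * richness l t E"
  proof -
    have "card (\<Union>x\<in>X. g x) \<le> (\<Sum>x\<in>X. card (g x))" by (rule card_UN_le[OF fX])
    also have "\<dots> \<le> (\<Sum>x\<in>X. richness l t E)" using v by (intro sum_mono) (auto simp: X_def g_def adj_def)
    also have "\<dots> \<le> card S * richness l t E"
      using S by (simp add: card_mono X_def)
    finally show ?thesis .
  qed
  have c5: "card (\<chi> ` Cr) \<le> card P"
  proof -
    have "card (\<chi> ` Cr) \<le> card Cr" using fP by (intro card_image_le) (simp add: Cr_def)
    also have "\<dots> \<le> card P" unfolding Cr_def using fP by (intro card_image_le)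
    finally show ?thesis .
  qed
  have Ndisj: "N i \<inter> N j = {}" if "i \<in> {1..l}" "j \<in> {1..l}" "i \<noteq> j" for i j
    using Wdisj that unfolding disjoint_family_on_def N_def by blast
  have cQ: "card Q = (\<Sum>j\<in>{1..l}. y j)"
    unfolding Q_def y_def N_def[symmetric] using fN Ndisj by (intro card_UN_disjoint) auto
  define D3 where "D3 = (\<Union>j\<in>{1..l}. N j \<times> N j)"
  have cD: "card D3 = (\<Sum>j\<in>{1..l}. y j ^ 2)"
  proof -
    have "card D3 = (\<Sum>j\<in>{1..l}. card (N j \<times> N j))"
      unfolding D3_def using fN Ndisj by (intro card_UN_disjoint) blast+
    then show ?thesis by (simp add: card_cartesian_product power2_eq_square y_def N_def)
  qed
  have sw: "card (prod.swap ` P) = card P" by (intro card_image) (auto intro: inj_onI)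
  have d1: "P \<inter> prod.swap ` P = {}" by (auto simp: P_def)
  have d2: "(P \<union> prod.swap ` P) \<inter> D3 = {}"
  proof -
    have "\<not> ((a, b) \<in> P \<or> (b, a) \<in> P)" if "(a, b) \<in> D3" for a b
      using that unfolding D3_def P_def N_def by blast
    then show ?thesis by auto
  qed
  have fD: "finite D3" using fN by (simp add: D3_def)
  have "2 * card P + card D3 = card ((P \<union> prod.swap ` P) \<union> D3)"
    using fP fD d1 d2 sw by (simp add: card_Un_disjoint)
  also have "\<dots> \<le> card (Q \<times> Q)"
    using fQ by (intro card_mono) (auto simp: P_def D3_def Q_def)
  also have "\<dots> = (\<Sum>j\<in>{1..l}. y j) ^ 2" by (simp add: card_cartesian_product cQ power2_eq_square)
  finally have c6: "2 * card P + (\<Sum>j\<in>{1..l}. y j ^ 2) \<le> (\<Sum>j\<in>{1..l}. y j) ^ 2" using cD by simp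
  have aux: "2 * c + Y \<le> 2 * (c' + b' + a' + g') + Y'"
    if "c \<le> c' + b + a + g + r" "b \<le> b'" "a \<le> a'" "g \<le> g'" "r \<le> r'" "2 * r' + Y \<le> Y'"
    for c c' b b' a a' g g' r r' Y Y' :: nat
  proof -
    have "c' + b + a + g + r \<le> c' + b' + a' + g' + r'" using that(2-5) by (intro add_mono) auto
    then have "2 * c \<le> 2 * (c' + b' + a' + g' + r')" using that(1) by (intro mult_le_mono2) (rule order.trans)
    then have "2 * c + Y \<le> 2 * (c' + b' + a' + g' + r') + Y" by (rule add_right_mono)
    also have "\<dots> = 2 * (c' + b' + a' + g') + (2 * r' + Y)" by (simp only: distrib_left add.assoc)
    also have "\<dots> \<le> 2 * (c' + b' + a' + g') + Y'" using that(6) by (rule add_left_mono)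
    finally show ?thesis .
  qed
  show ?thesis by (rule aux[OF c1 c2 c3[unfolded Z_def] c4 c5 c6])
qed

text \<open>If \<open>v\<close> had many neighbours in every part, a blowup with \<open>v\<close> as
  \<open>(1, 1)\<close> and all other vertices in its neighbourhood would have an edge inside part
  1. So \<open>v\<close> has few neighbours in some part \<open>k\<close>, and its many private
  colours then force \<open>v\<close> to be adjacent to almost all of every other part.\<close>

lemma every_vertex_typical:
  fixes q n :: real
  assumes q: "q = 1 / (100 * real l ^ 3 * real t)" and n: "n = real (card S)"
    and mm: "m = q * n" "m' = 6 * real l ^ 2 * real t * q * n"
    and Ws: "\<And>i. i \<in> {1..l} \<Longrightarrow> real (card (W i)) \<ge> (1 / real l - q) * n"
    and nq: "q * n \<ge> real (l * t)" "q * n \<ge> 2 * real (richness l t E) + 2 * real l"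
    and v: "v \<in> S"
    and new: "2 * real (card (\<chi> ` triples S)) \<ge> 2 * real (card (\<chi> ` triples (S - {v}))) + ((1 - 1 / real l) * (1 - 2 / real l) - 2 * q) * n^2"
  shows "\<exists>k\<in>{1..l}. typical k v"
proof -
  define L T where "L = real l" and "T = real t"
  have L: "L \<ge> 3" and T: "T \<ge> 4" using l tl by (auto simp: L_def T_def)
  have q0: "q > 0" using L T by (simp add: q L_def[symmetric] T_def[symmetric])
  have "card S > 0" using v S by (auto simp: card_gt_0_iff)
  then have n1: "n \<ge> 1" by (simp add: n)
  define N where "N j = {x\<in>W j. adj v x}" for j
  define y where "y j = real (card (N j))" for j
  define B where "B = (1/L + L * q) * n"
  have fN: "finite (N j)" for j using finite_W by (simp add: N_def)
  have sW: "(\<Sum>j\<in>{1..l}. real (card (W j))) = real (card (\<Union>j\<in>{1..l}. W j))"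
  proof -
    have "card (\<Union>j\<in>{1..l}. W j) = (\<Sum>j\<in>{1..l}. card (W j))"
      using finite_W Wdisj by (intro card_UN_disjoint) (auto simp: disjoint_family_on_def)
    then show ?thesis by simp
  qed
  have UW: "card (\<Union>j\<in>{1..l}. W j) \<le> card S" using WS S by (intro card_mono) auto
  have WB: "real (card (W i)) \<le> B" if i: "i \<in> {1..l}" for i
  proof -
    have "(\<Sum>j\<in>{1..l} - {i}. (1 / L - q) * n) \<le> (\<Sum>j\<in>{1..l} - {i}. real (card (W j)))"
      using Ws by (intro sum_mono) (auto simp: L_def)
    moreover have "(\<Sum>j\<in>{1..l} - {i}. (1 / L - q) * n) = (L - 1) * ((1 / L - q) * n)"
      using i by (simp add: L_def of_nat_diff)
    moreover have "(\<Sum>j\<in>{1..l}. real (card (W j))) = real (card (W i)) + (\<Sum>j\<in>{1..l} - {i}. real (card (W j)))"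
      using i by (intro sum.remove) auto
    ultimately have "real (card (W i)) + (L - 1) * ((1 / L - q) * n) \<le> n"
      using sW UW n by linarith
    moreover have "n - (L - 1) * ((1 / L - q) * n) = (1/L + (L - 1) * q) * n" using L by (simp add: field_simps)
    moreover have "(1/L + (L - 1) * q) * n \<le> B" unfolding B_def using q0 n1
      by (intro mult_right_mono add_left_mono) auto
    ultimately show ?thesis by linarith
  qed
  have Zc: "real (card (S - (\<Union>j\<in>{1..l}. W j))) \<le> L * q * n"
  proof -
    have "(\<Sum>j\<in>{1..l}. (1 / L - q) * n) \<le> (\<Sum>j\<in>{1..l}. real (card (W j)))"
      using Ws by (intro sum_mono) (auto simp: L_def)
    moreover have "(\<Sum>j\<in>{1..l}. (1 / L - q) * n) = n - L * q * n" using L by (simp add: L_def[symmetric] field_simps)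
    moreover have "card (S - (\<Union>j\<in>{1..l}. W j)) = card S - card (\<Union>j\<in>{1..l}. W j)"
      using WS finite_W by (intro card_Diff_subset) auto
    ultimately show ?thesis using sW UW n by (simp add: of_nat_diff)
  qed
  have yB: "0 \<le> y i \<and> y i \<le> B" if "i \<in> {1..l}" for i
  proof -
    have "card (N i) \<le> card (W i)" using finite_W by (intro card_mono) (auto simp: N_def)
    then show ?thesis using WB[OF that] by (simp add: y_def)
  qed
  have ysum: "(\<Sum>i\<in>{1..l}. y i) \<le> n"
  proof -
    have "(\<Sum>i\<in>{1..l}. y i) \<le> (\<Sum>i\<in>{1..l}. real (card (W i)))"
      unfolding y_def using finite_W by (intro sum_mono of_nat_mono card_mono) (auto simp: N_def)
    then show ?thesis using sW UW n by simp
  qed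
  have big: "(\<Sum>i\<in>{1..l}. y i)^2 - (\<Sum>i\<in>{1..l}. y i ^ 2) \<ge> ((1 - 1/L) * (1 - 2/L) - 3 * L * q) * n^2"
  proof -
    have "real (2 * card (\<chi> ` triples S) + (\<Sum>j\<in>{1..l}. card (N j) ^ 2)) \<le>
      real (2 * (card (\<chi> ` triples (S - {v})) + l + card (S - (\<Union>j\<in>{1..l}. W j)) * card S + card S * richness l t E)
        + (\<Sum>j\<in>{1..l}. card (N j)) ^ 2)"
      using card_new_colours_le[OF v] unfolding N_def by (simp only: of_nat_le_iff)
    then have "2 * real (card (\<chi> ` triples S)) + (\<Sum>i\<in>{1..l}. y i ^ 2) \<le>
      2 * real (card (\<chi> ` triples (S - {v}))) + 2 * L + 2 * (real (card (S - (\<Union>j\<in>{1..l}. W j))) * n) + 2 * (n * real (richness l t E))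
       + (\<Sum>i\<in>{1..l}. y i)^2"
      by (simp add: y_def n L_def)
    moreover have "real (card (S - (\<Union>j\<in>{1..l}. W j))) * n \<le> L * q * n * n"
      using Zc n1 by (intro mult_right_mono) auto
    moreover have "2 * L + 2 * (n * real (richness l t E)) \<le> q * n^2"
    proof -
      have "(2 * real (richness l t E) + 2 * L) * n \<le> (q * n) * n" using nq(2) n1 by (intro mult_right_mono) (auto simp: L_def)
      moreover have "2 * L * 1 \<le> 2 * L * n" using n1 L by (intro mult_left_mono) auto
      ultimately show ?thesis by (simp add: power2_eq_square algebra_simps)
    qed
    ultimately have "((1 - 1/L) * (1 - 2/L) - 2 * q) * n^2 \<le> 2 * (L * q * n * n) + q * n^2 + (\<Sum>i\<in>{1..l}. y i)^2 - (\<Sum>i\<in>{1..l}. y i ^ 2)"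
      using new unfolding L_def by linarith
    moreover have "3 * (q * n^2) \<le> L * (q * n^2)" using L q0 by (intro mult_right_mono) auto
    ultimately show ?thesis by (simp add: power2_eq_square algebra_simps)
  qed
  \<comment> \<open>The threshold is what \<open>greedy_extension\<close> needs for
    \<open>m = q * n\<close>, the additional \<open>q * n\<close> covering
    \<open>l * t\<close>.\<close>
  have "\<exists>k\<in>{1..l}. y k \<le> (L * T + 1) * q * n"
  proof (rule ccontr)
    assume "\<not> ?thesis"
    then have yb: "y k > (L * T + 1) * q * n" if "k \<in> {1..l}" for k using that by force
    define \<psi> where "\<psi> z = v" for z :: "nat \<times> nat"
    have "\<exists>\<phi>. inj_on \<phi> grid \<and> \<phi> ` grid \<subseteq> S \<and> cross_adj \<phi> grid \<and> (\<forall>z\<in>{(1, 1)}. \<phi> z = \<psi> z) \<and>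
      (\<forall>z\<in>grid - {(1, 1)}. \<phi> z \<in> N (fst z) - {})"
    proof (rule greedy_extension[where W = W and m = m])
      show "real (card {u\<in>W j. \<not> adj v u}) \<le> m" if "i \<in> {1..l}" "j \<in> {1..l}" "i \<noteq> j" "v \<in> W i" for i j v
        using miss that by blast
      show "{(1, 1)} \<subseteq> grid" using special_edges(1) by blast
      show "real (card (N j)) > l * t * m + l * t + card {}" if "j \<in> {1..l}" for j
        using yb[OF that] nq(1) by (simp add: y_def mm(1) L_def T_def algebra_simps)
    qed (use WS m v in \<open>auto simp: N_def \<psi>_def cross_adj_def\<close>)
    then obtain \<phi> where phi: "inj_on \<phi> grid" "\<phi> ` grid \<subseteq> S" "cross_adj \<phi> grid" "\<phi> (1, 1) = v"
      "\<forall>z\<in>grid - {(1, 1)}. \<phi> z \<in> N (fst z)" by (auto simp: \<psi>_def)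
    have "(1, 2) \<in> grid - {(1, 1)}" using special_edges(1) by auto
    from bspec[OF phi(5) this] have "\<phi> (1, 2) \<in> N 1" by simp
    then have "adj (\<phi> (1, 1)) (\<phi> (1, 2))" using phi(4) by (simp add: N_def)
    then show False using no_blowup_plus_edge[OF phi(1-3)] by blast
  qed
  then obtain k where k: "k \<in> {1..l}" "y k \<le> (L * T + 1) * q * n" by blast
  have "typical k v" unfolding typical_def
  proof (intro conjI ballI impI)
    fix j assume j: "j \<in> {1..l}" "j \<noteq> k"
    have q': "q = 1 / (100 * real l ^ 3 * real t)" by (rule q)
    have "B - y j \<le> 6 * real l ^ 2 * real t * q * n"
    proof (rule near_full_link[OF l tl q'])
      show "n > 0" using n1 by simp
      show "B = (1 / real l + real l * q) * n" by (simp add: B_def L_def)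
      show "y k \<le> (real l * real t + 1) * q * n" using k(2) by (simp add: L_def T_def)
      show "((1 - 1 / real l) * (1 - 2 / real l) - 3 * real l * q) * n\<^sup>2 \<le> (\<Sum>i = 1..l. y i)\<^sup>2 - (\<Sum>i = 1..l. (y i)\<^sup>2)"
        using big by (simp only: L_def)
    qed (use yB ysum k j in auto)
    moreover have "real (card {u\<in>W j. \<not> adj v u}) = real (card (W j)) - y j"
    proof -
      have "{u\<in>W j. \<not> adj v u} = W j - N j" by (auto simp: N_def)
      moreover have "card (W j - N j) = card (W j) - card (N j)" using fN by (intro card_Diff_subset) (auto simp: N_def)
      moreover have "card (N j) \<le> card (W j)" using finite_W by (intro card_mono) (auto simp: N_def)
      ultimately show ?thesis by (simp add: y_def of_nat_diff)
    qed
    ultimately show "real (card {u\<in>W j. \<not> adj v u}) \<le> m'" using WB[OF j(1)] mm(2) by linarith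
  qed (rule v)
  then show ?thesis using k(1) by blast
qed

text \<open>Every vertex joins a part for which it is typical. The resulting partition need not be
  balanced, but its transversal triples carry at most as many colours as the Turan number, and all
  other triples only \<open>l\<close> colours or a single one.\<close>

lemma colours_le_turan:
  assumes "\<And>v. v \<in> S \<Longrightarrow> \<exists>k\<in>{1..l}. typical k v"
  shows "card (\<chi> ` triples S) \<le> turan_number 3 (card S) l + (if E = {(2, 1), (2, 2)} then 1 else l)"
proof -
  obtain k where k: "\<And>v. v \<in> S \<Longrightarrow> k v \<in> {1..l} \<and> typical (k v) v" using assms by metis
  define U where "U i = {v\<in>S. k v = i}" for i
  let ?bad = "\<Union>i\<in>{1..l}. bad U i"
  have "triples S \<subseteq> cross_triples k S \<union> ?bad"
  proof
    fix e assume e: "e \<in> triples S"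
    show "e \<in> cross_triples k S \<union> ?bad"
    proof (cases "inj_on k e")
      case False
      then obtain u v where uv: "u \<in> e" "v \<in> e" "u \<noteq> v" "k u = k v" by (auto simp: inj_on_def)
      have S': "u \<in> S" "v \<in> S" using e uv by (auto simp: triples_def)
      have "e \<in> bad U (k u)" unfolding bad_def U_def using e uv S' by auto
      moreover have "k u \<in> {1..l}" using k S' by blast
      ultimately show ?thesis by blast
    qed (use e in \<open>simp add: cross_triples_def\<close>)
  qed
  then have "\<chi> ` triples S \<subseteq> \<chi> ` cross_triples k S \<union> \<chi> ` ?bad" by blast
  moreover have fc: "finite (cross_triples k S)" "finite ?bad"
    using finite_triples[OF S] by (auto simp: cross_triples_def bad_def)
  ultimately have "card (\<chi> ` triples S) \<le> card (\<chi> ` cross_triples k S \<union> \<chi> ` ?bad)" by (intro card_mono) auto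
  also have "\<dots> \<le> card (\<chi> ` cross_triples k S) + card (\<chi> ` ?bad)" by (rule card_Un_le)
  also have "card (\<chi> ` cross_triples k S) \<le> card (cross_triples k S)" using fc by (intro card_image_le)
  also have "card (cross_triples k S) \<le> turan_number 3 (card S) l"
    using l k by (intro card_cross_triples_le_turan[OF S]) auto
  also have "card (\<chi> ` ?bad) \<le> (if E = {(2, 1), (2, 2)} then 1 else l)"
    by (rule card_bad_colours) (use k in \<open>auto simp: U_def\<close>)
  finally show ?thesis by simp
qed

end

section \<open>The anti-Ramsey number\<close>

text \<open>Meant for the vertex set supplied by \<open>colour_dense_subset\<close>. Without a
  rainbow copy \<open>colours_le_turan\<close> would allow a surplus of at most \<open>K\<close>
  over the Turan number. The parameters are chosen in the order \<open>q\<close>, \<open>d\<close>,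
  \<open>nE\<close>, \<open>n1\<close>.\<close>

lemma rainbow_pattern_in_dense_colouring:
  assumes l: "3 \<le> l" and tl: "l < t" and E: "E \<in> {{(1, 2), (1, 3)}, {(1, 3), (1, 4)}, {(2, 1), (2, 2)}}"
  defines "K \<equiv> (if E = {(2, 1), (2, 2)} then 1 else l)"
  shows "\<exists>n1. \<forall>(S::nat set) (\<chi>::nat set \<Rightarrow> nat). finite S \<longrightarrow> n1 \<le> card S \<longrightarrow>
    card (\<chi> ` triples S) \<ge> turan_number 3 (card S) l + (K + 1) \<longrightarrow>
    (\<forall>v\<in>S. card (\<chi> ` triples S) + turan_number 3 (card S - 1) l \<ge> card (\<chi> ` triples (S - {v})) + turan_number 3 (card S) l) \<longrightarrow>
    (\<exists>H \<subseteq> triples S. is_copy_of H (expansion (pattern l t E)) \<and> rainbow \<chi> H)"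
proof -
  define L T where "L = real l" and "T = real t"
  have L: "L \<ge> 3" and T: "T \<ge> 4" using l tl by (auto simp: L_def T_def)
  \<comment> \<open>The value fixed in \<open>near_full_link\<close>; with it \<open>m'\<close>
    below is 6 percent of the ideal part size \<open>n / l\<close>.\<close>
  define q where "q = 1 / (100 * real l ^ 3 * real t)"
  have qLT: "q = 1 / (100 * L ^ 3 * T)" by (simp add: q_def L_def T_def)
  have q0: "q > 0" using L T by (simp add: qLT)
  define A where "A = (1 - 1 / real l) * (1 - 2 / real l)"
  have A1: "0 \<le> A" "A \<le> 1"
  proof -
    have "2 / real l \<le> 1" using l by simp
    then show "0 \<le> A" unfolding A_def using l by (intro mult_nonneg_nonneg) auto
    have "A \<le> 1 * 1" unfolding A_def using \<open>2 / real l \<le> 1\<close> by (intro mult_mono) auto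
    then show "A \<le> 1" by simp
  qed
  define R where "R = richness l t E"
  obtain d :: real where d: "d > 0" and stab: "\<forall>(S::nat set) adj. finite_graph S adj \<longrightarrow> S \<noteq> {} \<longrightarrow>
    real (card (finite_graph.cliques S adj 3)) \<ge> ((1 - 1/l) * (1 - 2/l) - d) * card S ^ 3 \<longrightarrow>
    real (card (finite_graph.cliques S adj (Suc l))) \<le> d * card S ^ (Suc l) \<longrightarrow>
    (\<exists>W. disjoint_family_on W {1..l} \<and> (\<forall>i. W i \<subseteq> S) \<and>
      (\<forall>i\<in>{1..l}. real (card (W i)) \<ge> (1/l - q) * card S) \<and>
      (\<forall>i\<in>{1..l}. \<forall>j\<in>{1..l}. i \<noteq> j \<longrightarrow> (\<forall>v\<in>W i. real (card {u\<in>W j. \<not> adj v u}) \<le> q * card S)))"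
    using triangle_stability[OF l q0] by (elim exE conjE)
  have "1 \<le> t" using tl by simp
  obtain nE where nE: "\<forall>S::nat set. \<forall>R. finite S \<longrightarrow> card S \<ge> nE \<longrightarrow>
    R \<subseteq> {xs. set xs \<subseteq> S \<and> length xs = Suc l} \<longrightarrow> real (card R) \<ge> d * real (card S) ^ Suc l \<longrightarrow>
    (\<exists>As. length As = Suc l \<and> (\<forall>A\<in>set As. A \<subseteq> S \<and> card A = t) \<and> listset As \<subseteq> R)"
    using blowup_in_dense_relation[OF d \<open>1 \<le> t\<close>, where r = "Suc l" and 'a = nat] by (elim exE)
  \<comment> \<open>Beyond \<open>c1\<close> the quadratic errors in the triangle count are at most
    \<open>d * n^3\<close>; beyond \<open>c2\<close> the constants occurring in
    \<open>every_vertex_typical\<close> are at most \<open>q * n\<close>.\<close>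
  define c1 c2 where "c1 = (30 * L + 6 * real R) / d" and "c2 = (2 * real R + 20 * L + L * T) / q"
  define n1 where "n1 = nE + l * t + l + 2 + nat \<lceil>c1\<rceil> + nat \<lceil>c2\<rceil> + 2 * l * (l * t + 13)"
  show ?thesis
  proof (intro exI[of _ n1] allI impI)
    fix S :: "nat set" and \<chi> :: "nat set \<Rightarrow> nat"
    assume S: "finite S" and nS: "n1 \<le> card S" and col: "turan_number 3 (card S) l + (K + 1) \<le> card (\<chi> ` triples S)"
      and priv: "\<forall>v\<in>S. card (\<chi> ` triples (S - {v})) + turan_number 3 (card S) l \<le> card (\<chi> ` triples S) + turan_number 3 (card S - 1) l"
    define n where "n = real (card S)"
    have big1: "card S \<ge> nE" "card S > l * t" "card S \<ge> l + 1" "card S \<ge> 2 * l * (l * t + 13)"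
      using nS by (auto simp: n1_def)
    have "nat \<lceil>c1\<rceil> \<le> card S" "nat \<lceil>c2\<rceil> \<le> card S" using nS unfolding n1_def by linarith+
    then have "real (nat \<lceil>c1\<rceil>) \<le> n" "real (nat \<lceil>c2\<rceil>) \<le> n" unfolding n_def by (simp_all only: of_nat_le_iff)
    then have "c1 \<le> n" "c2 \<le> n" by linarith+
    then have big2: "30 * L + 6 * real R \<le> d * n" and big3: "2 * real R + 20 * L + L * T \<le> q * n"
      using d q0 by (auto simp: c1_def c2_def pos_divide_le_eq mult.commute)
    have big4: "2 * L * (L * T + 13) \<le> n"
    proof -
      have "real (2 * l * (l * t + 13)) \<le> n" using big1(4) unfolding n_def by (simp only: of_nat_le_iff)
      then show ?thesis by (simp add: L_def T_def)
    qed
    have n1: "n \<ge> 1" using big1 by (simp add: n_def)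
    show "\<exists>H \<subseteq> triples S. is_copy_of H (expansion (pattern l t E)) \<and> rainbow \<chi> H"
    proof (rule ccontr)
      assume neg: "\<not> ?thesis"
      interpret coloured_triples l t E \<chi> S
        by unfold_locales (use l tl S big1 E neg in auto)
      have few: "real (card (cliques (Suc l))) \<le> d * card S ^ (Suc l)"
      proof (rule ccontr)
        assume "\<not> ?thesis"
        then have ge: "real (card (cliques (Suc l))) \<ge> d * real (card S) ^ Suc l" by simp
        have sub: "cliques (Suc l) \<subseteq> {xs. set xs \<subseteq> S \<and> length xs = Suc l}" by (auto simp: cliques_def)
        obtain As where "length As = Suc l" "\<forall>A\<in>set As. A \<subseteq> S \<and> card A = t" "listset As \<subseteq> cliques (Suc l)"
          using nE[rule_format, OF S big1(1) sub ge] by blast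
        then show False using no_complete_blowup[of As] by blast
      qed
      have many: "real (card (cliques 3)) \<ge> ((1 - 1/l) * (1 - 2/l) - d) * card S ^ 3"
      proof -
        have "real (6 * card (\<chi> ` triples S)) \<le> real (card (cliques 3) + 6 * richness l t E * card S ^ 2)"
          using card_colours_le_cliques by (simp only: of_nat_le_iff)
        then have "6 * real (card (\<chi> ` triples S)) \<le> real (card (cliques 3)) + 6 * real R * n^2"
          by (simp add: R_def n_def)
        moreover have "turan_number 3 (card S) l \<le> card (\<chi> ` triples S)" using col by simp
        then have "6 * real (turan_number 3 (card S) l) \<le> 6 * real (card (\<chi> ` triples S))" by simp
        moreover have "6 * real (turan_number 3 (card S) l) \<ge> A * n ^ 3 - 30 * (L * n ^ 2)"
          using turan_number_lower_bounds(1)[OF l, of "card S"] big1(3) by (simp add: A_def n_def L_def)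
        moreover have "(30 * L + 6 * real R) * n^2 \<le> (d * n) * n^2" using big2 by (intro mult_right_mono) auto
        ultimately have "real (card (cliques 3)) \<ge> (A - d) * n ^ 3"
          by (simp add: algebra_simps power2_eq_square power3_eq_cube)
        then show ?thesis by (simp add: A_def n_def)
      qed
      have Sne: "S \<noteq> {}" using big1 by auto
      obtain W where W: "disjoint_family_on W {1..l}" "\<forall>i. W i \<subseteq> S"
        "\<forall>i\<in>{1..l}. real (card (W i)) \<ge> (1/l - q) * card S"
        "\<forall>i\<in>{1..l}. \<forall>j\<in>{1..l}. i \<noteq> j \<longrightarrow> (\<forall>v\<in>W i. real (card {u\<in>W j. \<not> adj v u}) \<le> q * card S)"
        using stab[rule_format, OF finite_graph_axioms Sne many few] by (elim exE conjE)
      define m m' where "m = q * n" and "m' = 6 * real l ^ 2 * real t * q * n"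
      have s1: "L ^ 2 * T * q = 1 / (100 * L)" using L T by (simp add: qLT power2_eq_square power3_eq_cube)
      have mm': "m \<le> m'"
      proof -
        have "1 * 1 \<le> L^2 * T" using L T by (intro mult_mono one_le_power) auto
        then have "1 * (q * n) \<le> (6 * (L^2 * T)) * (q * n)" using q0 n1 by (intro mult_right_mono) auto
        then show ?thesis by (simp add: m_def m'_def L_def T_def algebra_simps)
      qed
      \<comment> \<open>In units of \<open>x = n / L\<close>: \<open>4 * m'\<close> is 24 percent,
        \<open>l * t * m\<close> at most one percent, and the constants at most half by the last
        summand of \<open>n1\<close>, while a part has at least 99 percent.\<close>
      have Wbig: "4 * m' + l * t * m + l * t + 12 < real (card (W j))" if "j \<in> {1..l}" for j
      proof -
        have "m' = 6 * (L ^ 2 * T * q) * n" by (simp add: m'_def L_def T_def)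
        then have e1: "m' = 6 * ((n / L) / 100)" unfolding s1 by simp
        have e2: "L * T * q \<le> 1 / (100 * L)" "q \<le> 1 / (100 * L)"
        proof -
          have "1 * (L * T * q) \<le> L * (L * T * q)" using L T q0 by (intro mult_right_mono) auto
          then show a: "L * T * q \<le> 1 / (100 * L)" using s1 by (simp add: power2_eq_square mult.assoc)
          have "1 * 1 \<le> L * T" using L T by (intro mult_mono) auto
          then have "1 * q \<le> (L * T) * q" using q0 by (intro mult_right_mono) auto
          then show "q \<le> 1 / (100 * L)" using a by simp
        qed
        have n0: "0 \<le> n" using n1 by simp
        define x where "x = n / L"
        have x: "1 / (100 * L) * n = x / 100" "n / (2 * L) = x / 2" by (simp_all add: x_def)
        have f1: "L * T * q * n \<le> x / 100" and f2: "q * n \<le> x / 100"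
          using mult_right_mono[OF e2(1) n0] mult_right_mono[OF e2(2) n0] by (simp_all only: x)
        have "(1/L - q) * n = x - q * n" by (simp add: x_def algebra_simps)
        then have f3: "x - q * n \<le> real (card (W j))" using W(3) that by (simp add: L_def n_def)
        have "L * T + 13 \<le> n / (2 * L)" using big4 L by (simp add: field_simps)
        then have f4: "L * T + 13 \<le> x / 2" by (simp only: x)
        have f5: "0 \<le> x" using n0 L by (simp add: x_def)
        have aux: "4 * (6 * (x/100)) + a + b + 12 < w" if "a \<le> x/100" "c \<le> x/100" "x - c \<le> w" "b + 13 \<le> x/2"
          for a b c w :: real using that f5 by linarith
        have "4 * m' + l * t * m + l * t + 12 = 4 * (6 * (x/100)) + L * T * q * n + L * T + 12"
          using e1 by (simp add: m_def L_def T_def x_def)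
        also have "\<dots> < real (card (W j))" by (rule aux[OF f1 f2 f3 f4])
        finally show ?thesis .
      qed
      interpret typical_base l t E \<chi> S W m m'
        using W q0 n1 mm' Wbig by unfold_locales (auto simp: m_def n_def)
      have "card (\<chi> ` triples S) \<le> turan_number 3 (card S) l + K"
        unfolding K_def
      proof (rule colours_le_turan)
        fix v assume v: "v \<in> S"
        show "\<exists>k\<in>{1..l}. typical k v"
        proof (rule every_vertex_typical[OF q_def n_def m_def m'_def _ _ _ v])
          show "(1 / real l - q) * n \<le> real (card (W i))" if "i \<in> {1..l}" for i
            using W(3) that by (simp add: n_def)
          have R0: "real R \<ge> 0" by simp
          show "real (l * t) \<le> q * n" using big3 L R0 by (simp add: L_def T_def)
          have "L * T \<ge> 0" using L T by simp
          then show "2 * real (richness l t E) + 2 * real l \<le> q * n" using big3 L by (simp add: R_def[symmetric] L_def[symmetric])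
          \<comment> \<open>The increment of the Turan number is known from \<open>s\<close> to
            \<open>Suc s\<close>, so its main term appears with \<open>(n - 1)^2\<close>; the slack
            \<open>2 * q * n^2\<close> absorbs the difference and the linear error.\<close>
          define s where "s = card S - 1"
          have s: "card S = Suc s" "s \<ge> l" using big1(3) by (auto simp: s_def)
          have sn: "real s = n - 1" using s by (simp add: n_def)
          have inc: "6 * real (turan_number 3 (card S) l) \<ge> 6 * real (turan_number 3 s l) + 3 * A * (n - 1)^2 - 50 * (L * (n - 1))"
          proof -
            have "3 * (1 - 1 / real l) * (1 - 2 / real l) * real s ^ 2 = 3 * A * (n - 1)^2"
              by (simp only: A_def sn mult.assoc)
            then show ?thesis using turan_number_lower_bounds(2)[OF l s(2)] unfolding s(1) sn L_def by linarith
          qed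
          have p: "real (card (\<chi> ` triples (S - {v}))) + real (turan_number 3 (card S) l)
             \<le> real (card (\<chi> ` triples S)) + real (turan_number 3 s l)"
            using priv[rule_format, OF v] unfolding s_def[symmetric] by (simp only: of_nat_add[symmetric] of_nat_le_iff)
          have aux: "3 * (P - 2 * Q) \<le> 3 * M - 50 * (Ln - L)"
            if "M = P - 2 * An + A" "An \<le> n" "3 * n \<le> Ln" "20 * Ln \<le> Q" for P Q M Ln An :: real
            using that A1 L n1 by simp
          have i1: "A * (n - 1)^2 = A * n^2 - 2 * (A * n) + A" by (simp add: power2_eq_square algebra_simps)
          have i2: "A * n \<le> n" using A1 n1 mult_right_mono[of A 1 n] by simp
          have i3: "3 * n \<le> L * n" using L n1 by (intro mult_right_mono) auto
          have "20 * L \<le> q * n" using big3 \<open>L * T \<ge> 0\<close> R0 by linarith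
          then have "20 * L * n \<le> q * n * n" using n1 by (intro mult_right_mono) auto
          then have i4: "20 * (L * n) \<le> q * n^2" by (simp add: power2_eq_square mult.assoc)
          have i5: "3 * A * (n - 1)^2 - 50 * (L * (n - 1)) = 3 * (A * (n - 1)^2) - 50 * (L * n - L)"
            by (simp add: right_diff_distrib)
          have i6: "(A - 2 * q) * n^2 = A * n^2 - 2 * (q * n^2)" by (simp add: left_diff_distrib)
          have aux2: "2 * s' + Y \<le> 2 * c" if "6 * t1 + M \<le> 6 * t2" "s' + t2 \<le> c + t1" "3 * Y \<le> M"
            for s' Y c t1 t2 M :: real using that by linarith
          have inc': "6 * real (turan_number 3 s l) + (3 * A * (n - 1)^2 - 50 * (L * (n - 1))) \<le> 6 * real (turan_number 3 (card S) l)"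
            using inc by (simp only: add_diff_eq)
          have "2 * real (card (\<chi> ` triples (S - {v}))) + (A * n^2 - 2 * (q * n^2)) \<le> 2 * real (card (\<chi> ` triples S))"
            by (rule aux2[OF inc' p]) (unfold i5, rule aux[OF i1 i2 i3 i4])
          then show "2 * real (card (\<chi> ` triples (S - {v}))) + ((1 - 1 / real l) * (1 - 2 / real l) - 2 * q) * n\<^sup>2
            \<le> 2 * real (card (\<chi> ` triples S))"
            unfolding A_def[symmetric] i6 .
        qed
      qed
      then show False using col by simp
    qed
  qed
qed

lemma anti_ramsey_pattern:
  assumes l: "3 \<le> l" and tl: "l < t" and E: "E \<in> {{(1, 2), (1, 3)}, {(1, 3), (1, 4)}, {(2, 1), (2, 2)}}"
  shows "\<forall>\<^sub>F n in sequentially. anti_ramsey n (expansion (pattern l t E)) =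
    turan_number 3 n l + (if E = {(2, 1), (2, 2)} then 1 else l) + 1"
proof -
  define K where "K = (if E = {(2, 1), (2, 2)} then 1 else l)"
  \<comment> \<open>Extra edges in different parts may become monochromatic in different classes, so
    then all classes must share a colour; for extra edges in one part the classes keep their own
    colours.\<close>
  define g where "g i = (if E = {(2, 1), (2, 2)} then 1 else i)" for i :: nat
  have g: "g ` {1..l} = {1..K}"
    using l by (cases "E = {(2, 1), (2, 2)}") (simp_all add: g_def K_def image_constant_conv)
  obtain n1 where n1: "\<forall>(S::nat set) (\<chi>::nat set \<Rightarrow> nat). finite S \<longrightarrow> n1 \<le> card S \<longrightarrow>
    card (\<chi> ` triples S) \<ge> turan_number 3 (card S) l + (K + 1) \<longrightarrow>
    (\<forall>v\<in>S. card (\<chi> ` triples S) + turan_number 3 (card S - 1) l \<ge> card (\<chi> ` triples (S - {v})) + turan_number 3 (card S) l) \<longrightarrow>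
    (\<exists>H \<subseteq> triples S. is_copy_of H (expansion (pattern l t E)) \<and> rainbow \<chi> H)"
    using rainbow_pattern_in_dense_colouring[OF l tl E] unfolding K_def by (elim exE)
  have mono: "\<exists>u v x y. {u, v} \<in> pattern l t E \<and> {x, y} \<in> pattern l t E \<and> {u, v} \<noteq> {x, y} \<and> u \<noteq> v \<and> x \<noteq> y \<and>
        q u = q v \<and> q x = q y \<and> g (q u) = g (q x)"
    if q: "\<And>x. x \<in> \<Union>(pattern l t E) \<Longrightarrow> q x \<in> {1..l}" for q
  proof -
    have l1: "l \<ge> 1" "l \<ge> 2" and t4: "t \<ge> 4" using l tl by auto
    have sub: "blowup_K l t \<subseteq> pattern l t E" by (auto simp: pattern_def)
    have E1: "{(1, 1), (1, 2)} \<in> pattern l t E" and E2: "E \<in> pattern l t E" by (auto simp: pattern_def)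
    have ne: "{(1, 1), (1, 2)} \<noteq> E"
    proof -
      have "(1, 1) \<notin> E" using E by auto
      then show ?thesis by blast
    qed
    consider (a) "E = {(1, 2), (1, 3)}" | (b) "E = {(1, 3), (1, 4)}" | (c) "E = {(2, 1), (2, 2)}" using E by blast
    then show ?thesis
    proof cases
      case a
      show ?thesis
        by (rule two_monochromatic_edges_in_part[OF tl sub q l1(2) E1, where j = 1 and c = 2 and d = 3])
           (use E2 ne t4 l1 in \<open>simp_all only: a[symmetric], simp_all\<close>)
    next
      case b
      show ?thesis
        by (rule two_monochromatic_edges_in_part[OF tl sub q l1(2) E1, where j = 1 and c = 3 and d = 4])
           (use E2 ne t4 l1 in \<open>simp_all only: b[symmetric], simp_all\<close>)
    next
      case c
      have gg: "\<forall>i\<in>{1..l}. \<forall>i'\<in>{1..l}. g i = g i'" using c by (simp add: g_def)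
      show ?thesis
        by (rule two_monochromatic_edges_in_part[OF tl sub q l1(2) E1 _ _ _ _ _ _ disjI2[OF gg],
              where j = 2 and c = 1 and d = 2])
           (use E2 ne t4 l1 in \<open>simp_all only: c[symmetric], simp_all\<close>)
    qed
  qed
  \<comment> \<open>The summands up to \<open>+ 1\<close> meet the demand of
    \<open>colour_dense_subset\<close>; \<open>3 * l\<close> ensures two points in every class of a
    balanced partition.\<close>
  have "anti_ramsey n (expansion (pattern l t E)) = turan_number 3 n l + K + 1" if n: "n \<ge> n1 + n1 ^ 3 + 1 + 3 * l" for n
  proof (rule anti_ramsey_eqI)
    have l1: "1 \<le> l" using l by simp
    obtain p where p: "p ` {1..n} \<subseteq> {1..l}"
      "\<And>i j. i \<in> {1..l} \<Longrightarrow> j \<in> {1..l} \<Longrightarrow> class_size p {1..n} i \<le> class_size p {1..n} j + 1"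
      "turan_number 3 n l = card (cross_triples p {1..n})" using turan_number_colouring[OF l1, of n] by blast
    have s: "(\<Sum>i\<in>{1..l}. class_size p {1..n} i) = n" using sum_class_size[OF _ _ p(1)] by simp
    have big: "class_size p {1..n} i \<ge> 2" if "i \<in> {1..l}" for i
    proof -
      have "real (class_size p {1..n} i) \<ge> real n / real l - 1" using balanced_class_bounds(2)[OF l1 s p(2) that] .
      moreover have "real n / real l \<ge> 3"
      proof -
        have "real (3 * l) \<le> real n" using n by (simp only: of_nat_le_iff)
        then show ?thesis using l by (simp add: field_simps)
      qed
      ultimately have "real (class_size p {1..n} i) \<ge> 2" by linarith
      then show ?thesis by simp
    qed
    have n3: "n \<ge> 3" using n l by simp
    fix m assume "1 \<le> m" "m \<le> turan_number 3 n l + K"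
    then show "\<exists>\<chi>. \<chi> ` triples {1..n} = {1..m} \<and> \<not> (\<exists>H \<subseteq> triples {1..n}. is_copy_of H (expansion (pattern l t E)) \<and> rainbow \<chi> H)"
      unfolding p(3) by (intro rainbow_free_colouring[OF p(1) big n3 g mono])
  next
    fix \<chi> :: "nat set \<Rightarrow> nat"
    assume c: "card (\<chi> ` triples {1..n}) = turan_number 3 n l + K + 1"
    have "\<exists>S \<subseteq> {1..n}. card S \<ge> n1 \<and> card (\<chi> ` triples S) \<ge> turan_number 3 (card S) l + (K + 1) \<and>
      (\<forall>v\<in>S. card (\<chi> ` triples S) + turan_number 3 (card S - 1) l \<ge> card (\<chi> ` triples (S - {v})) + turan_number 3 (card S) l)"
      by (rule colour_dense_subset) (use n c in auto)
    then obtain S where S: "S \<subseteq> {1..n}" "card S \<ge> n1" "card (\<chi> ` triples S) \<ge> turan_number 3 (card S) l + (K + 1)"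
      "\<forall>v\<in>S. card (\<chi> ` triples S) + turan_number 3 (card S - 1) l \<ge> card (\<chi> ` triples (S - {v})) + turan_number 3 (card S) l"
      by blast
    have fS: "finite S" using S(1) finite_subset by blast
    obtain H where "H \<subseteq> triples S" "is_copy_of H (expansion (pattern l t E))" "rainbow \<chi> H"
      using n1[rule_format, OF fS S(2,3)] S(4) by blast
    then show "\<exists>H \<subseteq> triples {1..n}. is_copy_of H (expansion (pattern l t E)) \<and> rainbow \<chi> H"
      using triples_mono[OF S(1)] by blast
  qed
  then show ?thesis unfolding K_def[symmetric] eventually_sequentially by blast
qed

theorem theorem1p4:
  fixes l t :: nat
  assumes "3 \<le> l" and "l < t"
  shows "\<forall>\<^sub>F n in sequentially.
      (\<forall>F \<in> {K_alpha l t, K_beta l t}.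
         anti_ramsey n (expansion F) = turan_number 3 n l + l + 1) \<and>
      anti_ramsey n (expansion (K_gamma l t)) = turan_number 3 n l + 2"
proof -
  have K: "K_alpha l t = pattern l t {(1, 2), (1, 3)}" "K_beta l t = pattern l t {(1, 3), (1, 4)}"
    "K_gamma l t = pattern l t {(2, 1), (2, 2)}"
    by (simp_all add: K_alpha_def K_beta_def K_gamma_def pattern_def)
  have ne: "{(1, 2), (1, 3)} \<noteq> {(2, 1), (2::nat, 2::nat)}" "{(1, 3), (1, 4)} \<noteq> {(2, 1), (2::nat, 2::nat)}"
    by (auto simp: doubleton_eq_iff)
  have e1: "\<forall>\<^sub>F n in sequentially. anti_ramsey n (expansion (K_alpha l t)) = turan_number 3 n l + l + 1"
    using anti_ramsey_pattern[OF assms, of "{(1, 2), (1, 3)}"] ne(1) unfolding K by simp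
  have e2: "\<forall>\<^sub>F n in sequentially. anti_ramsey n (expansion (K_beta l t)) = turan_number 3 n l + l + 1"
    using anti_ramsey_pattern[OF assms, of "{(1, 3), (1, 4)}"] ne(2) unfolding K by simp
  have e3: "\<forall>\<^sub>F n in sequentially. anti_ramsey n (expansion (K_gamma l t)) = turan_number 3 n l + 2"
    using anti_ramsey_pattern[OF assms, of "{(2, 1), (2, 2)}"] unfolding K by simp
  show ?thesis
    using eventually_conj[OF e1 eventually_conj[OF e2 e3]] by (rule eventually_mono) blast
qed

end
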